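(* For each $n\in\mathbb{N}$ and for all $p\in[1,\infty)$, the $p$-reflection distance $d_{\mathcal{R}}^p$ is a pseudometric on $n\text{-Mod}$. Moreover, for $\mathbb{V},\mathbb{W}\in n\text{-Mod}$, $d_{\mathcal{R}}^p(\mathbb{V},\mathbb{W})=0$ if and only if $\mathbb{V}\sim_{\mathcal{S}}\mathbb{W}$, so that $d_{\mathcal{R}}^p$ induces a metric on $n\text{-Mod}/{\sim_{\mathcal{S}}}$.
   Context: **Zigzag modules.** Fix a field $\mathbb{F}$ and $n\in\mathbb{N}$; all vector spaces are finite dimensional over $\mathbb{F}$. A zigzag module of length $n$, $\mathbb{V}=(V_i,p_i)$, consists of vector spaces $V_1,\dots,V_n$ and, for each $1\le i\le n-1$, one linear map $p_i$ (structure map) which is either forward, $V_i\to V_{i+1}$, or backward, $V_{i+1}\to V_i$. The type of $\mathbb{V}$ is the sequence $\tau\in\mathcal{T}_n:=\{\rightarrow,\leftarrow\}^{n-1}$ of directions of $p_1,\dots,p_{n-1}$. $n\text{-Mod}$ is the collection of zigzag modules of length $n$; $\mathrm{Mod}_\tau$ those of type $\tau$. Morphisms in $\mathrm{Mod}_\tau$ are families of linear maps $V_i\to W_i$ commuting with structure maps; an isomorphism has all components bijective; direct sums are componentwise. For $\mathbb{V},\mathbb{W}\in\mathrm{Mod}_\tau$, $\mathbb{W}\preceq\mathbb{V}$ means $\mathbb{V}\cong\mathbb{W}\oplus\mathbb{U}$ for some $\mathbb{U}\in\mathrm{Mod}_\tau$. For $1\le b\le d\le n$, the interval module $\mathbb{I}_\tau([b,d])\in\mathrm{Mod}_\tau$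 has $\mathbb{F}$ at indices $b\le i\le d$ and $0$ elsewhere, with $p_i=\mathrm{id}$ for $b\le i<d$ and $p_i=0$ otherwise; it is simple if $b=d$. Every $\mathbb{V}\in\mathrm{Mod}_\tau$ is a finite direct sum $\bigoplus_{i=1}^N\mathbb{I}_\tau([b_i,d_i])$, uniquely up to order (Krull–Remak–Schmidt, Gabriel); $\mathrm{Dgm}(\mathbb{V})$ is the multiset of the pairs $(b_i,d_i)$. **Equivalence.** If $p_k$ is an isomorphism, $\mathcal{A}_k(\mathbb{V})$ is obtained from $\mathbb{V}$ by replacing $p_k$ with $p_k^{-1}$ (reversing the $k$-th arrow). $\mathbb{V}\sim\mathbb{W}$ means $\mathbb{W}$ is isomorphic to a module obtained from $\mathbb{V}$ by a finite (possibly empty) sequence of such reversals. $\mathbb{W}\precsim\mathbb{V}$ means there is $\mathbb{W}'$ with $\mathbb{W}\sim\mathbb{W}'\preceq\mathbb{V}$. **Reflection functors.** For $2\le k\le n-1$: $\mathcal{L}_k(\mathbb{V})$ is obtained by replacing the part $V_{k-1}\leftrightarrow V_k\leftrightarrow V_{k+1}$ of $\mathbb{V}$ with $V_{k-1}\leftarrow L\to V_{k+1}$, where $L$ is the limit of that part and the maps are the limit projections; $\mathcal{C}_k(\mathbb{V})$ is obtained by replacing it with $V_{k-1}\to C\leftarrow V_{k+1}$, where $C$ is its colimit with the colimit maps. At index $1$: $\mathcal{L}_1^{\rightarrow}$ (resp. $\mathcal{L}_1^{\leftarrow}$) replaces $V_1$ and $p_1$ with $L\to V_2$, where $L$ is the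 limit of $0\to V_1\leftrightarrow V_2$ (resp. $0\leftarrow V_1\leftrightarrow V_2$); $\mathcal{C}_1^{\rightarrow},\mathcal{C}_1^{\leftarrow}$ replace them with $C\leftarrow V_2$, $C$ the colimit of the same respective diagrams. At index $n$: $\mathcal{L}_n^{\rightarrow},\mathcal{L}_n^{\leftarrow},\mathcal{C}_n^{\rightarrow},\mathcal{C}_n^{\leftarrow}$ are defined analogously using $V_{n-1}\leftrightarrow V_n\to 0$ (for $\rightarrow$) and $V_{n-1}\leftrightarrow V_n\leftarrow 0$ (for $\leftarrow$). $\mathcal{R}_k$ denotes any one of the reflection functors at index $k$. **Reflection distance.** $\mathcal{S}(\mathbb{V})$ is $\mathbb{V}$ with all simple interval summands removed: $\mathcal{S}(\mathbb{V})=\bigoplus_{(b,d)\in\mathrm{Dgm}(\mathbb{V}),\,b\ne d}\mathbb{I}([b,d])$ (zero module if there are no such summands). For a finite sequence $\mathfrak{R}=(\mathcal{R}_{k_\ell},\dots,\mathcal{R}_{k_1})$ of reflection functors, $1\le k_i\le n$, set $\mathfrak{R}(\mathbb{V})=(\mathcal{S}\circ\mathcal{R}_{k_\ell}\circ\mathcal{S}\circ\cdots\circ\mathcal{S}\circ\mathcal{R}_{k_1}\circ\mathcal{S})(\mathbb{V})$; for the empty sequence $\varepsilon$, $\varepsilon(\mathbb{V})=\mathcal{S}(\mathbb{V})$. For $p\in[1,\infty)$, $C_p(\mathfrak{R})=\ell^{1/p}$ for a nonempty sequence of length $\ell$, $C_p(\varepsilon)=0$. The $p$-reflection distance is $$d_{\mathcal{R}}^p(\mathbb{V},\mathbb{W})=\min_{(\mathfrak{R},\mathfrak{R}')}\big\{\max\{C_p(\mathfrak{R}),C_p(\mathfrak{R}')\}\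 \big|\ \mathfrak{R}(\mathbb{V})\precsim\mathbb{W},\ \mathfrak{R}'(\mathbb{W})\precsim\mathbb{V}\big\}$$ over pairs of finite sequences of reflection functors. **The relation $\sim_{\mathcal{S}}$.** $\mathbb{V}\sim_{\mathcal{S}}\mathbb{W}$ if and only if $\mathcal{S}(\mathbb{V})\precsim\mathbb{W}$ and $\mathcal{S}(\mathbb{W})\precsim\mathbb{V}$; this is an equivalence relation on $n\text{-Mod}$. *)

theory Defs
  imports "HOL-Analysis.Analysis" "HOL-Library.Function_Algebras" "HOL-Library.Multiset"
begin

section \<open>Finite dimensional vector spaces\<close>

text \<open>
  Vector spaces over the field \<open>'a\<close> are finite dimensional subspaces of an ambient vector space,
  given by a type \<open>'v\<close> and a scalar multiplication \<open>s\<close>.  When the ambient space is infinite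
  dimensional, it contains a copy of every finite dimensional space, in particular of all the
  limits, colimits and direct sums that are needed.  Ambient spaces may differ between the
  arguments of a linear map.
\<close>

definition fd_space :: "('a::field \<Rightarrow> 'v::ab_group_add \<Rightarrow> 'v) \<Rightarrow> 'v set \<Rightarrow> bool" where
  "fd_space s X \<longleftrightarrow> module.subspace s X \<and> (\<exists>B. finite B \<and> module.span s B = X)"

definition linear_between ::
  "('a::field \<Rightarrow> 'v::ab_group_add \<Rightarrow> 'v) \<Rightarrow> 'v set \<Rightarrow>
   ('a \<Rightarrow> 'w::ab_group_add \<Rightarrow> 'w) \<Rightarrow> 'w set \<Rightarrow> ('v \<Rightarrow> 'w) \<Rightarrow> bool" where
  "linear_between s X t Y f \<longleftrightarrow>
     (\<forall>x\<in>X. f x \<in> Y) \<and>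
     (\<forall>x\<in>X. \<forall>y\<in>X. f (x + y) = f x + f y) \<and>
     (\<forall>c. \<forall>x\<in>X. f (s c x) = t c (f x))"

definition prod_scale ::
  "('a \<Rightarrow> 'v \<Rightarrow> 'v) \<Rightarrow> ('a \<Rightarrow> 'w \<Rightarrow> 'w) \<Rightarrow> 'a \<Rightarrow> 'v \<times> 'w \<Rightarrow> 'v \<times> 'w" where
  "prod_scale s t c x = (s c (fst x), t c (snd x))"

definition fun_scale :: "('a \<Rightarrow> 'v \<Rightarrow> 'v) \<Rightarrow> 'a \<Rightarrow> ('i \<Rightarrow> 'v) \<Rightarrow> 'i \<Rightarrow> 'v" where
  "fun_scale s c f = (\<lambda>i. s c (f i))"


section \<open>Zigzag modules\<close>

text \<open>
  \<open>Fwd\<close> is an arrow from index \<open>i\<close> to \<open>i + 1\<close>, and \<open>Bwd\<close> one from \<open>i + 1\<close> to \<open>i\<close>.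
  For a module of length \<open>n\<close>, only the spaces at \<open>1, \<dots>, n\<close>, the arrows at \<open>1, \<dots>, n - 1\<close> and
  the values of the structure maps on their domains are meaningful; everything else in the
  record is ignored.
\<close>

datatype direction = Fwd | Bwd

fun flip :: "direction \<Rightarrow> direction" where
  "flip Fwd = Bwd"
| "flip Bwd = Fwd"

record 'v zigzag =
  space_at :: "nat \<Rightarrow> 'v set"
  dir_at :: "nat \<Rightarrow> direction"
  map_at :: "nat \<Rightarrow> 'v \<Rightarrow> 'v"

definition src :: "'v zigzag \<Rightarrow> nat \<Rightarrow> nat" where
  "src V i = (case dir_at V i of Fwd \<Rightarrow> i | Bwd \<Rightarrow> i + 1)"

definition tgt :: "'v zigzag \<Rightarrow> nat \<Rightarrow> nat" where
  "tgt V i = (case dir_at V i of Fwd \<Rightarrow> i + 1 | Bwd \<Rightarrow> i)"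

definition zigzag_modules ::
  "('a::field \<Rightarrow> 'v::ab_group_add \<Rightarrow> 'v) \<Rightarrow> nat \<Rightarrow> 'v zigzag set" where
  "zigzag_modules s n = {V.
     (\<forall>i\<in>{1..n}. fd_space s (space_at V i)) \<and>
     (\<forall>i\<in>{1..<n}. linear_between s (space_at V (src V i)) s (space_at V (tgt V i)) (map_at V i))}"

definition same_type :: "nat \<Rightarrow> 'v zigzag \<Rightarrow> 'w zigzag \<Rightarrow> bool" where
  "same_type n V W \<longleftrightarrow> (\<forall>i\<in>{1..<n}. dir_at V i = dir_at W i)"

definition zigzag_morphism ::
  "nat \<Rightarrow> ('a::field \<Rightarrow> 'v::ab_group_add \<Rightarrow> 'v) \<Rightarrow> 'v zigzag \<Rightarrow>
   ('a \<Rightarrow> 'w::ab_group_add \<Rightarrow> 'w) \<Rightarrow> 'w zigzag \<Rightarrow> (nat \<Rightarrow> 'v \<Rightarrow> 'w) \<Rightarrow> bool" where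
  "zigzag_morphism n s V t W f \<longleftrightarrow>
     same_type n V W \<and>
     (\<forall>i\<in>{1..n}. linear_between s (space_at V i) t (space_at W i) (f i)) \<and>
     (\<forall>i\<in>{1..<n}. \<forall>x\<in>space_at V (src V i).
        f (tgt V i) (map_at V i x) = map_at W i (f (src V i) x))"

definition zigzag_iso ::
  "nat \<Rightarrow> ('a::field \<Rightarrow> 'v::ab_group_add \<Rightarrow> 'v) \<Rightarrow> 'v zigzag \<Rightarrow>
   ('a \<Rightarrow> 'w::ab_group_add \<Rightarrow> 'w) \<Rightarrow> 'w zigzag \<Rightarrow> bool" where
  "zigzag_iso n s V t W \<longleftrightarrow>
     (\<exists>f. zigzag_morphism n s V t W f \<and>
          (\<forall>i\<in>{1..n}. bij_betw (f i) (space_at V i) (space_at W i)))"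

text \<open>The direct sums below are meant for summands of the same type.\<close>

definition direct_sum :: "'v zigzag \<Rightarrow> 'w zigzag \<Rightarrow> ('v \<times> 'w) zigzag" where
  "direct_sum V W =
     \<lparr>space_at = (\<lambda>i. space_at V i \<times> space_at W i),
      dir_at = dir_at V,
      map_at = (\<lambda>i. map_prod (map_at V i) (map_at W i))\<rparr>"

definition finite_direct_sum ::
  "(nat \<Rightarrow> direction) \<Rightarrow> nat \<Rightarrow> (nat \<Rightarrow> ('v::zero) zigzag) \<Rightarrow> (nat \<Rightarrow> 'v) zigzag" where
  "finite_direct_sum \<tau> N M =
     \<lparr>space_at = (\<lambda>i. {f. (\<forall>j<N. f j \<in> space_at (M j) i) \<and> (\<forall>j\<ge>N. f j = 0)}),
      dir_at = \<tau>,
      map_at = (\<lambda>i f j. if j < N then map_at (M j) i (f j) else 0)\<rparr>"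

definition summand ::
  "('a::field \<Rightarrow> 'v::ab_group_add \<Rightarrow> 'v) \<Rightarrow> nat \<Rightarrow> 'v zigzag \<Rightarrow> 'v zigzag \<Rightarrow> bool" where
  "summand s n W V \<longleftrightarrow>
     same_type n W V \<and>
     (\<exists>U\<in>zigzag_modules s n. same_type n U V \<and>
        zigzag_iso n s V (prod_scale s s) (direct_sum W U))"


section \<open>Interval modules and persistence diagrams\<close>

definition interval_module :: "(nat \<Rightarrow> direction) \<Rightarrow> nat \<Rightarrow> nat \<Rightarrow> ('a::field) zigzag" where
  "interval_module \<tau> b d =
     \<lparr>space_at = (\<lambda>i. if b \<le> i \<and> i \<le> d then UNIV else {0}),
      dir_at = \<tau>,
      map_at = (\<lambda>i. if b \<le> i \<and> i < d then id else (\<lambda>_. 0))\<rparr>"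

definition interval_sum :: "(nat \<Rightarrow> direction) \<Rightarrow> (nat \<times> nat) list \<Rightarrow> (nat \<Rightarrow> 'a::field) zigzag" where
  "interval_sum \<tau> xs =
     finite_direct_sum \<tau> (length xs) (\<lambda>j. interval_module \<tau> (fst (xs ! j)) (snd (xs ! j)))"

definition Dgm ::
  "('a::field \<Rightarrow> 'v::ab_group_add \<Rightarrow> 'v) \<Rightarrow> nat \<Rightarrow> 'v zigzag \<Rightarrow> (nat \<times> nat) multiset" where
  "Dgm s n V = (THE D. \<exists>xs. mset xs = D \<and>
     (\<forall>(b, d)\<in>set xs. 1 \<le> b \<and> b \<le> d \<and> d \<le> n) \<and>
     zigzag_iso n s V (fun_scale (*)) (interval_sum (dir_at V) xs))"

text \<open>
  Direct sums, limits and colimits are determined up to isomorphism only; the operations on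
  modules choose a representative with values in the given ambient space.
\<close>

definition remove_simples ::
  "('a::field \<Rightarrow> 'v::ab_group_add \<Rightarrow> 'v) \<Rightarrow> nat \<Rightarrow> 'v zigzag \<Rightarrow> 'v zigzag" where
  "remove_simples s n V = (SOME W. W \<in> zigzag_modules s n \<and>
     (\<exists>xs. mset xs = {#(b, d) \<in># Dgm s n V. b \<noteq> d#} \<and>
        zigzag_iso n s W (fun_scale (*)) (interval_sum (dir_at V) xs)))"


section \<open>Equivalence by arrow reversal\<close>

definition reverse_arrow :: "nat \<Rightarrow> 'v zigzag \<Rightarrow> 'v zigzag" where
  "reverse_arrow k V =
     V\<lparr>dir_at := (dir_at V)(k := flip (dir_at V k)),
       map_at := (map_at V)(k := inv_into (space_at V (src V k)) (map_at V k))\<rparr>"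

definition reversal_step :: "nat \<Rightarrow> 'v zigzag \<Rightarrow> 'v zigzag \<Rightarrow> bool" where
  "reversal_step n V W \<longleftrightarrow>
     (\<exists>k\<in>{1..<n}. bij_betw (map_at V k) (space_at V (src V k)) (space_at V (tgt V k)) \<and>
        W = reverse_arrow k V)"

definition zigzag_equiv ::
  "('a::field \<Rightarrow> 'v::ab_group_add \<Rightarrow> 'v) \<Rightarrow> nat \<Rightarrow> 'v zigzag \<Rightarrow> 'v zigzag \<Rightarrow> bool" where
  "zigzag_equiv s n V W \<longleftrightarrow> (\<exists>V'. (reversal_step n)\<^sup>*\<^sup>* V V' \<and> zigzag_iso n s W s V')"

definition summand_upto_equiv ::
  "('a::field \<Rightarrow> 'v::ab_group_add \<Rightarrow> 'v) \<Rightarrow> nat \<Rightarrow> 'v zigzag \<Rightarrow> 'v zigzag \<Rightarrow> bool" where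
  "summand_upto_equiv s n W V \<longleftrightarrow>
     (\<exists>W'\<in>zigzag_modules s n. zigzag_equiv s n W W' \<and> summand s n W' V)"


section \<open>Limits and colimits of zigzag diagrams\<close>

definition is_cone ::
  "('a::field \<Rightarrow> 'v::ab_group_add \<Rightarrow> 'v) \<Rightarrow> nat \<Rightarrow> 'v zigzag \<Rightarrow> 'v set \<Rightarrow> (nat \<Rightarrow> 'v \<Rightarrow> 'v) \<Rightarrow> bool" where
  "is_cone s n D X \<pi> \<longleftrightarrow>
     fd_space s X \<and>
     (\<forall>i\<in>{1..n}. linear_between s X s (space_at D i) (\<pi> i)) \<and>
     (\<forall>i\<in>{1..<n}. \<forall>x\<in>X. map_at D i (\<pi> (src D i) x) = \<pi> (tgt D i) x)"

definition is_limit ::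
  "('a::field \<Rightarrow> 'v::ab_group_add \<Rightarrow> 'v) \<Rightarrow> nat \<Rightarrow> 'v zigzag \<Rightarrow> 'v set \<Rightarrow> (nat \<Rightarrow> 'v \<Rightarrow> 'v) \<Rightarrow> bool" where
  "is_limit s n D L \<pi> \<longleftrightarrow>
     is_cone s n D L \<pi> \<and>
     (\<forall>X \<rho>. is_cone s n D X \<rho> \<longrightarrow>
        (let med = (\<lambda>u. linear_between s X s L u \<and> (\<forall>i\<in>{1..n}. \<forall>x\<in>X. \<pi> i (u x) = \<rho> i x))
         in (\<exists>u. med u) \<and> (\<forall>u u'. med u \<longrightarrow> med u' \<longrightarrow> (\<forall>x\<in>X. u x = u' x))))"

definition is_cocone ::
  "('a::field \<Rightarrow> 'v::ab_group_add \<Rightarrow> 'v) \<Rightarrow> nat \<Rightarrow> 'v zigzag \<Rightarrow> 'v set \<Rightarrow> (nat \<Rightarrow> 'v \<Rightarrow> 'v) \<Rightarrow> bool" where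
  "is_cocone s n D X \<iota> \<longleftrightarrow>
     fd_space s X \<and>
     (\<forall>i\<in>{1..n}. linear_between s (space_at D i) s X (\<iota> i)) \<and>
     (\<forall>i\<in>{1..<n}. \<forall>x\<in>space_at D (src D i). \<iota> (tgt D i) (map_at D i x) = \<iota> (src D i) x)"

definition is_colimit ::
  "('a::field \<Rightarrow> 'v::ab_group_add \<Rightarrow> 'v) \<Rightarrow> nat \<Rightarrow> 'v zigzag \<Rightarrow> 'v set \<Rightarrow> (nat \<Rightarrow> 'v \<Rightarrow> 'v) \<Rightarrow> bool" where
  "is_colimit s n D C \<iota> \<longleftrightarrow>
     is_cocone s n D C \<iota> \<and>
     (\<forall>X \<rho>. is_cocone s n D X \<rho> \<longrightarrow>
        (let med = (\<lambda>u. linear_between s C s X u \<and>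
                        (\<forall>i\<in>{1..n}. \<forall>x\<in>space_at D i. u (\<iota> i x) = \<rho> i x))
         in (\<exists>u. med u) \<and> (\<forall>u u'. med u \<longrightarrow> med u' \<longrightarrow> (\<forall>x\<in>C. u x = u' x))))"


section \<open>Reflection functors\<close>

text \<open>
  The reflections at the ends use the module padded by zero spaces at indices \<open>0\<close> and \<open>n + 1\<close>;
  the direction \<open>\<delta>\<close> of the additional arrow is the superscript of the functor.
\<close>

definition pad :: "nat \<Rightarrow> direction \<Rightarrow> ('v::zero) zigzag \<Rightarrow> 'v zigzag" where
  "pad n \<delta> V =
     \<lparr>space_at = (space_at V)(0 := {0}, n + 1 := {0}),
      dir_at = (dir_at V)(0 := \<delta>, n := \<delta>),
      map_at = (map_at V)(0 := (\<lambda>_. 0), n := (\<lambda>_. 0))\<rparr>"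

text \<open>The part of a padded module at \<open>k - 1, k, k + 1\<close>, renumbered as a diagram of length 3.\<close>

definition part_at :: "nat \<Rightarrow> 'v zigzag \<Rightarrow> 'v zigzag" where
  "part_at k V =
     \<lparr>space_at = (\<lambda>j. space_at V (k + j - 2)),
      dir_at = (\<lambda>j. dir_at V (k + j - 2)),
      map_at = (\<lambda>j. map_at V (k + j - 2))\<rparr>"

text \<open>At an end of the module, one of the two arrows set here is the padding arrow, which is
  ignored.\<close>

definition replace_at ::
  "nat \<Rightarrow> 'v set \<Rightarrow> direction \<Rightarrow> ('v \<Rightarrow> 'v) \<Rightarrow> direction \<Rightarrow> ('v \<Rightarrow> 'v) \<Rightarrow> 'v zigzag \<Rightarrow> 'v zigzag" where
  "replace_at k X \<delta> f \<epsilon> g V =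
     \<lparr>space_at = (space_at V)(k := X),
      dir_at = (dir_at V)(k - 1 := \<delta>, k := \<epsilon>),
      map_at = (map_at V)(k - 1 := f, k := g)\<rparr>"

text \<open>The direction is relevant at the end indices only: for \<open>1 < k < n\<close>, both directions denote
  the one functor at \<open>k\<close>.\<close>

datatype reflection = Lim nat direction | Colim nat direction

fun reflection_index :: "reflection \<Rightarrow> nat" where
  "reflection_index (Lim k \<delta>) = k"
| "reflection_index (Colim k \<delta>) = k"

fun is_reflection_of ::
  "('a::field \<Rightarrow> 'v::ab_group_add \<Rightarrow> 'v) \<Rightarrow> nat \<Rightarrow> reflection \<Rightarrow> 'v zigzag \<Rightarrow> 'v zigzag \<Rightarrow> bool" where
  "is_reflection_of s n (Lim k \<delta>) V W \<longleftrightarrow>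
     (\<exists>L \<pi>. is_limit s 3 (part_at k (pad n \<delta> V)) L \<pi> \<and>
        W = replace_at k L Bwd (\<pi> 1) Fwd (\<pi> 3) V)"
| "is_reflection_of s n (Colim k \<delta>) V W \<longleftrightarrow>
     (\<exists>C \<iota>. is_colimit s 3 (part_at k (pad n \<delta> V)) C \<iota> \<and>
        W = replace_at k C Fwd (\<iota> 1) Bwd (\<iota> 3) V)"

definition reflect ::
  "('a::field \<Rightarrow> 'v::ab_group_add \<Rightarrow> 'v) \<Rightarrow> nat \<Rightarrow> reflection \<Rightarrow> 'v zigzag \<Rightarrow> 'v zigzag" where
  "reflect s n r V = (SOME W. is_reflection_of s n r V W)"


section \<open>The reflection distance\<close>

text \<open>The head of the list is the functor that is applied last.\<close>

fun apply_reflections ::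
  "('a::field \<Rightarrow> 'v::ab_group_add \<Rightarrow> 'v) \<Rightarrow> nat \<Rightarrow> reflection list \<Rightarrow> 'v zigzag \<Rightarrow> 'v zigzag" where
  "apply_reflections s n [] V = remove_simples s n V"
| "apply_reflections s n (r # rs) V =
     remove_simples s n (reflect s n r (apply_reflections s n rs V))"

definition reflection_sequences :: "nat \<Rightarrow> reflection list set" where
  "reflection_sequences n = {rs. \<forall>r\<in>set rs. 1 \<le> reflection_index r \<and> reflection_index r \<le> n}"

definition cost :: "real \<Rightarrow> reflection list \<Rightarrow> real" where
  "cost p rs = (if rs = [] then 0 else real (length rs) powr (1 / p))"

definition reflection_dist ::
  "('a::field \<Rightarrow> 'v::ab_group_add \<Rightarrow> 'v) \<Rightarrow> nat \<Rightarrow> real \<Rightarrow> 'v zigzag \<Rightarrow> 'v zigzag \<Rightarrow> real" where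
  "reflection_dist s n p V W =
     (LEAST c. \<exists>R\<in>reflection_sequences n. \<exists>R'\<in>reflection_sequences n.
        c = max (cost p R) (cost p R') \<and>
        summand_upto_equiv s n (apply_reflections s n R V) W \<and>
        summand_upto_equiv s n (apply_reflections s n R' W) V)"

definition equiv_upto_simples ::
  "('a::field \<Rightarrow> 'v::ab_group_add \<Rightarrow> 'v) \<Rightarrow> nat \<Rightarrow> ('v zigzag \<times> 'v zigzag) set" where
  "equiv_upto_simples s n = {(V, W). V \<in> zigzag_modules s n \<and> W \<in> zigzag_modules s n \<and>
     summand_upto_equiv s n (remove_simples s n V) W \<and>
     summand_upto_equiv s n (remove_simples s n W) V}"

definition pseudometric_on :: "'b set \<Rightarrow> ('b \<Rightarrow> 'b \<Rightarrow> real) \<Rightarrow> bool" where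
  "pseudometric_on M d \<longleftrightarrow>
     (\<forall>x\<in>M. \<forall>y\<in>M. 0 \<le> d x y) \<and>
     (\<forall>x\<in>M. d x x = 0) \<and>
     (\<forall>x\<in>M. \<forall>y\<in>M. d x y = d y x) \<and>
     (\<forall>x\<in>M. \<forall>y\<in>M. \<forall>z\<in>M. d x z \<le> d x y + d y z)"

end

theory Submission
  imports Defs "HOL-Combinatorics.List_Permutation"
begin

text \<open>
  By Gabriel's theorem a zigzag module is determined up to isomorphism by its type and its multiset
  of intervals, so everything in the definition of the reflection distance can be computed on such
  pairs \<open>(\<tau>, D)\<close>, called diagrams below.  After this translation the theorem is a statement about
  a preorder on diagrams and monotone operations on them.

  \<^item> The arrow at \<open>k\<close> is bijective exactly if no interval of \<open>D\<close> ends at \<open>k\<close> or starts at \<open>k + 1\<close>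
    (\<open>structure_map_bij_iff\<close>).  Hence a module is a summand of another one up to arrow reversals if
    and only if its intervals form a submultiset and the types differ only at arrows which none of
    these intervals is cut at (\<open>summand_upto_equiv_iff\<close>).  This relation \<open>diagram_le\<close> is
    transitive.

  \<^item> The limit of a diagram of shape \<open>\<bullet> - \<bullet> - \<bullet>\<close> is the direct sum of the limits of its interval
    summands, and the limit of an interval summand is the field or zero, depending on whether an arrow
    enters the interval from outside.  Colimits are the same with arrows that leave.  Hence a reflection
    acts on every interval separately, moving its endpoints by at most one
    (\<open>reflection_properties\<close>).  The endpoints move in a way that depends only on arrows that cut the
    interval, so reflections are monotone for \<open>diagram_le\<close> (\<open>diagram_le_reflect\<close>).

  \<^item> Monotonicity gives the triangle inequality: if \<open>R(V)\<close> lies below \<open>W\<close> and \<open>Q(W)\<close> lies below \<open>U\<close>,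
    then \<open>Q(R(V))\<close> lies below \<open>Q(W)\<close> and so below \<open>U\<close>.  The lengths add up, and
    \<open>x \<mapsto> x powr (1 / p)\<close> is monotone and subadditive for \<open>p \<ge> 1\<close>.

  \<^item> The minimum in the definition is attained because costs are indexed by natural numbers and because
    some pair of sequences exists: every module is annihilated by a finite sequence of reflections
    (\<open>annihilating_sequence\<close>), and zero lies below everything.

  The distance vanishes exactly if the empty sequence works in both directions, which is the
  definition of equivalence up to simple summands.

  The foundation is the theory of interval decompositions.  Existence (\<open>adapted_strands_exist\<close>) is proved
  by induction on the length, for decompositions that are adapted to a given chain of subspaces of the
  last space; uniqueness (\<open>strand_multiplicity_le\<close>) because a composition of morphisms
  \<open>I \<rightarrow> I' \<rightarrow> I\<close> between distinct interval modules is zero.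
\<close>


section \<open>Bases and linear maps on subspaces\<close>

lemma vector_space_field: "vector_space ((*) :: 'a::field \<Rightarrow> 'a \<Rightarrow> 'a)"
  by unfold_locales (auto simp: algebra_simps)

lemma vector_space_prod_scale:
  assumes "vector_space s" "vector_space t"
  shows "vector_space (prod_scale s t)"
proof -
  interpret S: vector_space s by fact
  interpret T: vector_space t by fact
  show ?thesis
    by unfold_locales (auto simp: prod_scale_def S.scale_right_distrib T.scale_right_distrib
      S.scale_left_distrib T.scale_left_distrib)
qed

lemma vector_space_fun_scale:
  assumes "vector_space s"
  shows "vector_space (fun_scale s)"
proof -
  interpret S: vector_space s by fact
  show ?thesis
    by unfold_locales (auto simp: fun_scale_def S.scale_right_distrib S.scale_left_distrib)
qed

text \<open>Bases are families rather than sets, so that the same index can be followed along the spaces of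
a module.\<close>

definition indexed_basis ::
  "('a::field \<Rightarrow> 'v::ab_group_add \<Rightarrow> 'v) \<Rightarrow> 'i set \<Rightarrow> ('i \<Rightarrow> 'v) \<Rightarrow> 'v set \<Rightarrow> bool" where
  "indexed_basis s A f X \<longleftrightarrow> finite A \<and>
     (\<forall>c. (\<Sum>a\<in>A. s (c a) (f a)) = 0 \<longrightarrow> (\<forall>a\<in>A. c a = 0)) \<and>
     X = range (\<lambda>c. \<Sum>a\<in>A. s (c a) (f a))"

lemma indexed_basis_iff_independent:
  assumes "vector_space s"
  shows "indexed_basis s A f X \<longleftrightarrow>
    finite A \<and> inj_on f A \<and> \<not> module.dependent s (f ` A) \<and> module.span s (f ` A) = X"
proof -
  interpret S: vector_space s by fact
  have *: "(\<Sum>v\<in>f ` A. s (u v) v) = (\<Sum>a\<in>A. s (u (f a)) (f a))" if "inj_on f A" for u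
    using that by (simp add: sum.reindex o_def)
  have inj: "inj_on f A" if "finite A" "\<forall>c. (\<Sum>a\<in>A. s (c a) (f a)) = 0 \<longrightarrow> (\<forall>a\<in>A. c a = 0)"
  proof (rule inj_onI, rule ccontr)
    fix a b assume ab: "a \<in> A" "b \<in> A" "f a = f b" "a \<noteq> b"
    define c :: "_ \<Rightarrow> 'a" where "c = (\<lambda>x. if x = a then 1 else if x = b then - 1 else 0)"
    have "(\<Sum>x\<in>A. s (c x) (f x)) = (\<Sum>x\<in>A. (if x = a then f a else 0) + (if x = b then - f b else 0))"
      using ab(3,4) by (intro sum.cong refl) (simp add: c_def)
    also have "\<dots> = 0" using ab that(1) by (simp add: sum.distrib)
    finally have "c a = 0" using spec[OF that(2), of c] ab(1) by simp
    then show False by (simp add: c_def)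
  qed
  have ran: "range (\<lambda>u. \<Sum>a\<in>A. s (u (f a)) (f a)) = range (\<lambda>c. \<Sum>a\<in>A. s (c a) (f a))"
    if "inj_on f A"
  proof (intro equalityI subsetI)
    fix x assume "x \<in> range (\<lambda>c. \<Sum>a\<in>A. s (c a) (f a))"
    then obtain c where "x = (\<Sum>a\<in>A. s (c a) (f a))" by auto
    also have "\<dots> = (\<Sum>a\<in>A. s ((c \<circ> inv_into A f) (f a)) (f a))"
      by (rule sum.cong) (auto simp: that)
    finally show "x \<in> range (\<lambda>u. \<Sum>a\<in>A. s (u (f a)) (f a))" by blast
  qed auto
  show ?thesis
  proof
    assume ib: "indexed_basis s A f X"
    then have fin: "finite A" and ind: "\<forall>c. (\<Sum>a\<in>A. s (c a) (f a)) = 0 \<longrightarrow> (\<forall>a\<in>A. c a = 0)"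
      and X: "X = range (\<lambda>c. \<Sum>a\<in>A. s (c a) (f a))" by (auto simp: indexed_basis_def)
    note i = inj[OF fin ind]
    have "\<not> S.dependent (f ` A)"
      unfolding S.dependent_finite[OF finite_imageI[OF fin]] *[OF i]
      using ind by fastforce
    moreover have "S.span (f ` A) = X"
      unfolding S.span_finite[OF finite_imageI[OF fin]] *[OF i] X using ran[OF i] by simp
    ultimately show "finite A \<and> inj_on f A \<and> \<not> S.dependent (f ` A) \<and> S.span (f ` A) = X"
      using fin i by blast
  next
    assume "finite A \<and> inj_on f A \<and> \<not> S.dependent (f ` A) \<and> S.span (f ` A) = X"
    then have fin: "finite A" and i: "inj_on f A" and ind: "\<not> S.dependent (f ` A)"
      and X: "S.span (f ` A) = X" by auto
    have "c a = 0" if "(\<Sum>a\<in>A. s (c a) (f a)) = 0" "a \<in> A" for c a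
    proof -
      have "(\<Sum>a\<in>A. s ((c \<circ> inv_into A f) (f a)) (f a)) = (\<Sum>a\<in>A. s (c a) (f a))"
        by (rule sum.cong) (auto simp: i)
      then have "(\<Sum>v\<in>f ` A. s ((c \<circ> inv_into A f) v) v) = 0"
        using *[OF i] that(1) by metis
      from S.independentD[OF ind finite_imageI[OF fin] subset_refl this, of "f a"] that(2) i
      show ?thesis by auto
    qed
    then show "indexed_basis s A f X"
      unfolding indexed_basis_def X[symmetric] S.span_finite[OF finite_imageI[OF fin]] *[OF i] ran[OF i]
      using fin by blast
  qed
qed

lemma indexed_basis_expand:
  assumes "indexed_basis s A f X" "x \<in> X"
  shows "\<exists>c. x = (\<Sum>a\<in>A. s (c a) (f a))"
proof -
  have "x \<in> range (\<lambda>c. \<Sum>a\<in>A. s (c a) (f a))" using assms by (simp add: indexed_basis_def)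
  then show ?thesis by (rule rangeE) blast
qed

lemma indexed_basis_zero:
  assumes "indexed_basis s A f X" "(\<Sum>a\<in>A. s (c a) (f a)) = 0" "a \<in> A"
  shows "c a = 0"
  using assms by (simp add: indexed_basis_def)

lemma indexed_basisI_span:
  assumes s: "vector_space s" and "finite A"
    and "\<And>c a. (\<Sum>a\<in>A. s (c a) (f a)) = 0 \<Longrightarrow> a \<in> A \<Longrightarrow> c a = 0"
    and sp: "module.span s (f ` A) = X"
  shows "indexed_basis s A f X"
proof -
  have *: "indexed_basis s A f (range (\<lambda>c. \<Sum>a\<in>A. s (c a) (f a)))"
    unfolding indexed_basis_def using assms(2,3) by blast
  then have "module.span s (f ` A) = range (\<lambda>c. \<Sum>a\<in>A. s (c a) (f a))"
    unfolding indexed_basis_iff_independent[OF s] by blast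
  then show ?thesis using * sp by metis
qed

lemma indexed_basis_empty: "indexed_basis s {} f X \<longleftrightarrow> X = {0}"
  by (auto simp: indexed_basis_def)

lemma indexed_basis_reindex:
  assumes b: "bij_betw h B A" and f: "indexed_basis s A f X"
  shows "indexed_basis s B (f \<circ> h) X"
proof -
  have sum: "(\<Sum>x\<in>B. s (c x) (f (h x))) = (\<Sum>a\<in>A. s (c (inv_into B h a)) (f a))" for c
  proof -
    have "(\<Sum>a\<in>A. s (c (inv_into B h a)) (f a)) = (\<Sum>x\<in>B. s (c (inv_into B h (h x))) (f (h x)))"
      by (rule sum.reindex_bij_betw[symmetric, OF b])
    also have "\<dots> = (\<Sum>x\<in>B. s (c x) (f (h x)))"
      using b by (intro sum.cong) (auto simp: bij_betw_def)
    finally show ?thesis by simp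
  qed
  have sum2: "(\<Sum>x\<in>B. s (c (h x)) (f (h x))) = (\<Sum>a\<in>A. s (c a) (f a))" for c
    by (rule sum.reindex_bij_betw[OF b])
  have fin: "finite B" using b f by (auto simp: indexed_basis_def bij_betw_finite)
  have ind: "c x = 0" if "(\<Sum>x\<in>B. s (c x) (f (h x))) = 0" "x \<in> B" for c x
  proof -
    have "c (inv_into B h (h x)) = 0"
      using that f b unfolding sum indexed_basis_def by (metis bij_betwE)
    then show ?thesis using b that(2) by (simp add: bij_betw_def)
  qed
  have "X = range (\<lambda>c. \<Sum>x\<in>B. s (c x) (f (h x)))"
  proof (intro equalityI subsetI)
    fix x assume "x \<in> X"
    then obtain c where "x = (\<Sum>a\<in>A. s (c a) (f a))" using f by (auto simp: indexed_basis_def)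
    then have "x = (\<Sum>x\<in>B. s ((c \<circ> h) x) (f (h x)))" by (simp add: sum2)
    then show "x \<in> range (\<lambda>c. \<Sum>x\<in>B. s (c x) (f (h x)))" by blast
  next
    fix x assume "x \<in> range (\<lambda>c. \<Sum>x\<in>B. s (c x) (f (h x)))"
    then show "x \<in> X" using f unfolding sum by (auto simp: indexed_basis_def)
  qed
  then show ?thesis unfolding indexed_basis_def using fin ind by (auto simp: o_def)
qed

lemma indexed_basis_mem:
  assumes "vector_space s" "indexed_basis s A f X" "a \<in> A"
  shows "f a \<in> X"
proof -
  interpret S: vector_space s by fact
  show ?thesis using assms(2,3) S.span_base[of "f a" "f ` A"]
    unfolding indexed_basis_iff_independent[OF assms(1)] by auto
qed

lemma indexed_basis_nonzero:
  assumes "vector_space s" "indexed_basis s A f X" "a \<in> A"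
  shows "f a \<noteq> 0"
proof -
  interpret S: vector_space s by fact
  show ?thesis using assms(2,3) S.dependent_zero[of "f ` A"]
    unfolding indexed_basis_iff_independent[OF assms(1)] by force
qed

lemma indexed_basis_sum_mem:
  assumes "indexed_basis s A f X"
  shows "(\<Sum>a\<in>A. s (c a) (f a)) \<in> X"
  using assms by (auto simp: indexed_basis_def)

lemma indexed_basis_fd:
  assumes "vector_space s" "indexed_basis s A f X"
  shows "fd_space s X"
proof -
  interpret S: vector_space s by fact
  show ?thesis using assms(2) S.subspace_span[of "f ` A"]
    unfolding indexed_basis_iff_independent[OF assms(1)] fd_space_def by blast
qed

lemma indexed_basis_subspace:
  assumes "vector_space s" "indexed_basis s A f X"
  shows "module.subspace s X"
  using indexed_basis_fd[OF assms] by (simp add: fd_space_def)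

lemma linear_imp_linear_between:
  assumes "Vector_Spaces.linear s t g" "\<And>x. x \<in> X \<Longrightarrow> g x \<in> Y"
  shows "linear_between s X t Y g"
proof -
  interpret G: Vector_Spaces.linear s t g by fact
  show ?thesis using assms(2) by (auto simp: linear_between_def G.add G.scale)
qed

text \<open>A linear map on a subspace is the restriction of a linear map on the ambient space, which makes
the library on linear maps applicable.\<close>

lemma linear_between_extend:
  assumes s: "vector_space s" and t: "vector_space t"
    and X: "module.subspace s X" and f: "linear_between s X t Y f"
  shows "\<exists>g. Vector_Spaces.linear s t g \<and> (\<forall>x\<in>X. g x = f x)"
proof -
  interpret S: vector_space s by fact
  interpret T: vector_space t by fact
  interpret P: vector_space_pair s t by unfold_locales
  obtain B where B: "B \<subseteq> X" "\<not> S.dependent B" "X \<subseteq> S.span B"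
    using S.maximal_independent_subset by blast
  have sp: "S.span B = X" using B X by (meson S.span_subspace)
  define g where "g = P.construct B f"
  have lin: "Vector_Spaces.linear s t g" unfolding g_def by (rule P.linear_construct[OF B(2)])
  interpret G: Vector_Spaces.linear s t g by fact
  have gB: "g b = f b" if "b \<in> B" for b unfolding g_def by (rule P.construct_basis[OF B(2) that])
  have f0: "f 0 = 0"
  proof -
    have "f (0 + 0) = f 0 + f 0" using f S.subspace_0[OF X] unfolding linear_between_def by blast
    then show ?thesis by simp
  qed
  have "x \<in> X \<and> g x = f x" if "x \<in> S.span B" for x
    using that
  proof (induction rule: S.span_induct_alt)
    case base
    then show ?case using f0 S.subspace_0[OF X] by (simp add: G.zero)
  next
    case (step c x y)
    then have "x \<in> X" "y \<in> X" using B by auto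
    moreover have "s c x \<in> X" using \<open>x \<in> X\<close> S.subspace_scale[OF X] by blast
    ultimately show ?case using step f S.subspace_add[OF X, of "s c x" y] gB[of x]
      by (auto simp: linear_between_def G.add G.scale)
  qed
  then show ?thesis using lin sp by blast
qed

lemma linear_between_0:
  assumes "vector_space s" "module.subspace s X" "linear_between s X t Y f"
  shows "f 0 = 0"
proof -
  interpret S: vector_space s by fact
  have "f (0 + 0) = f 0 + f 0"
    using assms(3) S.subspace_0[OF assms(2)] unfolding linear_between_def by blast
  then show ?thesis by simp
qed

lemma linear_between_sum:
  assumes s: "vector_space s" and t: "vector_space t"
    and X: "module.subspace s X" and f: "linear_between s X t Y f"
    and v: "\<And>a. a \<in> A \<Longrightarrow> v a \<in> X"
  shows "f (\<Sum>a\<in>A. s (c a) (v a)) = (\<Sum>a\<in>A. t (c a) (f (v a)))"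
proof -
  interpret S: vector_space s by fact
  obtain g where g: "Vector_Spaces.linear s t g" "\<forall>x\<in>X. g x = f x"
    using linear_between_extend[OF s t X f] by blast
  interpret G: Vector_Spaces.linear s t g by fact
  have "(\<Sum>a\<in>A. s (c a) (v a)) \<in> X"
    by (intro S.subspace_sum[OF X] S.subspace_scale[OF X] v)
  then have "f (\<Sum>a\<in>A. s (c a) (v a)) = g (\<Sum>a\<in>A. s (c a) (v a))" using g by simp
  also have "\<dots> = (\<Sum>a\<in>A. t (c a) (g (v a)))" by (simp add: G.sum G.scale)
  also have "\<dots> = (\<Sum>a\<in>A. t (c a) (f (v a)))" using g v by simp
  finally show ?thesis .
qed

lemma linear_between_comp:
  assumes "linear_between s X t Y f" "linear_between t Y u Z g"
  shows "linear_between s X u Z (g \<circ> f)"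
  using assms by (auto simp: linear_between_def)

lemma linear_between_inv_into:
  assumes s: "vector_space s" and X: "module.subspace s X"
    and f: "linear_between s X t Y f" and b: "bij_betw f X Y"
  shows "linear_between t Y s X (inv_into X f)"
proof -
  interpret S: vector_space s by fact
  have g: "inv_into X f y \<in> X" "f (inv_into X f y) = y" if "y \<in> Y" for y
    using b that by (auto simp: bij_betw_def inv_into_into f_inv_into_f)
  have *: "inv_into X f y = x" if "x \<in> X" "f x = y" for x y
    using b that by (auto simp: bij_betw_def)
  show ?thesis unfolding linear_between_def
  proof (intro conjI ballI allI)
    fix y y' assume y: "y \<in> Y" "y' \<in> Y"
    show "inv_into X f (y + y') = inv_into X f y + inv_into X f y'"
      by (rule *) (use y g S.subspace_add[OF X] f in \<open>auto simp: linear_between_def\<close>)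
  next
    fix c y assume y: "y \<in> Y"
    show "inv_into X f (t c y) = s c (inv_into X f y)"
      by (rule *) (use y g S.subspace_scale[OF X] f in \<open>auto simp: linear_between_def\<close>)
  qed (use g in auto)
qed

lemma indexed_basis_linear_exists:
  assumes s: "vector_space s" and t: "vector_space t" and f: "indexed_basis s A f X"
  shows "\<exists>g. Vector_Spaces.linear s t g \<and> (\<forall>a\<in>A. g (f a) = h a)"
proof -
  interpret S: vector_space s by fact
  interpret T: vector_space t by fact
  interpret P: vector_space_pair s t by unfold_locales
  have i: "inj_on f A" and ind: "\<not> S.dependent (f ` A)"
    using f by (auto simp: indexed_basis_iff_independent[OF s])
  define g where "g = P.construct (f ` A) (h \<circ> inv_into A f)"
  have "g (f a) = h a" if "a \<in> A" for a
    unfolding g_def using P.construct_basis[OF ind, of "f a"] that i by auto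
  then show ?thesis using P.linear_construct[OF ind] unfolding g_def by blast
qed

lemma indexed_basis_coordinates:
  fixes s :: "'a::field \<Rightarrow> 'v::ab_group_add \<Rightarrow> 'v"
  assumes s: "vector_space s" and f: "indexed_basis s A f X"
  obtains \<kappa> where "\<And>a. Vector_Spaces.linear s (*) (\<kappa> a)"
    "\<And>a b. a \<in> A \<Longrightarrow> b \<in> A \<Longrightarrow> \<kappa> a (f b) = (if a = b then 1 else 0)"
    "\<And>x. x \<in> X \<Longrightarrow> x = (\<Sum>a\<in>A. s (\<kappa> a x) (f a))"
proof -
  interpret S: vector_space s by fact
  have F: "vector_space ((*) :: 'a \<Rightarrow> 'a \<Rightarrow> 'a)" by (rule vector_space_field)
  have "\<forall>a. \<exists>g. Vector_Spaces.linear s (*) g \<and> (\<forall>b\<in>A. g (f b) = (if a = b then 1 else (0::'a)))"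
    by (intro allI indexed_basis_linear_exists[OF s F f])
  then obtain \<kappa> where \<kappa>: "\<And>a. Vector_Spaces.linear s (*) (\<kappa> a)"
    "\<And>a b. b \<in> A \<Longrightarrow> \<kappa> a (f b) = (if a = b then 1 else (0::'a))"
    by metis
  have "x = (\<Sum>a\<in>A. s (\<kappa> a x) (f a))" if x: "x \<in> X" for x
  proof -
    obtain c where x: "x = (\<Sum>a\<in>A. s (c a) (f a))" using indexed_basis_expand[OF f x] by blast
    have "\<kappa> a x = c a" if "a \<in> A" for a
    proof -
      interpret K: Vector_Spaces.linear s "(*)" "\<kappa> a" by (rule \<kappa>)
      have "\<kappa> a x = (\<Sum>b\<in>A. c b * (if a = b then 1 else 0))"
        unfolding x K.sum by (intro sum.cong) (auto simp: K.scale \<kappa>(2))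
      also have "\<dots> = (\<Sum>b\<in>A. if a = b then c b else 0)" by (rule sum.cong) auto
      also have "\<dots> = c a" using that f by (simp add: indexed_basis_def)
      finally show ?thesis .
    qed
    then show ?thesis using x by simp
  qed
  then show ?thesis using \<kappa> that by blast
qed

lemma indexed_basis_image:
  assumes s: "vector_space s" and t: "vector_space t"
    and f: "indexed_basis s A f X" and h: "linear_between s X t Y h" and b: "bij_betw h X Y"
  shows "indexed_basis t A (h \<circ> f) Y"
proof -
  interpret S: vector_space s by fact
  have X: "S.subspace X" using indexed_basis_subspace[OF s f] .
  have *: "h (\<Sum>a\<in>A. s (c a) (f a)) = (\<Sum>a\<in>A. t (c a) (h (f a)))" for c
    by (rule linear_between_sum[OF s t X h]) (rule indexed_basis_mem[OF s f])
  have "\<forall>a\<in>A. c a = 0" if "(\<Sum>a\<in>A. t (c a) (h (f a))) = 0" for c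
  proof -
    have "h (\<Sum>a\<in>A. s (c a) (f a)) = h 0" using that * linear_between_0[OF s X h] by simp
    then have "(\<Sum>a\<in>A. s (c a) (f a)) = 0"
      using inj_onD[OF bij_betw_imp_inj_on[OF b]] indexed_basis_sum_mem[OF f] S.subspace_0[OF X]
      by blast
    then show ?thesis using f by (auto simp: indexed_basis_def)
  qed
  moreover have "Y = range (\<lambda>c. \<Sum>a\<in>A. t (c a) (h (f a)))"
  proof -
    have "Y = h ` X" using b by (simp add: bij_betw_def)
    also have "\<dots> = h ` range (\<lambda>c. \<Sum>a\<in>A. s (c a) (f a))" using f by (simp add: indexed_basis_def)
    also have "\<dots> = range (\<lambda>c. \<Sum>a\<in>A. t (c a) (h (f a)))" by (simp add: image_image *)
    finally show ?thesis .
  qed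
  ultimately show ?thesis using f unfolding indexed_basis_def by auto
qed

text \<open>Stated for an arbitrary target \<open>Z\<close>: that the values lie in \<open>Y\<close> follows from the behaviour on the
basis.\<close>

lemma indexed_basis_linear_bij:
  fixes s :: "'a::field \<Rightarrow> 'v::ab_group_add \<Rightarrow> 'v" and t :: "'a \<Rightarrow> 'w::ab_group_add \<Rightarrow> 'w"
  assumes s: "vector_space s" and t: "vector_space t"
    and f: "indexed_basis s A f X" and g: "indexed_basis t A g Y"
    and h: "linear_between s X t Z h" and hf: "\<And>a. a \<in> A \<Longrightarrow> h (f a) = g a"
  shows "bij_betw h X Y"
proof -
  interpret S: vector_space s by fact
  have X: "S.subspace X" using indexed_basis_subspace[OF s f] .
  interpret T: vector_space t by fact
  have *: "h (\<Sum>a\<in>A. s (c a) (f a)) = (\<Sum>a\<in>A. t (c a) (g a))" for c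
    using linear_between_sum[OF s t X h indexed_basis_mem[OF s f], where c = c] hf by simp
  have fX: "X = range (\<lambda>c. \<Sum>a\<in>A. s (c a) (f a))" and gY: "Y = range (\<lambda>c. \<Sum>a\<in>A. t (c a) (g a))"
    using f g by (auto simp: indexed_basis_def)
  have "h ` X = Y" unfolding fX gY image_image * ..
  moreover have "inj_on h X"
  proof (rule inj_onI)
    fix x y assume xy: "x \<in> X" "y \<in> X" "h x = h y"
    then obtain c d where c: "x = (\<Sum>a\<in>A. s (c a) (f a))" and d: "y = (\<Sum>a\<in>A. s (d a) (f a))"
      unfolding fX by auto
    have "(\<Sum>a\<in>A. t (c a - d a) (g a)) = 0"
      using xy(3) by (simp add: c d * T.scale_left_diff_distrib sum_subtractf)
    then have "\<forall>a\<in>A. c a - d a = 0" using indexed_basis_zero[OF g, where c = "\<lambda>a. c a - d a"] by simp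
    then show "x = y" by (simp add: c d)
  qed
  ultimately show ?thesis by (simp add: bij_betw_def)
qed

lemma indexed_basis_subset:
  assumes s: "vector_space s" and f: "indexed_basis s A f X" and B: "B \<subseteq> A"
  shows "indexed_basis s B f (module.span s (f ` B))"
proof -
  interpret S: vector_space s by fact
  show ?thesis using f B finite_subset[OF B] inj_on_subset[of f A, OF _ B] S.independent_mono[OF _ image_mono[OF B]]
    by (simp add: indexed_basis_iff_independent[OF s])
qed

text \<open>This is the only use of infinite dimensionality: the ambient space has room for every module that is
built from finitely many basis vectors.\<close>

lemma indexed_basis_in_infinite_dimensional:
  assumes s: "vector_space s" and inf: "\<nexists>B. finite_dimensional_vector_space s B"
    and A: "finite (A :: 'i set)"
  obtains f X where "indexed_basis s A f X"
proof -
  interpret S: vector_space s by fact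
  obtain B where B: "B \<subseteq> UNIV" "\<not> S.dependent B" "UNIV \<subseteq> S.span B"
    using S.maximal_independent_subset by blast
  have "infinite B"
  proof
    assume "finite B"
    then have "finite_dimensional_vector_space s B" using B by unfold_locales auto
    then show False using inf by blast
  qed
  then obtain C where C: "C \<subseteq> B" "finite C" "card C = card A"
    using infinite_arbitrarily_large by blast
  then obtain f where f: "bij_betw f A C" using A by (metis finite_same_card_bij)
  have "indexed_basis s A f (S.span C)"
    unfolding indexed_basis_iff_independent[OF s]
    using f A C B(2) S.dependent_mono by (auto simp: bij_betw_def)
  then show ?thesis using that by blast
qed


section \<open>Existence of interval decompositions\<close>

text \<open>A decomposition into one-dimensional strands: the strand \<open>j\<close> has a basis vector \<open>e j i\<close> at every index
\<open>i\<close> in \<open>T j\<close>, and structure maps send basis vectors along the strand, or to zero where it ends.  With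
\<open>T j = {b..d}\<close> the strands are interval summands.  Arbitrary sets \<open>T j\<close> allow restriction to a part of a
module without renumbering.\<close>

definition strand_basis ::
  "('a::field \<Rightarrow> 'v::ab_group_add \<Rightarrow> 'v) \<Rightarrow> nat \<Rightarrow> 'v zigzag \<Rightarrow> 'j set \<Rightarrow> ('j \<Rightarrow> nat set) \<Rightarrow>
   ('j \<Rightarrow> nat \<Rightarrow> 'v) \<Rightarrow> bool" where
  "strand_basis s n V J T e \<longleftrightarrow> finite J \<and>
     (\<forall>i\<in>{1..n}. indexed_basis s {j\<in>J. i \<in> T j} (\<lambda>j. e j i) (space_at V i)) \<and>
     (\<forall>i\<in>{1..<n}. \<forall>j\<in>J. src V i \<in> T j \<longrightarrow>
        map_at V i (e j (src V i)) = (if tgt V i \<in> T j then e j (tgt V i) else 0))"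

text \<open>Handle the largest member \<open>K\<close> of the chain first: a basis of \<open>K\<close> adapted to the smaller members remains
independent together with \<open>A\<close>, because by hypothesis the vectors of \<open>A\<close> outside \<open>K\<close> are independent
modulo \<open>K\<close>.\<close>

lemma extend_to_adapted_basis:
  assumes s: "vector_space s" and "finite C" and X: "module.subspace s X"
    and C: "\<And>K. K \<in> C \<Longrightarrow> module.subspace s K \<and> K \<subseteq> X"
    and chain: "\<And>K L. K \<in> C \<Longrightarrow> L \<in> C \<Longrightarrow> K \<subseteq> L \<or> L \<subseteq> K"
    and A: "finite A" "A \<subseteq> X" "\<not> module.dependent s A"
    and adapted: "\<And>K. K \<in> C \<Longrightarrow> K \<inter> module.span s A \<subseteq> module.span s (A \<inter> K)"
  shows "\<exists>B. A \<subseteq> B \<and> B \<subseteq> X \<and> \<not> module.dependent s B \<and> X \<subseteq> module.span s B \<and>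
    (\<forall>K\<in>C. K \<subseteq> module.span s (B \<inter> K))"
proof -
  interpret S: vector_space s by fact
  show ?thesis using assms(2-)
  proof (induction C arbitrary: X A rule: finite_psubset_induct)
    case (psubset C)
    show ?case
    proof (cases "C = {}")
      case True
      then show ?thesis
        using S.maximal_independent_subset_extend[OF psubset.prems(5,6)] by (metis empty_iff)
    next
      case False
      then obtain K where K: "K \<in> C" "\<forall>L\<in>C. K \<subseteq> L \<longrightarrow> L = K"
        using finite_has_maximal[OF psubset.hyps(1)] by metis
      have max: "L \<subseteq> K" if "L \<in> C" for L
        using psubset.prems(3)[OF K(1) that] K(2) that by blast
      have "\<exists>B. A \<inter> K \<subseteq> B \<and> B \<subseteq> K \<and> \<not> S.dependent B \<and> K \<subseteq> S.span B \<and>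
        (\<forall>L\<in>C - {K}. L \<subseteq> S.span (B \<inter> L))"
      proof (rule psubset.IH)
        show "L \<inter> S.span (A \<inter> K) \<subseteq> S.span (A \<inter> K \<inter> L)" if "L \<in> C - {K}" for L
        proof -
          have "A \<inter> K \<inter> L = A \<inter> L" using max that by blast
          then show ?thesis
            using psubset.prems(7)[of L] that S.span_mono[of "A \<inter> K" A] by auto
        qed
        show "\<not> S.dependent (A \<inter> K)" by (rule S.independent_mono[OF psubset.prems(6)]) blast
      qed (use psubset.prems K max in auto)
      then obtain B where B: "A \<inter> K \<subseteq> B" "B \<subseteq> K" "\<not> S.dependent B" "K \<subseteq> S.span B"
        "\<And>L. L \<in> C \<Longrightarrow> L \<noteq> K \<Longrightarrow> L \<subseteq> S.span (B \<inter> L)" by auto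
      have spB: "S.span B = K" using B psubset.prems(2)[OF K(1)] by (intro S.span_subspace) auto
      \<comment> \<open>A relation between \<open>B\<close> and \<open>A - K\<close> would put a combination of \<open>A - K\<close> into
        \<open>K \<inter> span A\<close>, which is spanned by \<open>A \<inter> K\<close>.\<close>
      have ind: "\<not> S.dependent (B \<union> D)" if "finite D" "D \<subseteq> A - K" for D
        using that
      proof (induction D rule: finite_induct)
        case empty
        then show ?case using B by simp
      next
        case (insert a D)
        have "a \<notin> S.span (B \<union> D)"
        proof
          assume "a \<in> S.span (B \<union> D)"
          then obtain x y where xy: "a = x + y" "x \<in> K" "y \<in> S.span D"
            unfolding S.span_Un spB by auto
          have D: "D \<subseteq> A - {a}" "A \<inter> K \<subseteq> A - {a}" using insert by auto
          have "x = a - y" using xy by simp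
          moreover have "a \<in> S.span A" "y \<in> S.span A"
            using insert xy(3) S.span_mono[of D A] by (auto intro: S.span_base)
          ultimately have "x \<in> S.span A" using S.span_diff by blast
          then have "x \<in> S.span (A \<inter> K)" using psubset.prems(7)[OF K(1)] xy(2) by blast
          then have "x \<in> S.span (A - {a})" using S.span_mono[OF D(2)] by blast
          moreover have "y \<in> S.span (A - {a})" using S.span_mono[OF D(1)] xy(3) by blast
          ultimately have "a \<in> S.span (A - {a})" unfolding xy(1) by (rule S.span_add)
          then show False using psubset.prems(6) insert unfolding S.dependent_def by blast
        qed
        then show ?case using insert S.independent_insertI[of a "B \<union> D"] by simp
      qed
      have "B \<union> A = B \<union> (A - K)" using B by blast
      then have ind': "\<not> S.dependent (B \<union> A)" using ind[of "A - K"] psubset.prems(4) by simp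
      have sub: "B \<union> A \<subseteq> X" using B psubset.prems(2)[OF K(1)] psubset.prems(5) by blast
      obtain B' where B': "B \<union> A \<subseteq> B'" "B' \<subseteq> X" "\<not> S.dependent B'" "X \<subseteq> S.span B'"
        using S.maximal_independent_subset_extend[OF sub ind'] by metis
      have "L \<subseteq> S.span (B' \<inter> L)" if "L \<in> C" for L
      proof (cases "L = K")
        case True
        have "B \<subseteq> B' \<inter> K" using B B' by blast
        then show ?thesis using B(4) S.span_mono True by blast
      next
        case False
        have "B \<inter> L \<subseteq> B' \<inter> L" using B' by blast
        then show ?thesis using B(5)[OF that False] S.span_mono by blast
      qed
      then show ?thesis using B' by (intro exI[of _ B']) auto
    qed
  qed
qed

text \<open>The strands that reach the last index \<open>m\<close> form a basis of the last space which restricts to a basis of every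
member of \<open>C\<close>.  Quantifying over chains \<open>C\<close> is what makes the induction on \<open>m\<close> work: the kernel or the image
of the next structure map becomes one more member of the chain.\<close>

definition has_adapted_strands ::
  "('a::field \<Rightarrow> 'v::ab_group_add \<Rightarrow> 'v) \<Rightarrow> nat \<Rightarrow> 'v zigzag \<Rightarrow> 'v set set \<Rightarrow> bool" where
  "has_adapted_strands s m V C \<longleftrightarrow>
     (\<exists>(N::nat) b d e. (\<forall>j<N. 1 \<le> b j \<and> b j \<le> d j \<and> d j \<le> m) \<and>
        strand_basis s m V {..<N} (\<lambda>j. {b j..d j}) e \<and>
        (\<forall>K\<in>C. K \<subseteq> module.span s ((\<lambda>j. e j m) ` {j. j < N \<and> d j = m \<and> e j m \<in> K})))"

lemma has_adapted_strandsE: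
  assumes "has_adapted_strands s m V C"
  obtains N :: nat and b d e
  where "\<And>j. j < N \<Longrightarrow> 1 \<le> b j \<and> b j \<le> d j \<and> d j \<le> m"
    and "strand_basis s m V {..<N} (\<lambda>j. {b j..d j}) e"
    and "\<And>K. K \<in> C \<Longrightarrow>
      K \<subseteq> module.span s ((\<lambda>j. e j m) ` {j. j < N \<and> d j = m \<and> e j m \<in> K})"
proof -
  obtain N :: nat and b d e where *: "(\<forall>j<N. 1 \<le> b j \<and> b j \<le> d j \<and> d j \<le> m) \<and>
      strand_basis s m V {..<N} (\<lambda>j. {b j..d j}) e \<and>
      (\<forall>K\<in>C. K \<subseteq> module.span s ((\<lambda>j. e j m) ` {j. j < N \<and> d j = m \<and> e j m \<in> K}))"
    using assms unfolding has_adapted_strands_def by (elim exE)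
  show thesis by (rule that[of N b d e]) (use * in simp_all)
qed

text \<open>The combinatorial half of the induction step.  The strands in \<open>J\<close> continue to the new index, the other
strands end at \<open>m\<close>, and the indices from \<open>N\<close> on are new strands that consist of the new index only.\<close>

lemma adapted_strands_step:
  fixes N N' m :: nat
  assumes m: "1 \<le> m"
    and e: "strand_basis s m V {..<N} (\<lambda>j. {b j..d j}) e"
    and bd: "\<And>j. j < N \<Longrightarrow> 1 \<le> b j \<and> b j \<le> d j \<and> d j \<le> m"
    and J: "J \<subseteq> {j. j < N \<and> d j = m}" and N: "N \<le> N'"
    and g: "indexed_basis s (J \<union> {N..<N'}) g (space_at V (Suc m))"
    and fwd: "\<And>j. dir_at V m = Fwd \<Longrightarrow> j < N \<Longrightarrow> d j = m \<Longrightarrow>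
      map_at V m (e j m) = (if j \<in> J then g j else 0)"
    and bwd: "\<And>j. dir_at V m = Bwd \<Longrightarrow> j \<in> J \<union> {N..<N'} \<Longrightarrow>
      map_at V m (g j) = (if j \<in> J then e j m else 0)"
    and C: "\<And>K. K \<in> C \<Longrightarrow> K \<subseteq> module.span s (g ` {j \<in> J \<union> {N..<N'}. g j \<in> K})"
  shows "has_adapted_strands s (Suc m) V C"
proof -
  define b' where "b' j = (if j < N then b j else Suc m)" for j
  define d' where "d' j = (if j < N \<and> j \<notin> J then d j else Suc m)" for j
  define e' where "e' j i = (if i = Suc m then g j else e j i)" for j i
  have act: "{j\<in>{..<N'}. i \<in> {b' j..d' j}} = {j\<in>{..<N}. i \<in> {b j..d j}}" if "i \<le> m" for i
    using that bd J N by (auto simp: b'_def d'_def split: if_splits)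
  have act': "{j\<in>{..<N'}. Suc m \<in> {b' j..d' j}} = J \<union> {N..<N'}"
  proof (intro equalityI subsetI)
    fix j assume "j \<in> {j\<in>{..<N'}. Suc m \<in> {b' j..d' j}}"
    then show "j \<in> J \<union> {N..<N'}" using bd[of j] by (auto simp: b'_def d'_def split: if_splits)
  next
    fix j assume "j \<in> J \<union> {N..<N'}"
    then show "j \<in> {j\<in>{..<N'}. Suc m \<in> {b' j..d' j}}"
      using bd[of j] J N by (fastforce simp: b'_def d'_def split: if_splits)
  qed
  have "strand_basis s (Suc m) V {..<N'} (\<lambda>j. {b' j..d' j}) e'"
    unfolding strand_basis_def
  proof (intro conjI ballI impI)
    fix i assume i: "i \<in> {1..Suc m}"
    show "indexed_basis s {j\<in>{..<N'}. i \<in> {b' j..d' j}} (\<lambda>j. e' j i) (space_at V i)"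
    proof (cases "i = Suc m")
      case True
      then show ?thesis using g act' by (simp add: e'_def)
    next
      case False
      then show ?thesis using i e act[of i] by (simp add: e'_def strand_basis_def)
    qed
  next
    fix i j assume i: "i \<in> {1..<Suc m}" and j: "j \<in> {..<N'}" and a: "src V i \<in> {b' j..d' j}"
    have act1: "j < N \<and> i' \<in> {b j..d j} \<longleftrightarrow> i' \<in> {b' j..d' j}" if "i' \<le> m" for i'
      using act[OF that] j by (auto simp: set_eq_iff)
    have act2: "j \<in> J \<union> {N..<N'} \<longleftrightarrow> Suc m \<in> {b' j..d' j}" using act' j by (auto simp: set_eq_iff)
    show "map_at V i (e' j (src V i)) = (if tgt V i \<in> {b' j..d' j} then e' j (tgt V i) else 0)"
    proof (cases "i = m")
      case False
      then have "i \<in> {1..<m}" using i by auto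
      moreover have le: "src V i \<le> m" "tgt V i \<le> m"
        using False i by (auto simp: src_def tgt_def split: direction.split)
      ultimately show ?thesis using e a act1[OF le(1)] act1[OF le(2)] by (auto simp: strand_basis_def e'_def)
    next
      case True
      show ?thesis
      proof (cases "dir_at V m")
        case Fwd
        then have st: "src V i = m" "tgt V i = Suc m" using True by (auto simp: src_def tgt_def)
        then have j': "j < N" "m \<in> {b j..d j}" using act1[of m] a by auto
        then have "d j = m" using bd[of j] by simp
        then show ?thesis using fwd[OF Fwd j'(1)] act2 j' st True by (auto simp: e'_def)
      next
        case Bwd
        then have st: "src V i = Suc m" "tgt V i = m" using True by (auto simp: src_def tgt_def)
        then have j': "j \<in> J \<union> {N..<N'}" using act2 a by auto
        have "m \<in> {b' j..d' j} \<longleftrightarrow> j \<in> J" using act1[of m] j' J bd by auto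
        then show ?thesis using bwd[OF Bwd j'] st True by (auto simp: e'_def)
      qed
    qed
  qed auto
  moreover have "1 \<le> b' j \<and> b' j \<le> d' j \<and> d' j \<le> Suc m" if "j < N'" for j
    using bd[of j] m J by (auto simp: b'_def d'_def)
  moreover have "K \<subseteq> module.span s ((\<lambda>j. e' j (Suc m)) ` {j. j < N' \<and> d' j = Suc m \<and> e' j (Suc m) \<in> K})"
    if "K \<in> C" for K
  proof -
    have "j \<in> J \<union> {N..<N'} \<longleftrightarrow> j < N' \<and> d' j = Suc m" for j
    proof (cases "j \<in> J")
      case True
      then have "j < N" using J by auto
      then show ?thesis using True N by (simp add: d'_def)
    next
      case False
      then show ?thesis using bd[of j] by (cases "j < N") (auto simp: d'_def)
    qed
    then have "{j \<in> J \<union> {N..<N'}. g j \<in> K} = {j. j < N' \<and> d' j = Suc m \<and> e' j (Suc m) \<in> K}"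
      by (simp add: e'_def conj_assoc)
    then show ?thesis using C[OF that] by (simp add: e'_def)
  qed
  ultimately show ?thesis unfolding has_adapted_strands_def by blast
qed

lemma fd_space_independent_finite:
  assumes s: "vector_space s" and "fd_space s X" "B \<subseteq> X" "\<not> module.dependent s B"
  shows "finite B"
proof -
  interpret S: vector_space s by fact
  obtain D where "finite D" "S.span D = X" using assms(2) by (auto simp: fd_space_def)
  then show ?thesis using S.independent_span_bound[of D B] assms by blast
qed

lemma indexed_basis_disjoint_spans:
  assumes s: "vector_space s" and f: "indexed_basis s A f X"
    and sub: "B \<subseteq> A" "D \<subseteq> A" "B \<inter> D = {}"
    and x: "x \<in> module.span s (f ` B)" "x \<in> module.span s (f ` D)"
  shows "x = 0"
proof -
  interpret S: vector_space s by fact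
  obtain \<kappa> where \<kappa>: "\<And>a. Vector_Spaces.linear s (*) (\<kappa> a)"
    "\<And>a b. a \<in> A \<Longrightarrow> b \<in> A \<Longrightarrow> \<kappa> a (f b) = (if a = b then 1 else 0)"
    "\<And>x. x \<in> X \<Longrightarrow> x = (\<Sum>a\<in>A. s (\<kappa> a x) (f a))"
    using indexed_basis_coordinates[OF s f] by blast
  have van: "\<kappa> a y = 0" if "y \<in> S.span (f ` G)" "G \<subseteq> A" "a \<in> A - G" for a y G
  proof -
    interpret K: Vector_Spaces.linear s "(*)" "\<kappa> a" by (rule \<kappa>)
    show ?thesis by (rule K.eq_0_on_span[OF _ that(1)]) (use that \<kappa>(2) in auto)
  qed
  have "x \<in> X"
    using x(1) S.span_mono[OF image_mono[OF sub(1)], of f] f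
    by (auto simp: indexed_basis_iff_independent[OF s])
  moreover have "\<kappa> a x = 0" if "a \<in> A" for a
    using van[OF x(1) sub(1), of a] van[OF x(2) sub(2), of a] that sub(3) by blast
  ultimately show ?thesis using \<kappa>(3)[of x] by simp
qed

lemma zigzag_module_spaces:
  assumes "V \<in> zigzag_modules s n" "1 \<le> i" "i \<le> n"
  shows "fd_space s (space_at V i)" "module.subspace s (space_at V i)"
  using assms by (auto simp: zigzag_modules_def fd_space_def)

lemma zigzag_modules_Suc:
  "V \<in> zigzag_modules s (Suc m) \<Longrightarrow> V \<in> zigzag_modules s m"
  by (auto simp: zigzag_modules_def)

text \<open>For an arrow \<open>P\<close> from \<open>m\<close> to \<open>m + 1\<close>, take strands adapted to the preimages of the chain and to the kernel of \<open>P\<close>.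
Strands outside the kernel have independent images, which extend to an adapted basis.  For an arrow from \<open>m + 1\<close>
to \<open>m\<close>, take strands adapted to the images of the chain and to the image of \<open>P\<close>.  Strands in the image are lifted,
each into the smallest possible member of the chain, and an adapted basis of the kernel is added.\<close>

lemma adapted_strands_exist:
  assumes s: "vector_space s" and m: "1 \<le> m" and V: "V \<in> zigzag_modules s m"
    and C: "finite C" "\<And>K. K \<in> C \<Longrightarrow> module.subspace s K \<and> K \<subseteq> space_at V m"
      "\<And>K L. K \<in> C \<Longrightarrow> L \<in> C \<Longrightarrow> K \<subseteq> L \<or> L \<subseteq> K"
  shows "has_adapted_strands s m V C"
  using m V C
proof (induction m arbitrary: C rule: nat_induct_at_least)
  interpret S: vector_space s by fact
  case base
  have sp: "fd_space s (space_at V 1)" "S.subspace (space_at V 1)"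
    using zigzag_module_spaces[OF base(1), of 1] by auto
  have "\<exists>B. {} \<subseteq> B \<and> B \<subseteq> space_at V 1 \<and> \<not> S.dependent B \<and> space_at V 1 \<subseteq> S.span B \<and>
    (\<forall>K\<in>C. K \<subseteq> S.span (B \<inter> K))"
    by (rule extend_to_adapted_basis[OF s base(2) sp(2) base(3,4)]) (auto simp: S.independent_empty)
  then obtain B where B: "B \<subseteq> space_at V 1" "\<not> S.dependent B" "space_at V 1 \<subseteq> S.span B"
    and BC: "\<forall>K\<in>C. K \<subseteq> S.span (B \<inter> K)" by (elim exE conjE) rule
  have fin: "finite B" by (rule fd_space_independent_finite[OF s sp(1) B(1,2)])
  then obtain h where h: "bij_betw h {..<card B} B"
    using ex_bij_betw_nat_finite by (metis lessThan_atLeast0)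
  have "S.span B = space_at V 1" using B sp(2) by (intro S.span_subspace) auto
  then have "indexed_basis s {..<card B} h (space_at V 1)"
    using h B(2) by (auto simp: indexed_basis_iff_independent[OF s] bij_betw_def)
  then have "strand_basis s 1 V {..<card B} (\<lambda>j. {1..1}) (\<lambda>j i. h j)"
    by (auto simp: strand_basis_def lessThan_def)
  moreover have "K \<subseteq> S.span (h ` {j. j < card B \<and> h j \<in> K})" if "K \<in> C" for K
  proof -
    have "h ` {j. j < card B \<and> h j \<in> K} = B \<inter> K" using h by (auto simp: bij_betw_def)
    then show ?thesis using BC that by simp
  qed
  ultimately show ?case unfolding has_adapted_strands_def
    by (intro exI[of _ "card B"] exI[of _ "\<lambda>_. 1"] exI[of _ "\<lambda>j i. h j"]) auto
next
  interpret S: vector_space s by fact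
  interpret SS: vector_space_pair s s by unfold_locales
  case (Suc m)
  let ?X = "space_at V m" and ?Y = "space_at V (Suc m)"
  have V': "V \<in> zigzag_modules s m" by (rule zigzag_modules_Suc[OF Suc.prems(1)])
  have X: "S.subspace ?X" using zigzag_module_spaces[OF V', of m] Suc.hyps by simp
  have Y: "fd_space s ?Y" "S.subspace ?Y" using zigzag_module_spaces[OF Suc.prems(1)] by auto
  have lin: "linear_between s (space_at V (src V m)) s (space_at V (tgt V m)) (map_at V m)"
    using Suc.prems(1) Suc.hyps by (auto simp: zigzag_modules_def)
  have "S.subspace (space_at V (src V m))"
    using X Y by (auto simp: src_def split: direction.split)
  then obtain P where P: "Vector_Spaces.linear s s P"
    "\<And>x. x \<in> space_at V (src V m) \<Longrightarrow> P x = map_at V m x"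
    using linear_between_extend[OF s s _ lin] by blast
  interpret P: Vector_Spaces.linear s s P by (rule P(1))
  show ?case
  proof (cases "dir_at V m")
    case Fwd
    then have st: "src V m = m" "tgt V m = Suc m" by (auto simp: src_def tgt_def)
    have PX: "P x \<in> ?Y" if "x \<in> ?X" for x
      using lin P(2) st that by (auto simp: linear_between_def)
    define pre where "pre K = ?X \<inter> {x. P x \<in> K}" for K
    have presub: "S.subspace (pre K)" if "S.subspace K" for K
      unfolding pre_def by (intro S.subspace_inter X P.subspace_linear_preimage that)
    have pre0: "S.subspace (pre {0})" by (rule presub) simp
    have strands: "has_adapted_strands s m V (pre ` insert {0} C)"
    proof (rule Suc.IH[OF V'])
      show "finite (pre ` insert {0} C)" using Suc.prems(2) by simp
      show "S.subspace K \<and> K \<subseteq> ?X" if "K \<in> pre ` insert {0} C" for K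
      proof -
        have "S.subspace K" using that presub Suc.prems(3) pre0 by blast
        then show ?thesis using that by (auto simp: pre_def)
      qed
      have "K \<subseteq> L \<or> L \<subseteq> K" if "K \<in> insert {0} C" "L \<in> insert {0} C" for K L
        using that Suc.prems(3,4) S.subspace_0 by blast
      then show "K \<subseteq> L \<or> L \<subseteq> K" if "K \<in> pre ` insert {0} C" "L \<in> pre ` insert {0} C" for K L
        using that unfolding pre_def by blast
    qed
    obtain N :: nat and b d e where bd: "\<And>j. j < N \<Longrightarrow> 1 \<le> b j \<and> b j \<le> d j \<and> d j \<le> m"
      and e: "strand_basis s m V {..<N} (\<lambda>j. {b j..d j}) e"
      and ad': "\<And>K. K \<in> pre ` insert {0} C \<Longrightarrow>
        K \<subseteq> S.span ((\<lambda>j. e j m) ` {j. j < N \<and> d j = m \<and> e j m \<in> K})"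
      by (rule has_adapted_strandsE[OF strands]) (rule that)
    note ad = ad'[OF imageI]
    define Jm where "Jm = {j. j < N \<and> d j = m}"
    \<comment> \<open>The strands in \<open>Jk\<close> span the kernel, since the preimage of \<open>{0}\<close> is a member of the chain.\<close>
    define Jk where "Jk = {j \<in> Jm. P (e j m) = 0}"
    define Ja where "Ja = Jm - Jk"
    have "{j\<in>{..<N}. m \<in> {b j..d j}} = Jm" using bd by (force simp: Jm_def)
    then have em: "indexed_basis s Jm (\<lambda>j. e j m) ?X"
      using e Suc.hyps unfolding strand_basis_def by auto
    have emX: "e j m \<in> ?X" if "j \<in> Jm" for j using indexed_basis_mem[OF s em that] .
    have ker: "x \<in> S.span ((\<lambda>j. e j m) ` Jk)" if "x \<in> ?X" "P x = 0" for x
    proof -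
      have "x \<in> pre {0}" using that by (simp add: pre_def)
      moreover have "{j. j < N \<and> d j = m \<and> e j m \<in> pre {0}} = Jk"
        using emX by (auto simp: Jk_def Jm_def pre_def)
      ultimately show ?thesis using ad[of "{0}"] by auto
    qed
    have Ja: "Ja \<subseteq> Jm" "Jk \<subseteq> Jm" "Ja \<inter> Jk = {}" by (auto simp: Ja_def Jk_def)
    define A where "A = (\<lambda>j. P (e j m)) ` Ja"
    have spX: "S.span ((\<lambda>j. e j m) ` G) \<subseteq> ?X" if "G \<subseteq> Jm" for G
      using that emX by (intro S.span_minimal X) auto
    have inj: "inj_on P (S.span ((\<lambda>j. e j m) ` Ja))"
      unfolding P.inj_on_iff_eq_0[OF S.subspace_span]
      using indexed_basis_disjoint_spans[OF s em Ja] ker spX[OF Ja(1)] by blast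
    have Jab: "inj_on (\<lambda>j. e j m) Ja" "\<not> S.dependent ((\<lambda>j. e j m) ` Ja)"
      using indexed_basis_subset[OF s em Ja(1)] unfolding indexed_basis_iff_independent[OF s] by auto
    have "\<not> S.dependent (P ` (\<lambda>j. e j m) ` Ja)"
      using P.independent_injective_image[OF Jab(2) inj] .
    then have Aind: "\<not> S.dependent A" by (simp add: A_def image_image)
    have Ainj: "inj_on (\<lambda>j. P (e j m)) Ja"
      using comp_inj_on[OF Jab(1), of P] inj_on_subset[OF inj S.span_superset] by (simp add: o_def)
    have finJ: "finite Jm" by (simp add: Jm_def)
    have finA: "finite A" unfolding A_def using finJ Ja by (auto intro: finite_subset)
    have AY: "A \<subseteq> ?Y" using PX emX Ja by (auto simp: A_def)
    have im: "P ` S.span ((\<lambda>j. e j m) ` G) \<subseteq> S.span ((\<lambda>j. P (e j m)) ` (G \<inter> Ja))" if "G \<subseteq> Jm" for G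
    proof -
      have "P ` S.span ((\<lambda>j. e j m) ` G) = S.span ((\<lambda>j. P (e j m)) ` G)"
        by (simp add: P.span_image[symmetric] image_image)
      also have "\<dots> \<subseteq> S.span ((\<lambda>j. P (e j m)) ` (G \<inter> Ja))"
      proof (rule S.span_minimal[OF _ S.subspace_span], rule image_subsetI)
        fix j assume "j \<in> G"
        show "P (e j m) \<in> S.span ((\<lambda>j. P (e j m)) ` (G \<inter> Ja))"
        proof (cases "j \<in> Ja")
          case True
          then show ?thesis using \<open>j \<in> G\<close> by (intro S.span_base) auto
        next
          case False
          then have "P (e j m) = 0" using that \<open>j \<in> G\<close> by (auto simp: Ja_def Jk_def)
          then show ?thesis using S.span_zero by simp
        qed
      qed
      finally show ?thesis .
    qed
    have Aad: "K \<inter> S.span A \<subseteq> S.span (A \<inter> K)" if K: "K \<in> C" for K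
    proof
      fix y assume y: "y \<in> K \<inter> S.span A"
      have "A = P ` (\<lambda>j. e j m) ` Ja" by (simp add: A_def image_image)
      then obtain x where x: "x \<in> S.span ((\<lambda>j. e j m) ` Ja)" "y = P x"
        using y P.span_image by auto
      then have "x \<in> pre K" using y spX[OF Ja(1)] by (auto simp: pre_def)
      define G where "G = {j. j < N \<and> d j = m \<and> e j m \<in> pre K}"
      have "x \<in> S.span ((\<lambda>j. e j m) ` G)" using ad[of K] \<open>x \<in> pre K\<close> K by (auto simp: G_def)
      moreover have "G \<subseteq> Jm" by (auto simp: G_def Jm_def)
      ultimately have "y \<in> S.span ((\<lambda>j. P (e j m)) ` (G \<inter> Ja))" using im x(2) by blast
      moreover have "(\<lambda>j. P (e j m)) ` (G \<inter> Ja) \<subseteq> A \<inter> K" by (auto simp: G_def A_def pre_def)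
      ultimately show "y \<in> S.span (A \<inter> K)" using S.span_mono by blast
    qed
    have "\<exists>B. A \<subseteq> B \<and> B \<subseteq> ?Y \<and> \<not> S.dependent B \<and> ?Y \<subseteq> S.span B \<and>
      (\<forall>K\<in>C. K \<subseteq> S.span (B \<inter> K))"
      by (rule extend_to_adapted_basis[OF s Suc.prems(2) Y(2) Suc.prems(3,4) finA AY Aind Aad])
    then obtain B where B: "A \<subseteq> B" "B \<subseteq> ?Y" "\<not> S.dependent B" "?Y \<subseteq> S.span B"
      "\<forall>K\<in>C. K \<subseteq> S.span (B \<inter> K)" by (elim exE conjE) (rule that)
    have finB: "finite B" by (rule fd_space_independent_finite[OF s Y(1) B(2,3)])
    then have "card {N..<N + card (B - A)} = card (B - A)" by simp
    then obtain h where h: "bij_betw h {N..<N + card (B - A)} (B - A)"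
      using finB by (metis finite_Diff finite_atLeastLessThan finite_same_card_bij)
    define N' where "N' = N + card (B - A)"
    define g where "g j = (if j \<in> Ja then P (e j m) else h j)" for j
    have JaN: "j < N" if "j \<in> Ja" for j using that Ja by (auto simp: Jm_def)
    have gA: "g ` Ja = A" "inj_on g Ja" using Ainj by (auto simp: g_def A_def inj_on_def)
    have gnew: "g j = h j" if "j \<in> {N..<N'}" for j using JaN that by (force simp: g_def)
    have gN: "g ` {N..<N'} = B - A" "inj_on g {N..<N'}"
      using h image_cong[OF refl gnew, of "{N..<N'}"] inj_on_cong[of "{N..<N'}" g h, OF gnew]
      by (simp_all add: bij_betw_def N'_def)
    have img: "g ` (Ja \<union> {N..<N'}) = B" using gA gN B(1) by auto
    have "inj_on g (Ja \<union> {N..<N'})" unfolding inj_on_Un using gA gN by auto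
    moreover have "S.span B = ?Y" using B Y(2) by (intro S.span_subspace) auto
    ultimately have gb: "indexed_basis s (Ja \<union> {N..<N'}) g ?Y"
      unfolding indexed_basis_iff_independent[OF s] img using B(3) finJ Ja
      by (auto intro: finite_subset)
    show ?thesis
    proof (rule adapted_strands_step[OF Suc.hyps e bd _ _ gb])
      show "Ja \<subseteq> {j. j < N \<and> d j = m}" using Ja by (auto simp: Jm_def)
      show "N \<le> N'" by (simp add: N'_def)
      show "map_at V m (e j m) = (if j \<in> Ja then g j else 0)" if "j < N" "d j = m" for j
      proof -
        have "map_at V m (e j m) = P (e j m)" using P(2) emX[of j] st that by (simp add: Jm_def)
        then show ?thesis using that by (auto simp: g_def Ja_def Jk_def Jm_def)
      qed
      show "K \<subseteq> S.span (g ` {j \<in> Ja \<union> {N..<N'}. g j \<in> K})" if "K \<in> C" for K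
      proof -
        have "g ` {j \<in> Ja \<union> {N..<N'}. g j \<in> K} = B \<inter> K" using img by auto
        then show ?thesis using B(5) that by simp
      qed
    qed (use Fwd in auto)
  next
    case Bwd
    then have st: "src V m = Suc m" "tgt V m = m" by (auto simp: src_def tgt_def)
    have PY: "P y \<in> ?X" if "y \<in> ?Y" for y
      using lin P(2) st that by (auto simp: linear_between_def)
    have CY: "S.subspace K \<and> K \<subseteq> ?Y" if "K \<in> insert ?Y C" for K using that Suc.prems(3) Y by auto
    have chain: "K \<subseteq> L \<or> L \<subseteq> K" if "K \<in> insert ?Y C" "L \<in> insert ?Y C" for K L
      using that Suc.prems(3,4) by blast
    have strands: "has_adapted_strands s m V ((`) P ` insert ?Y C)"
    proof (rule Suc.IH[OF V'])
      show "finite ((`) P ` insert ?Y C)" using Suc.prems(2) by simp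
      show "S.subspace K \<and> K \<subseteq> ?X" if "K \<in> (`) P ` insert ?Y C" for K
      proof -
        obtain L where L: "L \<in> insert ?Y C" "K = P ` L" using \<open>K \<in> (`) P ` insert ?Y C\<close> by (rule imageE)
        then show ?thesis using CY[OF L(1)] PY P.subspace_image[of L] by auto
      qed
      show "K \<subseteq> L \<or> L \<subseteq> K" if "K \<in> (`) P ` insert ?Y C" "L \<in> (`) P ` insert ?Y C" for K L
      proof -
        obtain K' L' where KL: "K' \<in> insert ?Y C" "K = P ` K'" "L' \<in> insert ?Y C" "L = P ` L'"
          using \<open>K \<in> (`) P ` insert ?Y C\<close> \<open>L \<in> (`) P ` insert ?Y C\<close> by (elim imageE) (rule that)
        then show ?thesis using chain[OF KL(1,3)] image_mono[of K' L' P] image_mono[of L' K' P] by metis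
      qed
    qed
    obtain N :: nat and b d e where bd: "\<And>j. j < N \<Longrightarrow> 1 \<le> b j \<and> b j \<le> d j \<and> d j \<le> m"
      and e: "strand_basis s m V {..<N} (\<lambda>j. {b j..d j}) e"
      and ad': "\<And>K. K \<in> (`) P ` insert ?Y C \<Longrightarrow>
        K \<subseteq> S.span ((\<lambda>j. e j m) ` {j. j < N \<and> d j = m \<and> e j m \<in> K})"
      by (rule has_adapted_strandsE[OF strands]) (rule that)
    note ad = ad'[OF imageI]
    define Jm where "Jm = {j. j < N \<and> d j = m}"
    define Ja where "Ja = {j \<in> Jm. e j m \<in> P ` ?Y}"
    have "{j\<in>{..<N}. m \<in> {b j..d j}} = Jm" using bd by (force simp: Jm_def)
    then have em: "indexed_basis s Jm (\<lambda>j. e j m) ?X"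
      using e Suc.hyps unfolding strand_basis_def by auto
    have finJ: "finite Jm" by (simp add: Jm_def)
    have Ja: "Ja \<subseteq> Jm" "finite Ja" using finJ by (auto simp: Ja_def)
    have Jab: "indexed_basis s Ja (\<lambda>j. e j m) (S.span ((\<lambda>j. e j m) ` Ja))"
      by (rule indexed_basis_subset[OF s em Ja(1)])
    have lift: "\<exists>y. y \<in> ?Y \<and> P y = e j m \<and> (\<forall>K\<in>insert ?Y C. e j m \<in> P ` K \<longrightarrow> y \<in> K)" if "j \<in> Ja" for j
    proof -
      let ?D = "{K \<in> insert ?Y C. e j m \<in> P ` K}"
      have "finite ?D" "?D \<noteq> {}" using that Suc.prems(2) by (auto simp: Ja_def)
      from finite_has_minimal[OF this] obtain K where K: "K \<in> ?D" "\<forall>L\<in>?D. L \<subseteq> K \<longrightarrow> K = L"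
        by (elim bexE) (rule that)
      then have KC: "K \<in> insert ?Y C" and "e j m \<in> P ` K" by auto
      then obtain y where y: "y \<in> K" "P y = e j m" by (auto elim!: imageE)
      have min: "K \<subseteq> L" if "L \<in> insert ?Y C" "e j m \<in> P ` L" for L
        using chain[OF KC that(1)] K(2) that by auto
      show ?thesis
      proof (intro exI conjI ballI impI)
        show "y \<in> ?Y" using y CY[OF KC] by blast
        show "y \<in> L" if "L \<in> insert ?Y C" "e j m \<in> P ` L" for L using min[OF that] y(1) by blast
      qed (fact y(2))
    qed
    \<comment> \<open>Lifting into the smallest member keeps the lifts adapted to every member of the chain.\<close>
    define l where "l j = (SOME y. y \<in> ?Y \<and> P y = e j m \<and> (\<forall>K\<in>insert ?Y C. e j m \<in> P ` K \<longrightarrow> y \<in> K))"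
      for j
    have l: "\<And>j. j \<in> Ja \<Longrightarrow> l j \<in> ?Y" "\<And>j. j \<in> Ja \<Longrightarrow> P (l j) = e j m"
      "\<And>j K. j \<in> Ja \<Longrightarrow> K \<in> insert ?Y C \<Longrightarrow> e j m \<in> P ` K \<Longrightarrow> l j \<in> K"
      using someI_ex[OF lift, folded l_def] by blast+
    define X0 where "X0 = ?Y \<inter> {y. P y = 0}"
    have X0: "S.subspace X0" unfolding X0_def by (intro S.subspace_inter Y P.subspace_kernel)
    obtain B where B: "B \<subseteq> X0" "\<not> S.dependent B" "X0 \<subseteq> S.span B"
      "\<forall>K\<in>insert ?Y C. K \<inter> X0 \<subseteq> S.span (B \<inter> (K \<inter> X0))"
    proof -
      have "\<exists>B. {} \<subseteq> B \<and> B \<subseteq> X0 \<and> \<not> S.dependent B \<and> X0 \<subseteq> S.span B \<and>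
        (\<forall>K\<in>(\<lambda>K. K \<inter> X0) ` insert ?Y C. K \<subseteq> S.span (B \<inter> K))"
      proof (rule extend_to_adapted_basis[OF s _ X0])
        show "K \<subseteq> L \<or> L \<subseteq> K" if "K \<in> (\<lambda>K. K \<inter> X0) ` insert ?Y C" "L \<in> (\<lambda>K. K \<inter> X0) ` insert ?Y C" for K L
          using that chain by blast
        show "S.subspace K \<and> K \<subseteq> X0" if "K \<in> (\<lambda>K. K \<inter> X0) ` insert ?Y C" for K
          using that CY X0 S.subspace_inter by blast
      qed (use Suc.prems(2) in \<open>auto simp: S.independent_empty\<close>)
      then show ?thesis by (elim exE conjE, intro that) simp_all
    qed
    have finB: "finite B"
      by (rule fd_space_independent_finite[OF s Y(1) _ B(2)]) (use B in \<open>auto simp: X0_def\<close>)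
    have "card {N..<N + card B} = card B" by simp
    then obtain h where h: "bij_betw h {N..<N + card B} B"
      using finB by (metis finite_atLeastLessThan finite_same_card_bij)
    define N' where "N' = N + card B"
    define g where "g j = (if j \<in> Ja then l j else h j)" for j
    have JaN: "j < N" if "j \<in> Ja" for j using that Ja by (auto simp: Jm_def)
    have gnew: "g j = h j" if "j \<in> {N..<N'}" for j using JaN that by (force simp: g_def)
    have hB: "h ` {N..<N'} = B" "inj_on h {N..<N'}" using h by (auto simp: bij_betw_def N'_def)
    have hb: "indexed_basis s {N..<N'} h (S.span B)"
      using hB B(2) by (simp add: indexed_basis_iff_independent[OF s])
    have hX: "h j \<in> X0" if "j \<in> {N..<N'}" for j using that hB(1) B(1) by blast
    have PB: "P (h j) = 0" if "j \<in> {N..<N'}" for j using hX[OF that] by (simp add: X0_def)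
    have disj: "Ja \<inter> {N..<N'} = {}" using JaN by force
    have gY: "g j \<in> ?Y" if "j \<in> Ja \<union> {N..<N'}" for j
      using that l(1)[of j] hX[of j] gnew[of j] unfolding X0_def g_def by auto
    have ind: "c j = 0" if sum: "(\<Sum>j\<in>Ja \<union> {N..<N'}. s (c j) (g j)) = 0" and j: "j \<in> Ja \<union> {N..<N'}" for c j
    proof -
      have split: "(\<Sum>j\<in>Ja. s (c j) (l j)) + (\<Sum>j\<in>{N..<N'}. s (c j) (h j)) = 0"
        using sum gnew Ja(2) disj by (simp add: sum.union_disjoint g_def)
      have "P ((\<Sum>j\<in>Ja. s (c j) (l j)) + (\<Sum>j\<in>{N..<N'}. s (c j) (h j))) = (\<Sum>j\<in>Ja. s (c j) (e j m))"
        by (simp add: P.add P.sum P.scale l PB)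
      then have "(\<Sum>j\<in>Ja. s (c j) (e j m)) = 0" using split by (simp add: P.zero)
      then have 1: "c j = 0" if "j \<in> Ja" for j using indexed_basis_zero[OF Jab _ that] by blast
      then have "(\<Sum>j\<in>{N..<N'}. s (c j) (h j)) = 0" using split by simp
      then have "c j = 0" if "j \<in> {N..<N'}" for j using indexed_basis_zero[OF hb _ that] by blast
      with 1 show ?thesis using j by blast
    qed
    have gspan: "K \<subseteq> S.span (g ` {j \<in> Ja \<union> {N..<N'}. g j \<in> K})" if K: "K \<in> insert ?Y C" for K
    proof
      fix y assume y: "y \<in> K"
      let ?G = "{j \<in> Ja \<union> {N..<N'}. g j \<in> K}"
      define G where "G = {j. j < N \<and> d j = m \<and> e j m \<in> P ` K}"
      have G: "j \<in> Ja \<and> l j \<in> K" if "j \<in> G" for j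
      proof -
        have "j \<in> Ja" using that CY[OF K] by (auto simp: G_def Ja_def Jm_def)
        then show ?thesis using l(3)[OF _ K] that by (auto simp: G_def)
      qed
      have "(\<lambda>j. e j m) ` G = P ` l ` G" using G l(2) by (auto simp: image_image)
      then have "P y \<in> P ` S.span (l ` G)"
        using ad[OF K] y P.span_image[of "l ` G"] by (auto simp: G_def)
      then obtain x where x: "x \<in> S.span (l ` G)" "P y = P x" by auto
      have lG: "l ` G \<subseteq> g ` ?G" using G by (force simp: g_def)
      have xK: "x \<in> K" using x(1) S.span_minimal[of "l ` G" K] G CY[OF K] by blast
      have "P (y - x) = 0" using x(2) by (simp add: P.diff)
      moreover have "y - x \<in> K" using y xK CY[OF K] S.subspace_diff by blast
      ultimately have "y - x \<in> K \<inter> X0" using CY[OF K] by (auto simp: X0_def)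
      then have "y - x \<in> S.span (B \<inter> (K \<inter> X0))" using bspec[OF B(4) K] by blast
      moreover have "B \<inter> (K \<inter> X0) \<subseteq> g ` ?G"
      proof
        fix z assume z: "z \<in> B \<inter> (K \<inter> X0)"
        then obtain j where "j \<in> {N..<N'}" "z = h j" using hB by auto
        then show "z \<in> g ` ?G" using z gnew[of j] by (intro image_eqI[of _ _ j]) auto
      qed
      ultimately have "y - x \<in> S.span (g ` ?G)" using S.span_mono by blast
      moreover have "x \<in> S.span (g ` ?G)" using x(1) S.span_mono[OF lG] by blast
      ultimately have "(y - x) + x \<in> S.span (g ` ?G)" by (rule S.span_add)
      then show "y \<in> S.span (g ` ?G)" by simp
    qed
    have gY': "S.span (g ` (Ja \<union> {N..<N'})) = ?Y"
    proof (rule S.span_subspace[OF _ _ Y(2)])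
      show "?Y \<subseteq> S.span (g ` (Ja \<union> {N..<N'}))"
        using gspan[of ?Y] S.span_mono[of "g ` {j \<in> Ja \<union> {N..<N'}. g j \<in> ?Y}" "g ` (Ja \<union> {N..<N'})"]
        by blast
    qed (use gY in auto)
    have gb: "indexed_basis s (Ja \<union> {N..<N'}) g ?Y"
    proof (rule indexed_basisI_span[OF s])
      show "finite (Ja \<union> {N..<N'})" using Ja(2) by simp
      show "c j = 0" if "(\<Sum>j\<in>Ja \<union> {N..<N'}. s (c j) (g j)) = 0" "j \<in> Ja \<union> {N..<N'}" for c j
        by (rule ind[OF that])
    qed (rule gY')
    show ?thesis
    proof (rule adapted_strands_step[OF Suc.hyps e bd _ _ gb])
      show "Ja \<subseteq> {j. j < N \<and> d j = m}" using Ja by (auto simp: Jm_def)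
      show "N \<le> N'" by (simp add: N'_def)
      show "map_at V m (g j) = (if j \<in> Ja then e j m else 0)" if "j \<in> Ja \<union> {N..<N'}" for j
      proof -
        have "map_at V m (g j) = P (g j)" using P(2) gY[OF that] st by simp
        then show ?thesis using that l(2) PB gnew by (auto simp: g_def)
      qed
      show "K \<subseteq> S.span (g ` {j \<in> Ja \<union> {N..<N'}. g j \<in> K})" if "K \<in> C" for K
        using gspan that by blast
    qed (use Bwd in auto)
  qed
qed


section \<open>Uniqueness of interval decompositions\<close>

lemma src_tgt_range:
  assumes "i \<in> {1..<n}"
  shows "src V i \<in> {1..n}" "tgt V i \<in> {1..n}"
  using assms by (auto simp: src_def tgt_def split: direction.split)

lemma same_type_src_tgt:
  assumes "same_type n V W" "i \<in> {1..<n}"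
  shows "src V i = src W i" "tgt V i = tgt W i"
  using assms by (auto simp: same_type_def src_def tgt_def)

lemma zigzag_module_maps:
  assumes "V \<in> zigzag_modules s n" "i \<in> {1..<n}"
  shows "linear_between s (space_at V (src V i)) s (space_at V (tgt V i)) (map_at V i)"
  using assms by (auto simp: zigzag_modules_def)

lemma linear_between_eq_on_basis:
  assumes s: "vector_space s" and t: "vector_space t" and b: "indexed_basis s A f X"
    and g: "linear_between s X t Y g" and h: "linear_between s X t Y h"
    and eq: "\<And>a. a \<in> A \<Longrightarrow> g (f a) = h (f a)" and x: "x \<in> X"
  shows "g x = h x"
proof -
  obtain c where c: "x = (\<Sum>a\<in>A. s (c a) (f a))" using indexed_basis_expand[OF b x] by blast
  note m = indexed_basis_mem[OF s b] indexed_basis_subspace[OF s b]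
  have "g x = (\<Sum>a\<in>A. t (c a) (g (f a)))" unfolding c by (rule linear_between_sum[OF s t m(2) g m(1)])
  moreover have "h x = (\<Sum>a\<in>A. t (c a) (h (f a)))" unfolding c by (rule linear_between_sum[OF s t m(2) h m(1)])
  ultimately show ?thesis using eq by simp
qed

lemma strand_basis_reindex:
  assumes h: "bij_betw h J' J" and e: "strand_basis s n V J T e"
  shows "strand_basis s n V J' (T \<circ> h) (e \<circ> h)"
proof -
  have "bij_betw h {j\<in>J'. i \<in> T (h j)} {j\<in>J. i \<in> T j}" for i
    using h by (auto simp: bij_betw_def inj_on_def)
  then have "indexed_basis s {j\<in>J'. i \<in> T (h j)} ((\<lambda>j. e j i) \<circ> h) (space_at V i)" if "i \<in> {1..n}" for i
    using e that by (intro indexed_basis_reindex[where A = "{j\<in>J. i \<in> T j}"]) (auto simp: strand_basis_def)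
  moreover have "finite J'" using h e by (auto simp: strand_basis_def bij_betw_finite)
  moreover have "h j \<in> J" if "j \<in> J'" for j using h that by (auto simp: bij_betw_def)
  ultimately show ?thesis using e by (auto simp: strand_basis_def o_def)
qed

lemma strand_basis_pullback:
  assumes s: "vector_space s" and t: "vector_space t" and V: "V \<in> zigzag_modules s n"
    and iso: "zigzag_iso n s V t W" and e: "strand_basis t n W J T e"
  shows "\<exists>e'. strand_basis s n V J T e'"
proof -
  obtain f where f: "zigzag_morphism n s V t W f"
    and b: "\<And>i. i \<in> {1..n} \<Longrightarrow> bij_betw (f i) (space_at V i) (space_at W i)"
    using iso unfolding zigzag_iso_def by blast
  have ty: "same_type n V W"
    and lin: "\<And>i. i \<in> {1..n} \<Longrightarrow> linear_between s (space_at V i) t (space_at W i) (f i)"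
    and comm: "\<And>i x. i \<in> {1..<n} \<Longrightarrow> x \<in> space_at V (src V i) \<Longrightarrow>
        f (tgt V i) (map_at V i x) = map_at W i (f (src V i) x)"
    using f unfolding zigzag_morphism_def by blast+
  define g where "g i = inv_into (space_at V i) (f i)" for i
  have sub: "module.subspace s (space_at V i)" if "i \<in> {1..n}" for i
    using zigzag_module_spaces[OF V] that by auto
  have g: "linear_between t (space_at W i) s (space_at V i) (g i)" "bij_betw (g i) (space_at W i) (space_at V i)"
    if "i \<in> {1..n}" for i
    unfolding g_def
    using linear_between_inv_into[OF s sub[OF that] lin[OF that] b[OF that]]
      bij_betw_inv_into[OF b[OF that]] by auto
  have fg: "f i (g i y) = y" if "i \<in> {1..n}" "y \<in> space_at W i" for i y
    unfolding g_def using b[OF that(1)] that(2) by (simp add: bij_betw_inv_into_right)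
  have gf: "g i (f i x) = x" if "i \<in> {1..n}" "x \<in> space_at V i" for i x
    unfolding g_def using b[OF that(1)] that(2) by (simp add: bij_betw_inv_into_left)
  have ib: "indexed_basis t {j\<in>J. i \<in> T j} (\<lambda>j. e j i) (space_at W i)" if "i \<in> {1..n}" for i
    using e that by (auto simp: strand_basis_def)
  have "strand_basis s n V J T (\<lambda>j i. g i (e j i))"
    unfolding strand_basis_def
  proof (intro conjI ballI impI)
    show "finite J" using e by (simp add: strand_basis_def)
    show "indexed_basis s {j\<in>J. i \<in> T j} (\<lambda>j. g i (e j i)) (space_at V i)" if "i \<in> {1..n}" for i
      using indexed_basis_image[OF t s ib[OF that] g[OF that]] by (simp add: o_def)
    fix i j assume i: "i \<in> {1..<n}" and j: "j \<in> J" and a: "src V i \<in> T j"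
    note st = src_tgt_range[OF i, of V] same_type_src_tgt[OF ty i]
    let ?u = "src V i" and ?v = "tgt V i"
    have eW: "e j ?u \<in> space_at W ?u" using indexed_basis_mem[OF t ib[OF st(1)], of j] j a by simp
    then have x: "g ?u (e j ?u) \<in> space_at V ?u" using g(1)[OF st(1)] by (simp add: linear_between_def)
    then have "map_at V i (g ?u (e j ?u)) \<in> space_at V ?v"
      using zigzag_module_maps[OF V i] by (simp add: linear_between_def)
    then have "map_at V i (g ?u (e j ?u)) = g ?v (f ?v (map_at V i (g ?u (e j ?u))))"
      using gf[OF st(2)] by simp
    also have "f ?v (map_at V i (g ?u (e j ?u))) = map_at W i (e j ?u)"
      using comm[OF i x] fg[OF st(1) eW] by simp
    also have "\<dots> = (if ?v \<in> T j then e j ?v else 0)"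
      using e i j a st by (auto simp: strand_basis_def)
    also have "g ?v \<dots> = (if ?v \<in> T j then g ?v (e j ?v) else 0)"
      using linear_between_0[OF t indexed_basis_subspace[OF t ib[OF st(2)]] g(1)[OF st(2)]] by simp
    finally show "map_at V i (g ?u (e j ?u)) = (if ?v \<in> T j then g ?v (e j ?v) else 0)" .
  qed
  then show ?thesis by blast
qed

lemma strand_basis_imp_iso:
  assumes s: "vector_space s" and t: "vector_space t"
    and V: "V \<in> zigzag_modules s n" and W: "W \<in> zigzag_modules t n"
    and ty: "same_type n V W"
    and e: "strand_basis s n V J T e" and e': "strand_basis t n W J T e'"
  shows "zigzag_iso n s V t W"
proof -
  have ib: "indexed_basis s {j\<in>J. i \<in> T j} (\<lambda>j. e j i) (space_at V i)"
    "indexed_basis t {j\<in>J. i \<in> T j} (\<lambda>j. e' j i) (space_at W i)" if "i \<in> {1..n}" for i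
    using e e' that by (auto simp: strand_basis_def)
  define f where "f i = (SOME f. Vector_Spaces.linear s t f \<and> (\<forall>j\<in>{j\<in>J. i \<in> T j}. f (e j i) = e' j i))" for i
  have f: "Vector_Spaces.linear s t (f i)" "\<And>j. j \<in> J \<Longrightarrow> i \<in> T j \<Longrightarrow> f i (e j i) = e' j i"
    if "i \<in> {1..n}" for i
    using someI_ex[OF indexed_basis_linear_exists[OF s t ib(1)[OF that], of "\<lambda>j. e' j i"], folded f_def]
    by auto
  interpret T: vector_space t by (rule t)
  have lin: "linear_between s (space_at V i) t (space_at W i) (f i)" if i: "i \<in> {1..n}" for i
  proof (rule linear_imp_linear_between[OF f(1)[OF i]])
    interpret F: Vector_Spaces.linear s t "f i" by (rule f(1)[OF i])
    fix x assume "x \<in> space_at V i"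
    then obtain c where "x = (\<Sum>j\<in>{j\<in>J. i \<in> T j}. s (c j) (e j i))"
      using indexed_basis_expand[OF ib(1)[OF i]] by blast
    then have "f i x = (\<Sum>j\<in>{j\<in>J. i \<in> T j}. t (c j) (e' j i))"
      using f(2)[OF i] by (simp add: F.sum F.scale)
    then show "f i x \<in> space_at W i" using indexed_basis_sum_mem[OF ib(2)[OF i]] by simp
  qed
  have bij: "bij_betw (f i) (space_at V i) (space_at W i)" if i: "i \<in> {1..n}" for i
    by (rule indexed_basis_linear_bij[OF s t ib[OF i] lin[OF i]]) (use f(2)[OF i] in auto)
  have "f (tgt V i) (map_at V i x) = map_at W i (f (src V i) x)"
    if i: "i \<in> {1..<n}" and x: "x \<in> space_at V (src V i)" for i x
  proof -
    note st = src_tgt_range[OF i, of V] same_type_src_tgt[OF ty i]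
    note l1 = linear_between_comp[OF zigzag_module_maps[OF V i] lin[OF st(2)]]
    have l2: "linear_between s (space_at V (src V i)) t (space_at W (tgt V i)) (map_at W i \<circ> f (src V i))"
      using linear_between_comp[OF lin[OF st(1)]] zigzag_module_maps[OF W i] st by auto
    have f0: "f (tgt V i) 0 = 0"
      by (rule linear_between_0[OF s indexed_basis_subspace[OF s ib(1)[OF st(2)]] lin[OF st(2)]])
    have "(f (tgt V i) \<circ> map_at V i) x = (map_at W i \<circ> f (src V i)) x"
    proof (rule linear_between_eq_on_basis[OF s t ib(1)[OF st(1)] l1 l2 _ x])
      fix j assume "j \<in> {j\<in>J. src V i \<in> T j}"
      then have j: "j \<in> J" "src V i \<in> T j" by auto
      have "map_at V i (e j (src V i)) = (if tgt V i \<in> T j then e j (tgt V i) else 0)"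
        using e i j by (simp add: strand_basis_def)
      moreover have "map_at W i (e' j (src V i)) = (if tgt V i \<in> T j then e' j (tgt V i) else 0)"
        using e' i j st by (simp add: strand_basis_def)
      ultimately show "(f (tgt V i) \<circ> map_at V i) (e j (src V i)) = (map_at W i \<circ> f (src V i)) (e j (src V i))"
        using f(2)[OF st(1) j] f(2)[OF st(2) j(1)] f0 by auto
    qed
    then show ?thesis by simp
  qed
  then show ?thesis using ty lin bij unfolding zigzag_iso_def zigzag_morphism_def by blast
qed

text \<open>Coordinates commute with the structure maps, that is, they are morphisms to interval modules: a coordinate
of an image vanishes if its strand does not contain the source of the arrow.\<close>

lemma strand_coordinates:
  fixes s :: "'a::field \<Rightarrow> 'v::ab_group_add \<Rightarrow> 'v"
  assumes s: "vector_space s" and V: "V \<in> zigzag_modules s n" and e: "strand_basis s n V J T e"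
  obtains \<kappa> where "\<And>i j. i \<in> {1..n} \<Longrightarrow> Vector_Spaces.linear s (*) (\<kappa> i j)"
    "\<And>i j l. i \<in> {1..n} \<Longrightarrow> j \<in> J \<Longrightarrow> l \<in> J \<Longrightarrow> i \<in> T j \<Longrightarrow> i \<in> T l \<Longrightarrow>
      \<kappa> i j (e l i) = (if j = l then 1 else 0)"
    "\<And>i x. i \<in> {1..n} \<Longrightarrow> x \<in> space_at V i \<Longrightarrow> x = (\<Sum>j\<in>{j\<in>J. i \<in> T j}. s (\<kappa> i j x) (e j i))"
    "\<And>i j x. i \<in> {1..<n} \<Longrightarrow> j \<in> J \<Longrightarrow> x \<in> space_at V (src V i) \<Longrightarrow> tgt V i \<in> T j \<Longrightarrow>
      \<kappa> (tgt V i) j (map_at V i x) = (if src V i \<in> T j then \<kappa> (src V i) j x else 0)"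
proof -
  have ib: "indexed_basis s {j\<in>J. i \<in> T j} (\<lambda>j. e j i) (space_at V i)" if "i \<in> {1..n}" for i
    using e that by (auto simp: strand_basis_def)
  let ?Q = "\<lambda>i \<kappa>. (\<forall>j. Vector_Spaces.linear s (*) (\<kappa> j)) \<and>
    (\<forall>j\<in>{j\<in>J. i \<in> T j}. \<forall>l\<in>{j\<in>J. i \<in> T j}. \<kappa> j (e l i) = (if j = l then 1 else (0::'a))) \<and>
    (\<forall>x\<in>space_at V i. x = (\<Sum>j\<in>{j\<in>J. i \<in> T j}. s (\<kappa> j x) (e j i)))"
  define \<kappa> where "\<kappa> i = (SOME \<kappa>. ?Q i \<kappa>)" for i
  have Q: "?Q i (\<kappa> i)" if "i \<in> {1..n}" for i
  proof -
    have "\<exists>\<kappa>. ?Q i \<kappa>" by (rule indexed_basis_coordinates[OF s ib[OF that]]) blast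
    then show ?thesis unfolding \<kappa>_def by (rule someI_ex)
  qed
  have \<kappa>: "\<And>i j. i \<in> {1..n} \<Longrightarrow> Vector_Spaces.linear s (*) (\<kappa> i j)"
    "\<And>i j l. i \<in> {1..n} \<Longrightarrow> j \<in> J \<Longrightarrow> l \<in> J \<Longrightarrow> i \<in> T j \<Longrightarrow> i \<in> T l \<Longrightarrow>
      \<kappa> i j (e l i) = (if j = l then 1 else (0::'a))"
    "\<And>i x. i \<in> {1..n} \<Longrightarrow> x \<in> space_at V i \<Longrightarrow> x = (\<Sum>j\<in>{j\<in>J. i \<in> T j}. s (\<kappa> i j x) (e j i))"
    using Q by simp_all
  have F: "vector_space ((*) :: 'a \<Rightarrow> 'a \<Rightarrow> 'a)" by (rule vector_space_field)
  interpret S: vector_space s by (rule s)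
  have nat: "\<kappa> (tgt V i) j (map_at V i x) = (if src V i \<in> T j then \<kappa> (src V i) j x else 0)"
    if i: "i \<in> {1..<n}" and j: "j \<in> J" and x: "x \<in> space_at V (src V i)" and a: "tgt V i \<in> T j" for i j x
  proof -
    note st = src_tgt_range[OF i, of V]
    have k: "linear_between s (space_at V i) (*) UNIV (\<kappa> i j)" if "i \<in> {1..n}" for i
      using linear_imp_linear_between[OF \<kappa>(1)[OF that]] by simp
    interpret K: Vector_Spaces.linear s "(*)" "\<kappa> (tgt V i) j" by (rule \<kappa>(1)[OF st(2)])
    have l2: "linear_between s (space_at V (src V i)) (*) UNIV (if src V i \<in> T j then \<kappa> (src V i) j else (\<lambda>_. 0))"
      using k[OF st(1)] by (auto simp: linear_between_def)
    have "(\<kappa> (tgt V i) j \<circ> map_at V i) x = (if src V i \<in> T j then \<kappa> (src V i) j else (\<lambda>_. 0)) x"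
    proof (rule linear_between_eq_on_basis[OF s F ib[OF st(1)]
        linear_between_comp[OF zigzag_module_maps[OF V i] k[OF st(2)]] l2 _ x])
      fix l assume "l \<in> {j\<in>J. src V i \<in> T j}"
      then have l: "l \<in> J" "src V i \<in> T l" by auto
      have "map_at V i (e l (src V i)) = (if tgt V i \<in> T l then e l (tgt V i) else 0)"
        using e i l by (simp add: strand_basis_def)
      then show "(\<kappa> (tgt V i) j \<circ> map_at V i) (e l (src V i)) =
        (if src V i \<in> T j then \<kappa> (src V i) j else (\<lambda>_. 0)) (e l (src V i))"
        using \<kappa>(2)[OF st(2) j l(1) a] \<kappa>(2)[OF st(1) j l(1) _ l(2)] a l(2) by (auto simp: K.zero)
    qed
    then show ?thesis by auto
  qed
  show ?thesis by (rule that[OF \<kappa> nat])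
qed

text \<open>The strands with interval \<open>I = {b..d}\<close> of the first decomposition give morphisms \<open>I \<rightarrow> V \<rightarrow> I\<close> whose compositions
form an identity matrix.  Through the second decomposition, each composition is a sum over its strands \<open>k\<close>, where
the contribution \<open>M\<close> of \<open>k\<close> does not depend on the index at which it is computed, and vanishes next to an index
in just one of the two intervals.  So only strands with interval \<open>I\<close> contribute, and the identity
matrix factors through as many dimensions as there are such strands.\<close>

lemma strand_multiplicity_le:
  fixes s :: "'a::field \<Rightarrow> 'v::ab_group_add \<Rightarrow> 'v"
  assumes s: "vector_space s" and V: "V \<in> zigzag_modules s n"
    and e: "strand_basis s n V J T e" and e': "strand_basis s n V J' T' e'"
    and T': "\<And>j. j \<in> J' \<Longrightarrow> \<exists>b d. T' j = {b..d} \<and> 1 \<le> b \<and> d \<le> n"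
    and bd: "1 \<le> b" "b \<le> d" "d \<le> n"
  shows "card {j\<in>J. T j = {b..d}} \<le> card {j\<in>J'. T' j = {b..d}}"
proof -
  interpret S: vector_space s by (rule s)
  obtain \<kappa> where \<kappa>: "\<And>i j. i \<in> {1..n} \<Longrightarrow> Vector_Spaces.linear s (*) (\<kappa> i j)"
    "\<And>i j l. i \<in> {1..n} \<Longrightarrow> j \<in> J \<Longrightarrow> l \<in> J \<Longrightarrow> i \<in> T j \<Longrightarrow> i \<in> T l \<Longrightarrow>
      \<kappa> i j (e l i) = (if j = l then 1 else 0)"
    "\<And>i x. i \<in> {1..n} \<Longrightarrow> x \<in> space_at V i \<Longrightarrow> x = (\<Sum>j\<in>{j\<in>J. i \<in> T j}. s (\<kappa> i j x) (e j i))"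
    "\<And>i j x. i \<in> {1..<n} \<Longrightarrow> j \<in> J \<Longrightarrow> x \<in> space_at V (src V i) \<Longrightarrow> tgt V i \<in> T j \<Longrightarrow>
      \<kappa> (tgt V i) j (map_at V i x) = (if src V i \<in> T j then \<kappa> (src V i) j x else 0)"
    using strand_coordinates[OF s V e] by blast
  obtain \<kappa>' where \<kappa>': "\<And>i j. i \<in> {1..n} \<Longrightarrow> Vector_Spaces.linear s (*) (\<kappa>' i j)"
    "\<And>i j l. i \<in> {1..n} \<Longrightarrow> j \<in> J' \<Longrightarrow> l \<in> J' \<Longrightarrow> i \<in> T' j \<Longrightarrow> i \<in> T' l \<Longrightarrow>
      \<kappa>' i j (e' l i) = (if j = l then 1 else 0)"
    "\<And>i x. i \<in> {1..n} \<Longrightarrow> x \<in> space_at V i \<Longrightarrow> x = (\<Sum>j\<in>{j\<in>J'. i \<in> T' j}. s (\<kappa>' i j x) (e' j i))"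
    "\<And>i j x. i \<in> {1..<n} \<Longrightarrow> j \<in> J' \<Longrightarrow> x \<in> space_at V (src V i) \<Longrightarrow> tgt V i \<in> T' j \<Longrightarrow>
      \<kappa>' (tgt V i) j (map_at V i x) = (if src V i \<in> T' j then \<kappa>' (src V i) j x else 0)"
    using strand_coordinates[OF s V e'] by blast
  define G where "G = {j\<in>J. T j = {b..d}}"
  define G' where "G' = {j\<in>J'. T' j = {b..d}}"
  have eV: "e j i \<in> space_at V i" if "i \<in> {1..n}" "j \<in> J" "i \<in> T j" for i j
    using e that indexed_basis_mem[OF s] by (fastforce simp: strand_basis_def)
  have e'V: "e' j i \<in> space_at V i" if "i \<in> {1..n}" "j \<in> J'" "i \<in> T' j" for i j
    using e' that indexed_basis_mem[OF s] by (fastforce simp: strand_basis_def)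
  have pe: "map_at V i (e j (src V i)) = (if tgt V i \<in> T j then e j (tgt V i) else 0)"
    if "i \<in> {1..<n}" "j \<in> J" "src V i \<in> T j" for i j using e that by (auto simp: strand_basis_def)
  have pe': "map_at V i (e' j (src V i)) = (if tgt V i \<in> T' j then e' j (tgt V i) else 0)"
    if "i \<in> {1..<n}" "j \<in> J'" "src V i \<in> T' j" for i j using e' that by (auto simp: strand_basis_def)
  \<comment> \<open>The contribution of the strand \<open>k\<close> to the entry \<open>(j, l)\<close>, computed at the index \<open>i\<close>.\<close>
  define M where "M j k l i = \<kappa>' i k (e j i) * \<kappa> i l (e' k i)" for j k l i
  have \<kappa>0: "\<kappa> i l 0 = 0" "\<kappa>' i k 0 = 0" if "i \<in> {1..n}" for i l k
  proof -
    interpret K: Vector_Spaces.linear s "(*)" "\<kappa> i l" by (rule \<kappa>(1)[OF that])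
    interpret K': Vector_Spaces.linear s "(*)" "\<kappa>' i k" by (rule \<kappa>'(1)[OF that])
    show "\<kappa> i l 0 = 0" "\<kappa>' i k 0 = 0" by (rule K.zero, rule K'.zero)
  qed
  have const: "M j k l (src V i) = M j k l (tgt V i)"
    if i: "i \<in> {1..<n}" and "j \<in> G" "l \<in> G" "k \<in> J'"
      and "src V i \<in> {b..d}" "tgt V i \<in> {b..d}" "src V i \<in> T' k" "tgt V i \<in> T' k" for i j k l
  proof -
    note st = src_tgt_range[OF i, of V]
    have "\<kappa>' (tgt V i) k (e j (tgt V i)) = \<kappa>' (src V i) k (e j (src V i))"
      using \<kappa>'(4)[OF i, of k "e j (src V i)"] eV[OF st(1), of j] pe[OF i, of j] that by (simp add: G_def)
    moreover have "\<kappa> (tgt V i) l (e' k (tgt V i)) = \<kappa> (src V i) l (e' k (src V i))"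
      using \<kappa>(4)[OF i, of l "e' k (src V i)"] e'V[OF st(1), of k] pe'[OF i, of k] that by (simp add: G_def)
    ultimately show ?thesis by (simp add: M_def)
  qed
  have bnd: "M j k l v = 0"
    if i: "i \<in> {1..<n}" and jkl: "j \<in> G" "l \<in> G" "k \<in> J'" and uv: "{u, v} = {src V i, tgt V i}"
      and v: "v \<in> {b..d}" "v \<in> T' k" and u: "u \<in> {b..d} \<longleftrightarrow> u \<notin> T' k" for i j k l u v
  proof -
    note st = src_tgt_range[OF i, of V]
    have "src V i \<noteq> tgt V i" by (auto simp: src_def tgt_def split: direction.split)
    then have or: "u = src V i \<and> v = tgt V i \<or> v = src V i \<and> u = tgt V i"
      using uv by (auto simp: doubleton_eq_iff)
    have "\<kappa>' v k (e j v) = 0 \<or> \<kappa> v l (e' k v) = 0"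
      using or
    proof (elim disjE conjE)
      assume e: "u = src V i" "v = tgt V i"
      show ?thesis
      proof (cases "u \<in> {b..d}")
        case True
        then have "u \<notin> T' k" using u by blast
        with True show ?thesis
          using \<kappa>'(4)[OF i, of k "e j u"] eV[OF st(1), of j] pe[OF i, of j] jkl v e by (simp add: G_def del: atLeastAtMost_iff)
      next
        case False
        then have "u \<in> T' k" using u by blast
        with False show ?thesis
          using \<kappa>(4)[OF i, of l "e' k u"] e'V[OF st(1), of k] pe'[OF i, of k] jkl v e by (simp add: G_def del: atLeastAtMost_iff)
      qed
    next
      assume e: "v = src V i" "u = tgt V i"
      show ?thesis
      proof (cases "u \<in> {b..d}")
        case True
        then have "u \<notin> T' k" using u by blast
        with True show ?thesis
          using \<kappa>(4)[OF i, of l "e' k v"] e'V[OF st(1), of k] pe'[OF i, of k] jkl v e \<kappa>0[OF st(2)]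
          by (simp add: G_def del: atLeastAtMost_iff)
      next
        case False
        then have "u \<in> T' k" using u by blast
        with False show ?thesis
          using \<kappa>'(4)[OF i, of k "e j v"] eV[OF st(1), of j] pe[OF i, of j] jkl v e \<kappa>0[OF st(2)]
          by (simp add: G_def del: atLeastAtMost_iff)
      qed
    qed
    then show ?thesis by (auto simp: M_def)
  qed
  have edge: "{i, Suc i} = {src V i, tgt V i}" for i
    by (auto simp: src_def tgt_def split: direction.split)
  have along: "M j k l i = M j k l (Suc i)" if "i \<in> {1..<n}" "j \<in> G" "l \<in> G" "k \<in> J'"
    "i \<in> {b..d} \<inter> T' k" "Suc i \<in> {b..d} \<inter> T' k" for i j k l
    using const[OF that(1-4)] that(5,6) edge[of i] by (auto simp: doubleton_eq_iff)
  have zero: "M j k l b = 0" if jkl: "j \<in> G" "l \<in> G" "k \<in> J'" and k: "b \<in> T' k" "T' k \<noteq> {b..d}" for j k l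
  proof -
    obtain b' d' where T: "T' k = {b'..d'}" "1 \<le> b'" "d' \<le> n" using T'[OF jkl(3)] by blast
    have b': "b' \<le> b" "b \<le> d'" using k T by auto
    show ?thesis
    proof (cases "b' = b")
      case False
      have "M j k l b = 0"
        by (rule bnd[of "b - 1" j l k "b - 1" b]) (use jkl edge[of "b - 1"] bd T b' False in auto)
      then show ?thesis .
    next
      case True
      then have ne: "d' \<noteq> d" using k T by auto
      define m where "m = min d d'"
      have m: "b \<le> m" "m \<le> d" "m \<le> d'" "Suc m \<le> n" using ne bd b' T by (auto simp: m_def)
      have Mm: "M j k l m = 0"
        by (rule bnd[of m j l k "Suc m" m])
          (use jkl edge[of m] bd T b' ne True in \<open>auto simp: m_def\<close>)
      have "i \<le> m \<longrightarrow> M j k l i = M j k l b" if "b \<le> i" for i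
        using that
      proof (induction i rule: dec_induct)
        case (step i)
        then show ?case using along[of i j l k] jkl bd T m True by auto
      qed simp
      from this[OF m(1)] have "M j k l m = M j k l b" by blast
      then show ?thesis using Mm by simp
    qed
  qed
  have b: "b \<in> {1..n}" using bd by auto
  \<comment> \<open>The part of \<open>e j b\<close> in the strands with interval \<open>{b..d}\<close>; it has the same coordinates in \<open>G\<close>.\<close>
  define w where "w j = (\<Sum>k\<in>G'. s (\<kappa>' b k (e j b)) (e' k b))" for j
  have fin: "finite J" "finite J'" using e e' by (auto simp: strand_basis_def)
  have \<kappa>w: "\<kappa> b l (w j) = (if l = j then 1 else 0)" if "j \<in> G" "l \<in> G" for j l
  proof -
    interpret K: Vector_Spaces.linear s "(*)" "\<kappa> b l" by (rule \<kappa>(1)[OF b])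
    have "(if l = j then 1 else 0) = \<kappa> b l (e j b)"
      using \<kappa>(2)[OF b, of l j] that bd by (simp add: G_def)
    also have "\<dots> = \<kappa> b l (\<Sum>k\<in>{k\<in>J'. b \<in> T' k}. s (\<kappa>' b k (e j b)) (e' k b))"
      by (rule arg_cong[OF \<kappa>'(3)[OF b eV[OF b]]]) (use that bd in \<open>auto simp: G_def\<close>)
    also have "\<dots> = (\<Sum>k\<in>{k\<in>J'. b \<in> T' k}. M j k l b)" by (simp add: K.sum K.scale M_def)
    also have "\<dots> = (\<Sum>k\<in>G'. M j k l b)"
      using fin zero[OF that] bd by (intro sum.mono_neutral_right) (auto simp: G'_def)
    also have "\<dots> = \<kappa> b l (w j)" by (simp add: w_def K.sum K.scale M_def)
    finally show ?thesis by simp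
  qed
  have wz: "c l = 0" if "(\<Sum>j\<in>G. s (c j) (w j)) = 0" "l \<in> G" for c l
  proof -
    interpret K: Vector_Spaces.linear s "(*)" "\<kappa> b l" by (rule \<kappa>(1)[OF b])
    have "0 = \<kappa> b l (\<Sum>j\<in>G. s (c j) (w j))" using that by (simp add: K.zero)
    also have "\<dots> = (\<Sum>j\<in>G. if l = j then c j else 0)" by (simp add: K.sum K.scale \<kappa>w that(2)) (rule sum.cong, auto simp: \<kappa>w that(2))
    also have "\<dots> = c l" using fin that(2) by (simp add: G_def)
    finally show ?thesis by simp
  qed
  have "indexed_basis s G w (S.span (w ` G))"
  proof (rule indexed_basisI_span[OF s])
    show "finite G" using fin by (simp add: G_def)
    show "c l = 0" if "(\<Sum>j\<in>G. s (c j) (w j)) = 0" "l \<in> G" for c l by (rule wz[OF that])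
  qed simp
  then have wG: "inj_on w G" "\<not> S.dependent (w ` G)" by (auto simp: indexed_basis_iff_independent[OF s])
  have "w ` G \<subseteq> S.span ((\<lambda>k. e' k b) ` G')"
    by (auto simp: w_def intro!: S.span_sum S.span_scale intro: S.span_base)
  then have "card (w ` G) \<le> card ((\<lambda>k. e' k b) ` G')"
    using S.independent_span_bound[OF _ wG(2)] fin by (simp add: G'_def)
  also have "\<dots> \<le> card G'" using fin by (intro card_image_le) (simp add: G'_def)
  finally show ?thesis using card_image[OF wG(1)] by (simp add: G_def G'_def)
qed


section \<open>Persistence diagrams\<close>

lemma interval_sum_strands:
  "strand_basis (fun_scale ((*) :: 'a::field \<Rightarrow> 'a \<Rightarrow> 'a)) n (interval_sum \<tau> xs) {..<length xs}
     (\<lambda>j. {fst (xs ! j)..snd (xs ! j)}) (\<lambda>j i k. if k = j then 1 else 0)"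
proof -
  let ?V = "interval_sum \<tau> xs :: (nat \<Rightarrow> 'a) zigzag"
  let ?u = "\<lambda>j k. if k = j then 1 else (0::'a)"
  have sp: "space_at ?V i = {f. \<forall>k. f k \<noteq> 0 \<longrightarrow> k < length xs \<and> i \<in> {fst (xs ! k)..snd (xs ! k)}}" for i
  proof (rule set_eqI)
    fix f :: "nat \<Rightarrow> 'a"
    have "f \<in> space_at ?V i \<longleftrightarrow> (\<forall>k<length xs. i \<notin> {fst (xs ! k)..snd (xs ! k)} \<longrightarrow> f k = 0) \<and>
      (\<forall>k\<ge>length xs. f k = 0)"
      unfolding interval_sum_def finite_direct_sum_def interval_module_def by auto
    then show "f \<in> space_at ?V i \<longleftrightarrow>
      f \<in> {f. \<forall>k. f k \<noteq> 0 \<longrightarrow> k < length xs \<and> i \<in> {fst (xs ! k)..snd (xs ! k)}}"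
      unfolding mem_Collect_eq by (meson not_le)
  qed
  have sum: "(\<Sum>j\<in>A. fun_scale (*) (c j) (?u j)) = (\<lambda>k. if k \<in> A then c k else 0)"
    if A: "finite A" for A and c :: "nat \<Rightarrow> 'a"
  proof
    fix k
    have "(\<Sum>j\<in>A. fun_scale (*) (c j) (?u j)) k = (\<Sum>j\<in>A. fun_scale (*) (c j) (?u j) k)"
      using A by (induction A rule: finite_induct) auto
    also have "\<dots> = (\<Sum>j\<in>A. if k = j then c j else 0)"
      by (rule sum.cong) (auto simp: fun_scale_def)
    finally show "(\<Sum>j\<in>A. fun_scale (*) (c j) (?u j)) k = (if k \<in> A then c k else 0)" using A by simp
  qed
  have "indexed_basis (fun_scale (*)) {j\<in>{..<length xs}. i \<in> {fst (xs ! j)..snd (xs ! j)}} ?u (space_at ?V i)" for i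
  proof -
    let ?A = "{j\<in>{..<length xs}. i \<in> {fst (xs ! j)..snd (xs ! j)}}"
    have fin: "finite ?A" by simp
    have "space_at ?V i = range (\<lambda>c k. if k \<in> ?A then c k else 0)"
    proof (intro equalityI subsetI)
      fix f assume "f \<in> space_at ?V i"
      then have "f k = (if k \<in> ?A then f k else 0)" for k
        unfolding sp mem_Collect_eq lessThan_iff by metis
      then have f: "(\<lambda>k. if k \<in> ?A then f k else 0) = f" by (intro ext) (rule sym)
      show "f \<in> range (\<lambda>c k. if k \<in> ?A then c k else 0)"
        using rangeI[of "\<lambda>c k. if k \<in> ?A then c k else 0" f] unfolding f .
    next
      fix f :: "nat \<Rightarrow> 'a" assume "f \<in> range (\<lambda>c k. if k \<in> ?A then c k else 0)"
      then show "f \<in> space_at ?V i" by (auto simp: sp split: if_splits)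
    qed
    moreover have "c a = 0" if "(\<lambda>k. if k \<in> ?A then c k else 0) = 0" "a \<in> ?A" for c :: "nat \<Rightarrow> 'a" and a
      using fun_cong[OF that(1), of a] that(2) by simp
    ultimately show ?thesis unfolding indexed_basis_def sum[OF fin] using fin by blast
  qed
  moreover have "map_at ?V i (?u j) = (if tgt ?V i \<in> {fst (xs ! j)..snd (xs ! j)} then ?u j else 0)"
    if "j < length xs" "src ?V i \<in> {fst (xs ! j)..snd (xs ! j)}" for i j
    using that by (auto simp: interval_sum_def finite_direct_sum_def interval_module_def src_def tgt_def
      fun_eq_iff split: direction.splits)
  ultimately show ?thesis unfolding strand_basis_def by simp
qed

lemma interval_sum_module:
  "interval_sum \<tau> xs \<in> zigzag_modules (fun_scale ((*) :: 'a::field \<Rightarrow> 'a \<Rightarrow> 'a)) n"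
proof -
  let ?V = "interval_sum \<tau> xs :: (nat \<Rightarrow> 'a) zigzag"
  note vs = vector_space_fun_scale[OF vector_space_field]
  have "fd_space (fun_scale (*)) (space_at ?V i)" if "i \<in> {1..n}" for i
    using interval_sum_strands[of n \<tau> xs, where 'a = 'a] that
    unfolding strand_basis_def by (intro indexed_basis_fd[OF vs]) blast
  moreover have "linear_between (fun_scale (*)) (space_at ?V (src ?V i)) (fun_scale (*))
    (space_at ?V (tgt ?V i)) (map_at ?V i)" for i
    by (auto simp: linear_between_def interval_sum_def finite_direct_sum_def interval_module_def src_def
      tgt_def fun_scale_def fun_eq_iff split: direction.splits)
  ultimately show ?thesis by (auto simp: zigzag_modules_def)
qed

definition decomposes ::
  "('a::field \<Rightarrow> 'v::ab_group_add \<Rightarrow> 'v) \<Rightarrow> nat \<Rightarrow> 'v zigzag \<Rightarrow> (nat \<times> nat) list \<Rightarrow> bool" where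
  "decomposes s n V xs \<longleftrightarrow> (\<forall>(b, d)\<in>set xs. 1 \<le> b \<and> b \<le> d \<and> d \<le> n) \<and>
     (\<exists>e. strand_basis s n V {..<length xs} (\<lambda>j. {fst (xs ! j)..snd (xs ! j)}) e)"

text \<open>Links strand bases with the decompositions in the definition of persistence diagrams.\<close>

lemma decomposes_iff_iso:
  assumes s: "vector_space s" and V: "V \<in> zigzag_modules s n"
    and ty: "\<And>i. i \<in> {1..<n} \<Longrightarrow> dir_at V i = \<tau> i"
  shows "decomposes s n V xs \<longleftrightarrow> (\<forall>(b, d)\<in>set xs. 1 \<le> b \<and> b \<le> d \<and> d \<le> n) \<and>
    zigzag_iso n s V (fun_scale (*)) (interval_sum \<tau> xs)"
proof -
  note vs = vector_space_fun_scale[OF vector_space_field]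
  have "same_type n V (interval_sum \<tau> xs)"
    using ty by (simp add: same_type_def interval_sum_def finite_direct_sum_def)
  then show ?thesis
    using strand_basis_imp_iso[OF s vs V interval_sum_module _ _ interval_sum_strands]
      strand_basis_pullback[OF s vs V _ interval_sum_strands]
    unfolding decomposes_def by blast
qed

lemma decomposes_exists:
  assumes s: "vector_space s" and V: "V \<in> zigzag_modules s n"
  shows "\<exists>xs. decomposes s n V xs"
proof (cases "n = 0")
  case True
  then have "decomposes s n V []" by (auto simp: decomposes_def strand_basis_def)
  then show ?thesis by blast
next
  case False
  then have "has_adapted_strands s n V {}" using adapted_strands_exist[OF s _ V, of "{}"] by simp
  then obtain N :: nat and b d e where bd: "\<And>j. j < N \<Longrightarrow> 1 \<le> b j \<and> b j \<le> d j \<and> d j \<le> n"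
    and e: "strand_basis s n V {..<N} (\<lambda>j. {b j..d j}) e"
    by (rule has_adapted_strandsE) (rule that)
  let ?xs = "map (\<lambda>j. (b j, d j)) [0..<N]"
  have "strand_basis s n V {..<length ?xs} (\<lambda>j. {fst (?xs ! j)..snd (?xs ! j)}) e \<longleftrightarrow>
    strand_basis s n V {..<N} (\<lambda>j. {b j..d j}) e"
  proof -
    have "{j \<in> {..<N}. i \<in> {fst (?xs ! j)..snd (?xs ! j)}} = {j \<in> {..<N}. i \<in> {b j..d j}}" for i by auto
    then show ?thesis unfolding strand_basis_def by simp
  qed
  then have "decomposes s n V ?xs" using e bd unfolding decomposes_def by auto
  then show ?thesis by blast
qed

lemma decomposes_unique:
  assumes s: "vector_space s" and V: "V \<in> zigzag_modules s n"
    and xs: "decomposes s n V xs" and ys: "decomposes s n V ys"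
  shows "mset xs = mset ys"
proof (rule multiset_eqI)
  fix x :: "nat \<times> nat"
  have cnt: "count (mset zs) x = card {j\<in>{..<length zs}. {fst (zs ! j)..snd (zs ! j)} = {fst x..snd x}}"
    if "1 \<le> fst x" "fst x \<le> snd x" "\<forall>(b, d)\<in>set zs. 1 \<le> b \<and> b \<le> d \<and> d \<le> n" for zs
  proof -
    have "count (mset zs) x = card {j. j < length zs \<and> x = zs ! j}"
      by (simp add: count_mset count_list_eq_length_filter length_filter_conv_card)
    also have "{j. j < length zs \<and> x = zs ! j} = {j\<in>{..<length zs}. {fst (zs ! j)..snd (zs ! j)} = {fst x..snd x}}"
      using that(2) by (auto simp: prod_eq_iff Icc_eq_Icc)
    finally show ?thesis .
  qed
  have le: "count (mset xs) x \<le> count (mset ys) x"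
    if xs: "decomposes s n V xs" and ys: "decomposes s n V ys" for xs ys
  proof (cases "1 \<le> fst x \<and> fst x \<le> snd x \<and> snd x \<le> n")
    case False
    then have "x \<notin> set xs" using xs unfolding decomposes_def by (cases x) fastforce
    then show ?thesis by (simp add: count_eq_zero_iff[THEN iffD2])
  next
    case True
    obtain e e' where e: "strand_basis s n V {..<length xs} (\<lambda>j. {fst (xs ! j)..snd (xs ! j)}) e"
      "strand_basis s n V {..<length ys} (\<lambda>j. {fst (ys ! j)..snd (ys ! j)}) e'"
      using xs ys unfolding decomposes_def by blast
    have val: "\<forall>(b, d)\<in>set xs. 1 \<le> b \<and> b \<le> d \<and> d \<le> n" "\<forall>(b, d)\<in>set ys. 1 \<le> b \<and> b \<le> d \<and> d \<le> n"
      using xs ys unfolding decomposes_def by blast+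
    have T: "\<exists>b d. {fst (ys ! j)..snd (ys ! j)} = {b..d} \<and> 1 \<le> b \<and> d \<le> n" if "j \<in> {..<length ys}" for j
    proof (intro exI conjI)
      show "1 \<le> fst (ys ! j)" "snd (ys ! j) \<le> n" using val(2) that nth_mem[of j ys] by fastforce+
    qed (rule refl)
    show ?thesis
      unfolding cnt[OF conjunct1[OF True] conjunct1[OF conjunct2[OF True]] val(1)]
        cnt[OF conjunct1[OF True] conjunct1[OF conjunct2[OF True]] val(2)]
      by (rule strand_multiplicity_le[OF s V e T]) (use True in auto)
  qed
  show "count (mset xs) x = count (mset ys) x" using le[OF xs ys] le[OF ys xs] by simp
qed

lemma decomposes_permute:
  assumes "mset xs = mset ys" "decomposes s n V xs"
  shows "decomposes s n V ys"
proof -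
  obtain f where f: "bij_betw f {..<length ys} {..<length xs}" "\<And>i. i < length ys \<Longrightarrow> ys ! i = xs ! f i"
    using permutation_Ex_bij[of ys xs] assms(1) by auto
  obtain e where e: "strand_basis s n V {..<length xs} (\<lambda>j. {fst (xs ! j)..snd (xs ! j)}) e"
    using assms(2) unfolding decomposes_def by blast
  have "strand_basis s n V {..<length ys} ((\<lambda>j. {fst (xs ! j)..snd (xs ! j)}) \<circ> f) (e \<circ> f)"
    by (rule strand_basis_reindex[OF f(1) e])
  moreover have "{j \<in> {..<length ys}. i \<in> {fst (ys ! j)..snd (ys ! j)}} =
    {j \<in> {..<length ys}. i \<in> ((\<lambda>j. {fst (xs ! j)..snd (xs ! j)}) \<circ> f) j}" for i
    using f(2) by auto
  ultimately have "strand_basis s n V {..<length ys} (\<lambda>j. {fst (ys ! j)..snd (ys ! j)}) (e \<circ> f)"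
    unfolding strand_basis_def using f(2) by simp
  then show ?thesis using assms(2) mset_eq_setD[OF assms(1)] unfolding decomposes_def by blast
qed

lemma Dgm_eq:
  assumes s: "vector_space s" and V: "V \<in> zigzag_modules s n" and xs: "decomposes s n V xs"
  shows "Dgm s n V = mset xs"
  unfolding Dgm_def
proof (rule the_equality)
  have *: "(\<forall>(b, d)\<in>set ys. 1 \<le> b \<and> b \<le> d \<and> d \<le> n) \<and>
    zigzag_iso n s V (fun_scale (*)) (interval_sum (dir_at V) ys) \<longleftrightarrow> decomposes s n V ys" for ys
    using decomposes_iff_iso[OF s V refl] by blast
  show "\<exists>ys. mset ys = mset xs \<and> (\<forall>(b, d)\<in>set ys. 1 \<le> b \<and> b \<le> d \<and> d \<le> n) \<and>
      zigzag_iso n s V (fun_scale (*)) (interval_sum (dir_at V) ys)"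
    using xs unfolding * by blast
  show "D = mset xs" if "\<exists>ys. mset ys = D \<and> (\<forall>(b, d)\<in>set ys. 1 \<le> b \<and> b \<le> d \<and> d \<le> n) \<and>
      zigzag_iso n s V (fun_scale (*)) (interval_sum (dir_at V) ys)" for D
    using that decomposes_unique[OF s V _ xs] unfolding * by blast
qed

lemma decomposes_iff_Dgm:
  assumes s: "vector_space s" and V: "V \<in> zigzag_modules s n"
  shows "decomposes s n V xs \<longleftrightarrow> Dgm s n V = mset xs"
  using decomposes_exists[OF s V] Dgm_eq[OF s V] decomposes_permute by metis

lemma Dgm_bounds:
  assumes s: "vector_space s" and V: "V \<in> zigzag_modules s n" and "(b, d) \<in># Dgm s n V"
  shows "1 \<le> b" "b \<le> d" "d \<le> n"
proof -
  obtain xs where xs: "decomposes s n V xs" using decomposes_exists[OF s V] by blast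
  then have "(b, d) \<in> set xs" using assms(3) Dgm_eq[OF s V] by simp
  then show "1 \<le> b" "b \<le> d" "d \<le> n" using xs unfolding decomposes_def by blast+
qed

lemma Dgm_eq_strands:
  assumes s: "vector_space s" and V: "V \<in> zigzag_modules s n" and e: "strand_basis s n V J T e"
    and T: "\<And>j. j \<in> J \<Longrightarrow> T j = {b j..d j}" and bd: "\<And>j. j \<in> J \<Longrightarrow> 1 \<le> b j \<and> b j \<le> d j \<and> d j \<le> n"
  shows "Dgm s n V = image_mset (\<lambda>j. (b j, d j)) (mset_set J)"
proof -
  have fin: "finite J" using e by (simp add: strand_basis_def)
  then obtain h where h: "bij_betw h {..<card J} J" using ex_bij_betw_nat_finite by (metis lessThan_atLeast0)
  let ?xs = "map (\<lambda>i. (b (h i), d (h i))) [0..<card J]"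
  have hJ: "h i \<in> J" if "i < card J" for i using h that by (auto simp: bij_betw_def)
  have sb: "strand_basis s n V {..<card J} (T \<circ> h) (e \<circ> h)" by (rule strand_basis_reindex[OF h e])
  have "{j \<in> {..<card J}. i \<in> {fst (?xs ! j)..snd (?xs ! j)}} = {j \<in> {..<card J}. i \<in> (T \<circ> h) j}" for i
    using T[OF hJ] by auto
  then have "strand_basis s n V {..<length ?xs} (\<lambda>j. {fst (?xs ! j)..snd (?xs ! j)}) (e \<circ> h)"
    using sb T[OF hJ] unfolding strand_basis_def by simp
  then have "decomposes s n V ?xs" using bd[OF hJ] unfolding decomposes_def by auto
  then have "Dgm s n V = mset ?xs" by (rule Dgm_eq[OF s V])
  also have "\<dots> = image_mset (\<lambda>i. (b (h i), d (h i))) (mset_set {..<card J})"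
    by (simp add: lessThan_atLeast0)
  also have "\<dots> = image_mset (\<lambda>j. (b j, d j)) (image_mset h (mset_set {..<card J}))"
    by (simp add: image_mset.compositionality o_def)
  also have "image_mset h (mset_set {..<card J}) = mset_set J"
    using h by (simp add: image_mset_mset_set bij_betw_def)
  finally show ?thesis .
qed

lemma Dgm_strandsE:
  assumes s: "vector_space s" and V: "V \<in> zigzag_modules s n"
  obtains J :: "nat set" and b d e where "strand_basis s n V J (\<lambda>j. {b j..d j}) e"
    "\<And>j. j \<in> J \<Longrightarrow> 1 \<le> b j \<and> b j \<le> d j \<and> d j \<le> n"
    "Dgm s n V = image_mset (\<lambda>j. (b j, d j)) (mset_set J)"
proof -
  obtain xs where xs: "decomposes s n V xs" using decomposes_exists[OF s V] by blast
  then obtain e where e: "strand_basis s n V {..<length xs} (\<lambda>j. {fst (xs ! j)..snd (xs ! j)}) e"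
    unfolding decomposes_def by blast
  have bd: "1 \<le> fst (xs ! j) \<and> fst (xs ! j) \<le> snd (xs ! j) \<and> snd (xs ! j) \<le> n" if "j \<in> {..<length xs}" for j
    using xs nth_mem[of j xs] that unfolding decomposes_def by fastforce
  show ?thesis by (rule that[OF e bd Dgm_eq_strands[OF s V e refl bd]]) simp
qed

lemma iso_iff_Dgm:
  assumes s: "vector_space s" and t: "vector_space t"
    and V: "V \<in> zigzag_modules s n" and W: "W \<in> zigzag_modules t n"
  shows "zigzag_iso n s V t W \<longleftrightarrow> same_type n V W \<and> Dgm s n V = Dgm t n W"
proof
  assume iso: "zigzag_iso n s V t W"
  then have ty: "same_type n V W" unfolding zigzag_iso_def zigzag_morphism_def by blast
  obtain J :: "nat set" and b d e where e: "strand_basis t n W J (\<lambda>j. {b j..d j}) e"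
    and bd: "\<And>j. j \<in> J \<Longrightarrow> 1 \<le> b j \<and> b j \<le> d j \<and> d j \<le> n"
    and D: "Dgm t n W = image_mset (\<lambda>j. (b j, d j)) (mset_set J)"
    by (rule Dgm_strandsE[OF t W]) (rule that)
  obtain e' where e': "strand_basis s n V J (\<lambda>j. {b j..d j}) e'"
    using strand_basis_pullback[OF s t V iso e] by blast
  show "same_type n V W \<and> Dgm s n V = Dgm t n W" using ty Dgm_eq_strands[OF s V e' refl bd] D by simp
next
  assume a: "same_type n V W \<and> Dgm s n V = Dgm t n W"
  obtain xs where "decomposes s n V xs" using decomposes_exists[OF s V] by blast
  moreover from this have "decomposes t n W xs"
    using a decomposes_iff_Dgm[OF s V] decomposes_iff_Dgm[OF t W] by simp
  ultimately obtain e e' where "strand_basis s n V {..<length xs} (\<lambda>j. {fst (xs ! j)..snd (xs ! j)}) e"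
    "strand_basis t n W {..<length xs} (\<lambda>j. {fst (xs ! j)..snd (xs ! j)}) e'"
    unfolding decomposes_def by blast
  then show "zigzag_iso n s V t W" using strand_basis_imp_iso[OF s t V W] a by blast
qed

text \<open>All spaces are spanned by subfamilies of one independent family, and each structure map fixes or kills
its members.\<close>

lemma module_with_Dgm_exists:
  assumes s: "vector_space (s :: 'a::field \<Rightarrow> 'v::ab_group_add \<Rightarrow> 'v)"
    and inf: "\<nexists>B. finite_dimensional_vector_space s B"
    and D: "\<And>b d. (b, d) \<in># D \<Longrightarrow> 1 \<le> b \<and> b \<le> d \<and> d \<le> n"
  shows "\<exists>V\<in>zigzag_modules s n. dir_at V = \<tau> \<and> Dgm s n V = D"
proof -
  interpret S: vector_space s by (rule s)
  obtain xs where xs: "mset xs = D" using ex_mset by blast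
  let ?J = "{..<length xs}" and ?T = "\<lambda>j. {fst (xs ! j)..snd (xs ! j)}"
  obtain f X where f: "indexed_basis s ?J f X"
    using indexed_basis_in_infinite_dimensional[OF s inf, of ?J] by auto
  define st where "st i = (case \<tau> i of Fwd \<Rightarrow> (i, i + 1) | Bwd \<Rightarrow> (i + 1, i))" for i
  have "\<exists>g. Vector_Spaces.linear s s g \<and> (\<forall>j\<in>?J. g (f j) = (if snd (st i) \<in> ?T j \<and> fst (st i) \<in> ?T j then f j else 0))" for i
    by (rule indexed_basis_linear_exists[OF s s f])
  then obtain g where g: "\<And>i. Vector_Spaces.linear s s (g i)"
    "\<And>i j. j \<in> ?J \<Longrightarrow> g i (f j) = (if snd (st i) \<in> ?T j \<and> fst (st i) \<in> ?T j then f j else 0)" by metis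
  define V where "V = \<lparr>space_at = (\<lambda>i. S.span (f ` {j\<in>?J. i \<in> ?T j})), dir_at = \<tau>, map_at = g\<rparr>"
  have spV: "space_at V i = S.span (f ` {j\<in>?J. i \<in> ?T j})" for i by (simp add: V_def)
  have src: "src V i = fst (st i)" "tgt V i = snd (st i)" for i
    by (auto simp: src_def tgt_def st_def V_def split: direction.splits)
  have ib: "indexed_basis s {j\<in>?J. i \<in> ?T j} f (space_at V i)" for i
    unfolding V_def using indexed_basis_subset[OF s f, of "{j\<in>?J. i \<in> ?T j}"] by auto
  have "linear_between s (space_at V (src V i)) s (space_at V (tgt V i)) (map_at V i)" for i
  proof -
    interpret G: Vector_Spaces.linear s s "g i" by (rule g)
    have "g i ` S.span (f ` {j\<in>?J. src V i \<in> ?T j}) \<subseteq> S.span (f ` {j\<in>?J. tgt V i \<in> ?T j})"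
      unfolding G.span_image[symmetric]
    proof (intro S.span_minimal S.subspace_span image_subsetI)
      fix y assume "y \<in> f ` {j\<in>?J. src V i \<in> ?T j}"
      then obtain j where j: "j \<in> ?J" "src V i \<in> ?T j" "y = f j" by auto
      show "g i y \<in> S.span (f ` {j\<in>?J. tgt V i \<in> ?T j})"
      proof (cases "tgt V i \<in> ?T j")
        case True
        then have "g i y = f j" using g(2)[OF j(1), of i] j by (simp add: src)
        then show ?thesis using j True by (auto intro!: S.span_base)
      next
        case False
        then have "g i y = 0" using g(2)[OF j(1), of i] j(3) by (auto simp: src)
        then show ?thesis using S.span_zero by simp
      qed
    qed
    then have "g i ` space_at V (src V i) \<subseteq> space_at V (tgt V i)" by (simp add: spV)
    moreover have "map_at V i = g i" by (simp add: V_def)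
    ultimately show ?thesis by (auto intro: linear_imp_linear_between[OF g(1)])
  qed
  then have V: "V \<in> zigzag_modules s n" using indexed_basis_fd[OF s ib] by (simp add: zigzag_modules_def)
  have "strand_basis s n V ?J ?T (\<lambda>j i. f j)"
    unfolding strand_basis_def using ib g(2) by (auto simp: src) (auto simp: V_def)
  moreover have "\<forall>(b, d)\<in>set xs. 1 \<le> b \<and> b \<le> d \<and> d \<le> n" using D xs by auto
  ultimately have "decomposes s n V xs" unfolding decomposes_def by blast
  then have "Dgm s n V = D" using Dgm_eq[OF s V] xs by simp
  moreover have "dir_at V = \<tau>" by (simp add: V_def)
  ultimately show ?thesis using V by blast
qed

lemma remove_simples_properties:
  assumes s: "vector_space s" and inf: "\<nexists>B. finite_dimensional_vector_space s B"
    and V: "V \<in> zigzag_modules s n"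
  shows "remove_simples s n V \<in> zigzag_modules s n" (is ?A)
    and "same_type n (remove_simples s n V) V" (is ?B)
    and "Dgm s n (remove_simples s n V) = {#(b, d) \<in># Dgm s n V. b \<noteq> d#}" (is ?C)
proof -
  let ?D = "{#(b, d) \<in># Dgm s n V. b \<noteq> d#}"
  let ?P = "\<lambda>W. W \<in> zigzag_modules s n \<and> (\<exists>xs. mset xs = ?D \<and>
        zigzag_iso n s W (fun_scale (*)) (interval_sum (dir_at V) xs))"
  have bd: "1 \<le> b \<and> b \<le> d \<and> d \<le> n" if "(b, d) \<in># ?D" for b d
    using that Dgm_bounds[OF s V] by auto
  obtain W0 where W0: "W0 \<in> zigzag_modules s n" "dir_at W0 = dir_at V" "Dgm s n W0 = ?D"
    using module_with_Dgm_exists[OF s inf bd, where \<tau> = "dir_at V"] by blast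
  obtain xs where xs: "mset xs = ?D" using ex_mset by blast
  have "decomposes s n W0 xs" using decomposes_iff_Dgm[OF s W0(1)] W0(3) xs by simp
  then have "?P W0" using decomposes_iff_iso[OF s W0(1), of "dir_at V" xs] W0 xs by auto
  then have P: "?P (remove_simples s n V)" unfolding remove_simples_def by (rule someI)
  then show ?A by blast
  obtain ys where ys: "mset ys = ?D"
    "zigzag_iso n s (remove_simples s n V) (fun_scale (*)) (interval_sum (dir_at V) ys)" using P by blast
  have ty: "\<And>i. i \<in> {1..<n} \<Longrightarrow> dir_at (remove_simples s n V) i = dir_at V i"
    using ys(2) unfolding zigzag_iso_def zigzag_morphism_def same_type_def
    by (auto simp: interval_sum_def finite_direct_sum_def)
  then show ?B by (simp add: same_type_def)
  have "set ys = set_mset ?D" using ys(1) by (metis set_mset_mset)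
  then have "\<forall>(b, d)\<in>set ys. 1 \<le> b \<and> b \<le> d \<and> d \<le> n" using bd by blast
  then have "decomposes s n (remove_simples s n V) ys"
    using decomposes_iff_iso[OF s \<open>?A\<close> ty] ys(2) by blast
  then show ?C using Dgm_eq[OF s \<open>?A\<close>] ys(1) by simp
qed

lemma indexed_basis_prod:
  fixes s :: "'a::field \<Rightarrow> 'v::ab_group_add \<Rightarrow> 'v" and t :: "'a \<Rightarrow> 'w::ab_group_add \<Rightarrow> 'w"
  assumes s: "vector_space s" and t: "vector_space t"
    and f: "indexed_basis s A f X" and g: "indexed_basis t B g Y"
  shows "indexed_basis (prod_scale s t) (A <+> B) (case_sum (\<lambda>a. (f a, 0)) (\<lambda>b. (0, g b))) (X \<times> Y)"
proof -
  interpret S: vector_space s by (rule s)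
  interpret T: vector_space t by (rule t)
  have fin: "finite A" "finite B" using f g by (auto simp: indexed_basis_def)
  have sum: "(\<Sum>k\<in>A <+> B. prod_scale s t (c k) (case_sum (\<lambda>a. (f a, 0)) (\<lambda>b. (0, g b)) k)) =
    ((\<Sum>a\<in>A. s (c (Inl a)) (f a)), (\<Sum>b\<in>B. t (c (Inr b)) (g b)))" for c
  proof -
    have "(\<Sum>a\<in>A. (s (c (Inl a)) (f a), 0::'w)) = ((\<Sum>a\<in>A. s (c (Inl a)) (f a)), 0)"
      using fin(1) by (induction A rule: finite_induct) (auto simp: zero_prod_def)
    moreover have "(\<Sum>b\<in>B. (0::'v, t (c (Inr b)) (g b))) = (0, (\<Sum>b\<in>B. t (c (Inr b)) (g b)))"
      using fin(2) by (induction B rule: finite_induct) (auto simp: zero_prod_def)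
    ultimately show ?thesis using fin by (simp add: sum.Plus o_def prod_scale_def)
  qed
  show ?thesis unfolding indexed_basis_def sum
  proof (intro conjI allI impI ballI)
    fix c k
    assume z: "((\<Sum>a\<in>A. s (c (Inl a)) (f a)), (\<Sum>b\<in>B. t (c (Inr b)) (g b))) = 0" and k: "k \<in> A <+> B"
    then have z1: "(\<Sum>a\<in>A. s (c (Inl a)) (f a)) = 0" and z2: "(\<Sum>b\<in>B. t (c (Inr b)) (g b)) = 0"
      by (auto simp: zero_prod_def)
    show "c k = 0"
      using k indexed_basis_zero[OF f, where c = "c \<circ> Inl"] indexed_basis_zero[OF g, where c = "c \<circ> Inr"] z1 z2
      by (auto simp: o_def)
  next
    show "X \<times> Y = range (\<lambda>c. ((\<Sum>a\<in>A. s (c (Inl a)) (f a)), (\<Sum>b\<in>B. t (c (Inr b)) (g b))))"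
    proof (intro equalityI subsetI)
      fix z assume "z \<in> X \<times> Y"
      then obtain x y where z: "z = (x, y)" "x \<in> X" "y \<in> Y" by auto
      obtain c where c: "x = (\<Sum>a\<in>A. s (c a) (f a))" using indexed_basis_expand[OF f z(2)] by blast
      obtain d where d: "y = (\<Sum>b\<in>B. t (d b) (g b))" using indexed_basis_expand[OF g z(3)] by blast
      show "z \<in> range (\<lambda>c. ((\<Sum>a\<in>A. s (c (Inl a)) (f a)), (\<Sum>b\<in>B. t (c (Inr b)) (g b))))"
        by (rule range_eqI[of _ _ "case_sum c d"]) (simp add: z c d)
    qed (use indexed_basis_sum_mem[OF f] indexed_basis_sum_mem[OF g] in auto)
  qed (use fin in simp)
qed

lemma Dgm_direct_sum:
  assumes s: "vector_space s" and V: "V \<in> zigzag_modules s n" and W: "W \<in> zigzag_modules s n"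
    and ty: "same_type n V W"
  shows "direct_sum V W \<in> zigzag_modules (prod_scale s s) n"
    and "Dgm (prod_scale s s) n (direct_sum V W) = Dgm s n V + Dgm s n W"
proof -
  note p = vector_space_prod_scale[OF s s]
  obtain J :: "nat set" and b d e where e: "strand_basis s n V J (\<lambda>j. {b j..d j}) e"
    and bd: "\<And>j. j \<in> J \<Longrightarrow> 1 \<le> b j \<and> b j \<le> d j \<and> d j \<le> n"
    and D: "Dgm s n V = image_mset (\<lambda>j. (b j, d j)) (mset_set J)"
    by (rule Dgm_strandsE[OF s V]) (rule that)
  obtain J' :: "nat set" and b' d' e' where e': "strand_basis s n W J' (\<lambda>j. {b' j..d' j}) e'"
    and bd': "\<And>j. j \<in> J' \<Longrightarrow> 1 \<le> b' j \<and> b' j \<le> d' j \<and> d' j \<le> n"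
    and D': "Dgm s n W = image_mset (\<lambda>j. (b' j, d' j)) (mset_set J')"
    by (rule Dgm_strandsE[OF s W]) (rule that)
  have fin: "finite J" "finite J'" using e e' by (auto simp: strand_basis_def)
  let ?V = "direct_sum V W"
  let ?b = "case_sum b b'" and ?d = "case_sum d d'"
  let ?e = "case_sum (\<lambda>j i. (e j i, 0)) (\<lambda>j i. (0, e' j i))"
  have st: "src ?V i = src V i" "tgt ?V i = tgt V i" for i by (auto simp: src_def tgt_def direct_sum_def)
  have ib: "indexed_basis (prod_scale s s) {j\<in>J <+> J'. i \<in> {?b j..?d j}} (\<lambda>j. ?e j i) (space_at ?V i)"
    if "i \<in> {1..n}" for i
  proof -
    have "{j\<in>J <+> J'. i \<in> {?b j..?d j}} = {j\<in>J. i \<in> {b j..d j}} <+> {j\<in>J'. i \<in> {b' j..d' j}}" by auto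
    moreover have "(\<lambda>j. ?e j i) = case_sum (\<lambda>j. (e j i, 0)) (\<lambda>j. (0, e' j i))"
      by (auto simp: fun_eq_iff split: sum.splits)
    ultimately show ?thesis
      using indexed_basis_prod[OF s s, of "{j\<in>J. i \<in> {b j..d j}}" "\<lambda>j. e j i" "space_at V i"
        "{j\<in>J'. i \<in> {b' j..d' j}}" "\<lambda>j. e' j i" "space_at W i"] e e' that
      by (simp add: strand_basis_def direct_sum_def)
  qed
  have lin: "linear_between (prod_scale s s) (space_at ?V (src ?V i)) (prod_scale s s) (space_at ?V (tgt ?V i)) (map_at ?V i)"
    if i: "i \<in> {1..<n}" for i
    using zigzag_module_maps[OF V i] zigzag_module_maps[OF W i] same_type_src_tgt[OF ty i]
    by (auto simp: linear_between_def st prod_scale_def) (auto simp: direct_sum_def)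
  show m: "?V \<in> zigzag_modules (prod_scale s s) n"
    using indexed_basis_fd[OF p ib] lin by (simp add: zigzag_modules_def)
  have "strand_basis (prod_scale s s) n ?V (J <+> J') (\<lambda>j. {?b j..?d j}) ?e"
    unfolding strand_basis_def
  proof (intro conjI ballI impI)
    fix i j assume i: "i \<in> {1..<n}" and j: "j \<in> J <+> J'" and a: "src ?V i \<in> {?b j..?d j}"
    note st' = src_tgt_range[OF i, of V] same_type_src_tgt[OF ty i]
    have z: "map_at V i 0 = 0" "map_at W i 0 = 0"
      using linear_between_0[OF s _ zigzag_module_maps[OF V i]] linear_between_0[OF s _ zigzag_module_maps[OF W i]]
        zigzag_module_spaces(2)[OF V] zigzag_module_spaces(2)[OF W] st' by auto
    show "map_at ?V i (?e j (src ?V i)) = (if tgt ?V i \<in> {?b j..?d j} then ?e j (tgt ?V i) else 0)"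
      using j
    proof (rule PlusE)
      fix k assume k: "k \<in> J" "j = Inl k"
      then have "map_at V i (e k (src V i)) = (if tgt V i \<in> {b k..d k} then e k (tgt V i) else 0)"
        using e i a by (simp add: strand_basis_def st)
      then show ?thesis using k z by (simp add: st) (simp add: direct_sum_def zero_prod_def)
    next
      fix k assume k: "k \<in> J'" "j = Inr k"
      then have "map_at W i (e' k (src W i)) = (if tgt W i \<in> {b' k..d' k} then e' k (tgt W i) else 0)"
        using e' i a st' by (simp add: strand_basis_def st)
      then show ?thesis using k z st' by (simp add: st) (simp add: direct_sum_def zero_prod_def)
    qed
  qed (use fin ib in auto)
  then have "Dgm (prod_scale s s) n ?V = image_mset (\<lambda>j. (?b j, ?d j)) (mset_set (J <+> J'))"
    by (rule Dgm_eq_strands[OF p m _ refl]) (use bd bd' in auto)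
  also have "mset_set (J <+> J') = image_mset Inl (mset_set J) + image_mset Inr (mset_set J')"
    using fin unfolding Plus_def
    by (subst mset_set_Union) (auto simp: image_mset_mset_set)
  finally show "Dgm (prod_scale s s) n ?V = Dgm s n V + Dgm s n W"
    by (simp add: D D' image_mset.compositionality o_def)
qed

lemma summand_iff_Dgm:
  assumes s: "vector_space s" and inf: "\<nexists>B. finite_dimensional_vector_space s B"
    and V: "V \<in> zigzag_modules s n" and W: "W \<in> zigzag_modules s n"
  shows "summand s n W V \<longleftrightarrow> same_type n W V \<and> Dgm s n W \<subseteq># Dgm s n V"
proof -
  note p = vector_space_prod_scale[OF s s]
  have same: "same_type n V W" "same_type n W U" if "same_type n W V" "same_type n U V" for U
    using that by (auto simp: same_type_def)
  have ty: "same_type n V (direct_sum W U)" if "same_type n W V" for U :: "'b zigzag"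
    using that by (auto simp: same_type_def direct_sum_def)
  have *: "zigzag_iso n s V (prod_scale s s) (direct_sum W U) \<longleftrightarrow> Dgm s n V = Dgm s n W + Dgm s n U"
    if "same_type n W V" "same_type n U V" "U \<in> zigzag_modules s n" for U
    using iso_iff_Dgm[OF s p V Dgm_direct_sum(1)[OF s W that(3)]] Dgm_direct_sum(2)[OF s W that(3)]
      same[OF that(1,2)] ty[OF that(1)] by simp
  show ?thesis
  proof
    assume "summand s n W V"
    then show "same_type n W V \<and> Dgm s n W \<subseteq># Dgm s n V" unfolding summand_def using * by auto
  next
    assume a: "same_type n W V \<and> Dgm s n W \<subseteq># Dgm s n V"
    have bd: "1 \<le> b \<and> b \<le> d \<and> d \<le> n" if "(b, d) \<in># Dgm s n V - Dgm s n W" for b d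
      using in_diffD[OF that] Dgm_bounds[OF s V] by blast
    obtain U where U: "U \<in> zigzag_modules s n" "dir_at U = dir_at V" "Dgm s n U = Dgm s n V - Dgm s n W"
      using module_with_Dgm_exists[OF s inf bd] by blast
    have "same_type n U V" using U by (simp add: same_type_def)
    then show "summand s n W V" unfolding summand_def using * U a by (auto intro!: bexI[of _ U])
  qed
qed


section \<open>Arrow reversals\<close>

text \<open>The relation of being a summand up to arrow reversals, on types and persistence diagrams: types may differ only
at arrows which are bijective on the smaller module.\<close>

definition diagram_le ::
  "nat \<Rightarrow> (nat \<Rightarrow> direction) \<times> (nat \<times> nat) multiset \<Rightarrow>
    (nat \<Rightarrow> direction) \<times> (nat \<times> nat) multiset \<Rightarrow> bool" where
  "diagram_le n x y \<longleftrightarrow> snd x \<subseteq># snd y \<and>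
     (\<forall>k\<in>{1..<n}. fst x k \<noteq> fst y k \<longrightarrow> (\<forall>(b, d)\<in>#snd x. d \<noteq> k \<and> b \<noteq> k + 1))"

definition diagram ::
  "('a::field \<Rightarrow> 'v::ab_group_add \<Rightarrow> 'v) \<Rightarrow> nat \<Rightarrow> 'v zigzag \<Rightarrow>
    (nat \<Rightarrow> direction) \<times> (nat \<times> nat) multiset" where
  "diagram s n V = (dir_at V, Dgm s n V)"

text \<open>A strand that ends at the source of the arrow gives a kernel element, and one that starts at its target has
a coordinate that vanishes on the image.\<close>

lemma structure_map_bij_iff:
  assumes s: "vector_space s" and V: "V \<in> zigzag_modules s n" and k: "k \<in> {1..<n}"
  shows "bij_betw (map_at V k) (space_at V (src V k)) (space_at V (tgt V k)) \<longleftrightarrow>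
    (\<forall>(b, d)\<in>#Dgm s n V. d \<noteq> k \<and> b \<noteq> k + 1)"
proof -
  obtain J :: "nat set" and b d e where e: "strand_basis s n V J (\<lambda>j. {b j..d j}) e"
    and bd: "\<And>j. j \<in> J \<Longrightarrow> 1 \<le> b j \<and> b j \<le> d j \<and> d j \<le> n"
    and D: "Dgm s n V = image_mset (\<lambda>j. (b j, d j)) (mset_set J)"
    by (rule Dgm_strandsE[OF s V]) (rule that)
  let ?T = "\<lambda>j. {b j..d j}"
  have fin: "finite J" using e by (simp add: strand_basis_def)
  note st = src_tgt_range[OF k, of V]
  have ib: "indexed_basis s {j\<in>J. i \<in> ?T j} (\<lambda>j. e j i) (space_at V i)" if "i \<in> {1..n}" for i
    using e that by (auto simp: strand_basis_def)
  note lin = zigzag_module_maps[OF V k]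
  have map: "map_at V k (e j (src V k)) = (if tgt V k \<in> ?T j then e j (tgt V k) else 0)"
    if "j \<in> J" "src V k \<in> ?T j" for j
    using e k that unfolding strand_basis_def by blast
  have "(\<forall>(b, d)\<in>#Dgm s n V. d \<noteq> k \<and> b \<noteq> k + 1) \<longleftrightarrow> (\<forall>j\<in>J. d j \<noteq> k \<and> b j \<noteq> k + 1)"
    using fin by (simp add: D)
  also have "\<dots> \<longleftrightarrow> (\<forall>j\<in>J. src V k \<in> ?T j \<longleftrightarrow> tgt V k \<in> ?T j)"
  proof (rule ball_cong[OF refl])
    fix j assume "j \<in> J"
    then show "(d j \<noteq> k \<and> b j \<noteq> k + 1) = ((src V k \<in> ?T j) = (tgt V k \<in> ?T j))"
      using bd[of j] by (auto simp: src_def tgt_def split: direction.splits)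
  qed
  also have "\<dots> \<longleftrightarrow> bij_betw (map_at V k) (space_at V (src V k)) (space_at V (tgt V k))"
  proof
    assume a: "\<forall>j\<in>J. src V k \<in> ?T j \<longleftrightarrow> tgt V k \<in> ?T j"
    then have eq: "{j\<in>J. src V k \<in> ?T j} = {j\<in>J. tgt V k \<in> ?T j}" by blast
    show "bij_betw (map_at V k) (space_at V (src V k)) (space_at V (tgt V k))"
      by (rule indexed_basis_linear_bij[OF s s ib[OF st(1)] ib[OF st(2), folded eq] lin])
        (use map a in auto)
  next
    assume bij: "bij_betw (map_at V k) (space_at V (src V k)) (space_at V (tgt V k))"
    show "\<forall>j\<in>J. src V k \<in> ?T j \<longleftrightarrow> tgt V k \<in> ?T j"
    proof
      fix j assume j: "j \<in> J"
      have 1: "tgt V k \<in> ?T j" if a: "src V k \<in> ?T j"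
      proof (rule ccontr)
        assume "tgt V k \<notin> ?T j"
        then have z: "map_at V k (e j (src V k)) = 0" using map[OF j a] by (simp del: atLeastAtMost_iff)
        interpret S: vector_space s by (rule s)
        have sub: "S.subspace (space_at V (src V k))" by (rule indexed_basis_subspace[OF s ib[OF st(1)]])
        have "map_at V k (e j (src V k)) = map_at V k 0"
          using z linear_between_0[OF s sub lin] by simp
        then have "e j (src V k) = 0"
          using inj_onD[OF bij_betw_imp_inj_on[OF bij]] indexed_basis_mem[OF s ib[OF st(1)], of j] j a
            S.subspace_0[OF sub] by blast
        then show False using indexed_basis_nonzero[OF s ib[OF st(1)], of j] j a by blast
      qed
      have 2: "src V k \<in> ?T j" if a: "tgt V k \<in> ?T j"
      proof (rule ccontr)
        assume na: "src V k \<notin> ?T j"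
        obtain \<kappa> where \<kappa>: "\<And>i j. i \<in> {1..n} \<Longrightarrow> Vector_Spaces.linear s (*) (\<kappa> i j)"
          "\<And>i j l. i \<in> {1..n} \<Longrightarrow> j \<in> J \<Longrightarrow> l \<in> J \<Longrightarrow> i \<in> ?T j \<Longrightarrow> i \<in> ?T l \<Longrightarrow>
            \<kappa> i j (e l i) = (if j = l then 1 else 0)"
          "\<And>i j x. i \<in> {1..<n} \<Longrightarrow> j \<in> J \<Longrightarrow> x \<in> space_at V (src V i) \<Longrightarrow> tgt V i \<in> ?T j \<Longrightarrow>
            \<kappa> (tgt V i) j (map_at V i x) = (if src V i \<in> ?T j then \<kappa> (src V i) j x else 0)"
          by (rule strand_coordinates[OF s V e]) (rule that)
        have "e j (tgt V k) \<in> space_at V (tgt V k)" using indexed_basis_mem[OF s ib[OF st(2)], of j] j a by simp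
        then obtain x where x: "x \<in> space_at V (src V k)" "map_at V k x = e j (tgt V k)"
          using bij by (metis bij_betw_imp_surj_on imageE)
        have "\<kappa> (tgt V k) j (e j (tgt V k)) = 0" using \<kappa>(3)[OF k j x(1) a] na x(2) by (simp del: atLeastAtMost_iff)
        then show False using \<kappa>(2)[OF st(2) j j a a] by simp
      qed
      show "src V k \<in> ?T j \<longleftrightarrow> tgt V k \<in> ?T j" using 1 2 by blast
    qed
  qed
  finally show ?thesis by blast
qed

lemma reverse_arrow_properties:
  assumes s: "vector_space s" and V: "V \<in> zigzag_modules s n" and k: "k \<in> {1..<n}"
    and bij: "bij_betw (map_at V k) (space_at V (src V k)) (space_at V (tgt V k))"
  shows "reverse_arrow k V \<in> zigzag_modules s n" (is "?W \<in> _")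
    and "Dgm s n (reverse_arrow k V) = Dgm s n V"
proof -
  obtain J :: "nat set" and b d e where e: "strand_basis s n V J (\<lambda>j. {b j..d j}) e"
    and bd: "\<And>j. j \<in> J \<Longrightarrow> 1 \<le> b j \<and> b j \<le> d j \<and> d j \<le> n"
    and D: "Dgm s n V = image_mset (\<lambda>j. (b j, d j)) (mset_set J)"
    by (rule Dgm_strandsE[OF s V]) (rule that)
  let ?T = "\<lambda>j. {b j..d j}"
  have fin: "finite J" using e by (simp add: strand_basis_def)
  note st = src_tgt_range[OF k, of V]
  have other: "src ?W i = src V i" "tgt ?W i = tgt V i" "map_at ?W i = map_at V i" if "i \<noteq> k" for i
    using that by (auto simp: reverse_arrow_def src_def tgt_def)
  have rev: "src ?W k = tgt V k" "tgt ?W k = src V k"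
    "map_at ?W k = inv_into (space_at V (src V k)) (map_at V k)"
    by (auto simp: reverse_arrow_def src_def tgt_def split: direction.splits)
  have sp: "space_at ?W = space_at V" by (simp add: reverse_arrow_def)
  have lin: "linear_between s (space_at ?W (src ?W i)) s (space_at ?W (tgt ?W i)) (map_at ?W i)"
    if i: "i \<in> {1..<n}" for i
  proof (cases "i = k")
    case True
    show ?thesis unfolding True rev sp
      by (rule linear_between_inv_into[OF s _ zigzag_module_maps[OF V k] bij])
        (use zigzag_module_spaces[OF V] st in auto)
  next
    case False
    show ?thesis unfolding other[OF False] sp by (rule zigzag_module_maps[OF V i])
  qed
  then show W: "?W \<in> zigzag_modules s n" using V by (simp add: zigzag_modules_def sp)
  have both: "src V k \<in> ?T j \<longleftrightarrow> tgt V k \<in> ?T j" if "j \<in> J" for j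
  proof -
    have "(b j, d j) \<in># Dgm s n V" using that fin by (simp add: D)
    then have "d j \<noteq> k \<and> b j \<noteq> k + 1" using structure_map_bij_iff[OF s V k] bij by blast
    then show ?thesis using bd[OF that] by (auto simp: src_def tgt_def split: direction.splits)
  qed
  have "strand_basis s n ?W J ?T e"
    unfolding strand_basis_def
  proof (intro conjI ballI impI)
    fix i j assume i: "i \<in> {1..<n}" and j: "j \<in> J" and a: "src ?W i \<in> ?T j"
    show "map_at ?W i (e j (src ?W i)) = (if tgt ?W i \<in> ?T j then e j (tgt ?W i) else 0)"
    proof (cases "i = k")
      case True
      have act: "tgt V k \<in> ?T j" "src V k \<in> ?T j" using a both[OF j] True rev by auto
      then have "map_at V k (e j (src V k)) = e j (tgt V k)" using e k j by (auto simp: strand_basis_def)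
      moreover have "e j (src V k) \<in> space_at V (src V k)"
      proof -
        have "indexed_basis s {j\<in>J. src V k \<in> ?T j} (\<lambda>j. e j (src V k)) (space_at V (src V k))"
          using e st(1) by (simp add: strand_basis_def)
        from indexed_basis_mem[OF s this, of j] show ?thesis using act j by simp
      qed
      ultimately have "inv_into (space_at V (src V k)) (map_at V k) (e j (tgt V k)) = e j (src V k)"
        using bij by (metis bij_betw_inv_into_left)
      then show ?thesis using act by (simp add: True rev)
    next
      case False
      show ?thesis using e i j a unfolding other[OF False] strand_basis_def by blast
    qed
  qed (use e in \<open>auto simp: strand_basis_def sp\<close>)
  then show "Dgm s n ?W = Dgm s n V" using Dgm_eq_strands[OF s W _ refl bd] D by simp
qed

text \<open>Reversing an arrow changes neither the intervals nor, therefore, which other arrows can be reversed.  So the arrows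
at which the types differ can be reversed one after the other.\<close>

lemma zigzag_equiv_iff:
  assumes s: "vector_space s" and V: "V \<in> zigzag_modules s n" and W: "W \<in> zigzag_modules s n"
  shows "zigzag_equiv s n V W \<longleftrightarrow> Dgm s n V = Dgm s n W \<and>
    (\<forall>k\<in>{1..<n}. dir_at V k \<noteq> dir_at W k \<longrightarrow> (\<forall>(b, d)\<in>#Dgm s n V. d \<noteq> k \<and> b \<noteq> k + 1))"
proof
  assume "zigzag_equiv s n V W"
  then obtain V' where V': "(reversal_step n)\<^sup>*\<^sup>* V V'" and iso: "zigzag_iso n s W s V'"
    unfolding zigzag_equiv_def by blast
  have "V' \<in> zigzag_modules s n \<and> Dgm s n V' = Dgm s n V \<and>
    (\<forall>k\<in>{1..<n}. dir_at V k \<noteq> dir_at V' k \<longrightarrow> (\<forall>(b, d)\<in>#Dgm s n V. d \<noteq> k \<and> b \<noteq> k + 1))"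
    using V'
  proof (induction rule: rtranclp_induct)
    case base
    show ?case using V by simp
  next
    case (step X Y)
    then obtain k where k: "k \<in> {1..<n}" "Y = reverse_arrow k X"
      and bij: "bij_betw (map_at X k) (space_at X (src X k)) (space_at X (tgt X k))"
      unfolding reversal_step_def by blast
    have X: "X \<in> zigzag_modules s n" using step by blast
    have "\<forall>(b, d)\<in>#Dgm s n V. d \<noteq> k \<and> b \<noteq> k + 1"
      using bij structure_map_bij_iff[OF s X k(1)] step.IH by simp
    moreover have "dir_at Y i = dir_at X i" if "i \<noteq> k" for i using that k by (simp add: reverse_arrow_def)
    ultimately show ?case
      using reverse_arrow_properties[OF s X k(1) bij] step.IH k(2) by metis
  qed
  then show "Dgm s n V = Dgm s n W \<and>
    (\<forall>k\<in>{1..<n}. dir_at V k \<noteq> dir_at W k \<longrightarrow> (\<forall>(b, d)\<in>#Dgm s n V. d \<noteq> k \<and> b \<noteq> k + 1))"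
    using iso_iff_Dgm[OF s s W, of V'] iso unfolding same_type_def by auto
next
  assume a: "Dgm s n V = Dgm s n W \<and>
    (\<forall>k\<in>{1..<n}. dir_at V k \<noteq> dir_at W k \<longrightarrow> (\<forall>(b, d)\<in>#Dgm s n V. d \<noteq> k \<and> b \<noteq> k + 1))"
  define K where "K X = {k\<in>{1..<n}. dir_at X k \<noteq> dir_at W k}" for X :: "'b zigzag"
  have "\<exists>X'. (reversal_step n)\<^sup>*\<^sup>* X X' \<and> zigzag_iso n s W s X'"
    if "X \<in> zigzag_modules s n" "Dgm s n X = Dgm s n W"
      "\<forall>k\<in>K X. \<forall>(b, d)\<in>#Dgm s n W. d \<noteq> k \<and> b \<noteq> k + 1" for X
    using that
  proof (induction "card (K X)" arbitrary: X)
    case 0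
    then have "K X = {}" by (simp add: K_def)
    then have "same_type n W X" by (auto simp: K_def same_type_def)
    then show ?case using iso_iff_Dgm[OF s s W 0(2)] 0(3) by auto
  next
    case (Suc m)
    then obtain k where k: "k \<in> K X" by fastforce
    then have k': "k \<in> {1..<n}" "dir_at X k \<noteq> dir_at W k" by (auto simp: K_def)
    have bij: "bij_betw (map_at X k) (space_at X (src X k)) (space_at X (tgt X k))"
      using structure_map_bij_iff[OF s Suc.prems(1) k'(1)] Suc.prems(2,3) k by simp
    let ?Y = "reverse_arrow k X"
    note Y = reverse_arrow_properties[OF s Suc.prems(1) k'(1) bij]
    have "flip x = y" if "x \<noteq> y" for x y using that by (cases x; cases y) auto
    then have "K ?Y = K X - {k}" using k' by (auto simp: K_def reverse_arrow_def)
    moreover have "finite (K X)" by (simp add: K_def)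
    ultimately have "m = card (K ?Y)" using Suc.hyps(2) k by simp
    then have "\<exists>X'. (reversal_step n)\<^sup>*\<^sup>* ?Y X' \<and> zigzag_iso n s W s X'"
      using Suc.hyps(1)[of ?Y] Y Suc.prems \<open>K ?Y = K X - {k}\<close> by simp
    moreover have "reversal_step n X ?Y" unfolding reversal_step_def using k' bij by blast
    ultimately show ?case by (meson converse_rtranclp_into_rtranclp)
  qed
  from this[OF V] show "zigzag_equiv s n V W" unfolding zigzag_equiv_def using a by (auto simp: K_def)
qed

lemma summand_upto_equiv_iff:
  assumes s: "vector_space s" and inf: "\<nexists>B. finite_dimensional_vector_space s B"
    and V: "V \<in> zigzag_modules s n" and W: "W \<in> zigzag_modules s n"
  shows "summand_upto_equiv s n W V \<longleftrightarrow> diagram_le n (diagram s n W) (diagram s n V)"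
proof
  assume "summand_upto_equiv s n W V"
  then obtain W' where W': "W' \<in> zigzag_modules s n" "zigzag_equiv s n W W'" "summand s n W' V"
    unfolding summand_upto_equiv_def by blast
  then show "diagram_le n (diagram s n W) (diagram s n V)"
    using zigzag_equiv_iff[OF s W W'(1)] summand_iff_Dgm[OF s inf V W'(1)]
    by (auto simp: diagram_le_def diagram_def same_type_def)
next
  assume le: "diagram_le n (diagram s n W) (diagram s n V)"
  have bd: "1 \<le> b \<and> b \<le> d \<and> d \<le> n" if "(b, d) \<in># Dgm s n W" for b d
    using that Dgm_bounds[OF s W] by blast
  obtain W' where W': "W' \<in> zigzag_modules s n" "dir_at W' = dir_at V" "Dgm s n W' = Dgm s n W"
    using module_with_Dgm_exists[OF s inf bd] by blast
  have "zigzag_equiv s n W W'"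
    using zigzag_equiv_iff[OF s W W'(1)] le W' by (auto simp: diagram_le_def diagram_def)
  moreover have "summand s n W' V"
    using summand_iff_Dgm[OF s inf V W'(1)] le W' by (auto simp: diagram_le_def diagram_def same_type_def)
  ultimately show "summand_upto_equiv s n W V" unfolding summand_upto_equiv_def using W'(1) by blast
qed


section \<open>Limits and colimits of decomposed diagrams\<close>

text \<open>The strands whose limit is one-dimensional: no arrow enters them from outside.\<close>

definition source_strands :: "nat \<Rightarrow> 'v zigzag \<Rightarrow> 'j set \<Rightarrow> ('j \<Rightarrow> nat set) \<Rightarrow> 'j set" where
  "source_strands n D J T = {j\<in>J. T j \<inter> {1..n} \<noteq> {} \<and> (\<forall>i\<in>{1..<n}. tgt D i \<in> T j \<longrightarrow> src D i \<in> T j)}"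

text \<open>The strands whose colimit is one-dimensional: no arrow leaves them.\<close>

definition sink_strands :: "nat \<Rightarrow> 'v zigzag \<Rightarrow> 'j set \<Rightarrow> ('j \<Rightarrow> nat set) \<Rightarrow> 'j set" where
  "sink_strands n D J T = {j\<in>J. T j \<inter> {1..n} \<noteq> {} \<and> (\<forall>i\<in>{1..<n}. src D i \<in> T j \<longrightarrow> tgt D i \<in> T j)}"

lemma constant_on_convex:
  fixes h :: "nat \<Rightarrow> 'b"
  assumes conv: "\<And>x y z. x \<in> T \<Longrightarrow> z \<in> T \<Longrightarrow> 1 \<le> x \<Longrightarrow> x \<le> y \<Longrightarrow> y \<le> z \<Longrightarrow> y \<in> T"
    and step: "\<And>i. i \<in> {1..<n} \<Longrightarrow> src D i \<in> T \<Longrightarrow> tgt D i \<in> T \<Longrightarrow> h (src D i) = h (tgt D i)"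
    and "i \<in> T \<inter> {1..n}" "i' \<in> T \<inter> {1..n}"
  shows "h i = h i'"
proof -
  have up: "h x = h y" if xy: "x \<le> y" "x \<in> T \<inter> {1..n}" "y \<in> T \<inter> {1..n}" for x y
    using xy
  proof (induction y rule: dec_induct)
    case (step y)
    have y: "y \<in> T \<inter> {1..n}" using conv[of x "Suc y" y] step by auto
    then have "h (src D y) = h (tgt D y)"
      using step.prems assms(2)[of y] by (auto simp: src_def tgt_def split: direction.split)
    then have "h y = h (Suc y)" by (auto simp: src_def tgt_def split: direction.splits)
    then show ?case using step y by simp
  qed simp
  show ?thesis
  proof (cases "i \<le> i'")
    case True
    then show ?thesis using assms(3,4) by (rule up)
  next
    case False
    then have "i' \<le> i" by simp
    from up[OF this assms(4,3)] show ?thesis by (rule sym)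
  qed
qed

text \<open>The components of a cone have coordinates that are constant along each strand.  If an arrow enters the
strand from outside, this constant is zero; the remaining constants are the coordinates of the
mediating map.\<close>

lemma limit_of_strands:
  fixes s :: "'a::field \<Rightarrow> 'v::ab_group_add \<Rightarrow> 'v"
  assumes s: "vector_space s" and D: "D \<in> zigzag_modules s n" and e: "strand_basis s n D J T e"
    and conv: "\<And>j x y z. j \<in> J \<Longrightarrow> x \<in> T j \<Longrightarrow> z \<in> T j \<Longrightarrow> 1 \<le> x \<Longrightarrow> x \<le> y \<Longrightarrow> y \<le> z \<Longrightarrow> y \<in> T j"
    and l: "indexed_basis s (source_strands n D J T) l L"
    and lin: "\<And>i. i \<in> {1..n} \<Longrightarrow> linear_between s L s (space_at D i) (\<pi> i)"
    and \<pi>: "\<And>i j. i \<in> {1..n} \<Longrightarrow> j \<in> source_strands n D J T \<Longrightarrow> \<pi> i (l j) = (if i \<in> T j then e j i else 0)"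
  shows "is_limit s n D L \<pi>"
proof -
  interpret S: vector_space s by (rule s)
  let ?S = "source_strands n D J T"
  obtain \<kappa> where \<kappa>: "\<And>i j. i \<in> {1..n} \<Longrightarrow> Vector_Spaces.linear s (*) (\<kappa> i j)"
    "\<And>i j l. i \<in> {1..n} \<Longrightarrow> j \<in> J \<Longrightarrow> l \<in> J \<Longrightarrow> i \<in> T j \<Longrightarrow> i \<in> T l \<Longrightarrow>
      \<kappa> i j (e l i) = (if j = l then 1 else 0)"
    "\<And>i x. i \<in> {1..n} \<Longrightarrow> x \<in> space_at D i \<Longrightarrow> x = (\<Sum>j\<in>{j\<in>J. i \<in> T j}. s (\<kappa> i j x) (e j i))"
    "\<And>i j x. i \<in> {1..<n} \<Longrightarrow> j \<in> J \<Longrightarrow> x \<in> space_at D (src D i) \<Longrightarrow> tgt D i \<in> T j \<Longrightarrow>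
      \<kappa> (tgt D i) j (map_at D i x) = (if src D i \<in> T j then \<kappa> (src D i) j x else 0)"
    by (rule strand_coordinates[OF s D e]) (rule that)
  have fin: "finite J" using e by (simp add: strand_basis_def)
  have SJ: "?S \<subseteq> J" by (auto simp: source_strands_def)
  then have finS: "finite ?S" using fin by (rule finite_subset)
  have cone: "is_cone s n D L \<pi>"
    unfolding is_cone_def
  proof (intro conjI ballI)
    show "fd_space s L" by (rule indexed_basis_fd[OF s l])
    fix i x assume i: "i \<in> {1..<n}" and x: "x \<in> L"
    note st = src_tgt_range[OF i, of D]
    have m0: "map_at D i 0 = 0"
      by (rule linear_between_0[OF s _ zigzag_module_maps[OF D i]]) (use zigzag_module_spaces[OF D] st in auto)
    have "(map_at D i \<circ> \<pi> (src D i)) x = \<pi> (tgt D i) x"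
    proof (rule linear_between_eq_on_basis[OF s s l linear_between_comp[OF lin[OF st(1)] zigzag_module_maps[OF D i]] lin[OF st(2)] _ x])
      fix j assume j: "j \<in> ?S"
      have "src D i \<in> T j \<Longrightarrow> map_at D i (e j (src D i)) = (if tgt D i \<in> T j then e j (tgt D i) else 0)"
        using e i j SJ by (auto simp: strand_basis_def)
      moreover have "tgt D i \<in> T j \<Longrightarrow> src D i \<in> T j" using j i by (auto simp: source_strands_def)
      ultimately show "(map_at D i \<circ> \<pi> (src D i)) (l j) = \<pi> (tgt D i) (l j)"
        using \<pi>[OF st(1) j] \<pi>[OF st(2) j] m0 by auto
    qed
    then show "map_at D i (\<pi> (src D i) x) = \<pi> (tgt D i) x" by simp
  qed (use lin in blast)
  define p where "p j = (SOME i. i \<in> T j \<inter> {1..n})" for j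
  have p: "p j \<in> T j" "p j \<in> {1..n}" if "j \<in> ?S" for j
  proof -
    have "p j \<in> T j \<inter> {1..n}" unfolding p_def by (rule someI_ex) (use that in \<open>auto simp: source_strands_def\<close>)
    then show "p j \<in> T j" "p j \<in> {1..n}" by auto
  qed
  have coord: "\<kappa> (p j) j (\<pi> (p j) (\<Sum>k\<in>?S. s (c k) (l k))) = c j" if j: "j \<in> ?S" for c j
  proof -
    interpret K: Vector_Spaces.linear s "(*)" "\<kappa> (p j) j" by (rule \<kappa>(1)[OF p(2)[OF j]])
    have "\<pi> (p j) (\<Sum>k\<in>?S. s (c k) (l k)) = (\<Sum>k\<in>?S. s (c k) (\<pi> (p j) (l k)))"
      by (rule linear_between_sum[OF s s indexed_basis_subspace[OF s l] lin[OF p(2)[OF j]] indexed_basis_mem[OF s l]])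
    then have "\<kappa> (p j) j (\<pi> (p j) (\<Sum>k\<in>?S. s (c k) (l k))) = (\<Sum>k\<in>?S. c k * \<kappa> (p j) j (\<pi> (p j) (l k)))"
      by (simp add: K.sum K.scale)
    also have "\<dots> = (\<Sum>k\<in>?S. if j = k then c k else 0)"
    proof (rule sum.cong[OF refl])
      fix k assume k: "k \<in> ?S"
      show "c k * \<kappa> (p j) j (\<pi> (p j) (l k)) = (if j = k then c k else 0)"
        using \<pi>[OF p(2)[OF j] k] \<kappa>(2)[OF p(2)[OF j] subsetD[OF SJ j] subsetD[OF SJ k] p(1)[OF j]] p(1)[OF j]
        by (auto simp: K.zero)
    qed
    also have "\<dots> = c j" using finS j by simp
    finally show ?thesis .
  qed
  have inj: "y = y'" if y: "y \<in> L" "y' \<in> L" and eq: "\<And>i. i \<in> {1..n} \<Longrightarrow> \<pi> i y = \<pi> i y'" for y y'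
  proof -
    obtain c where c: "y = (\<Sum>k\<in>?S. s (c k) (l k))" using indexed_basis_expand[OF l y(1)] by blast
    obtain c' where c': "y' = (\<Sum>k\<in>?S. s (c' k) (l k))" using indexed_basis_expand[OF l y(2)] by blast
    have "c j = c' j" if "j \<in> ?S" for j
      using coord[OF that, of c] coord[OF that, of c'] eq[OF p(2)[OF that]] c c' by simp
    then show ?thesis using c c' by simp
  qed
  have ex: "\<exists>u. linear_between s X s L u \<and> (\<forall>i\<in>{1..n}. \<forall>x\<in>X. \<pi> i (u x) = \<rho> i x)"
    if cX: "is_cone s n D X \<rho>" for X \<rho>
  proof -
    have \<rho>: "\<And>i. i \<in> {1..n} \<Longrightarrow> linear_between s X s (space_at D i) (\<rho> i)"
      "\<And>i x. i \<in> {1..<n} \<Longrightarrow> x \<in> X \<Longrightarrow> map_at D i (\<rho> (src D i) x) = \<rho> (tgt D i) x"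
      using cX unfolding is_cone_def by blast+
    have \<rho>D: "\<rho> i x \<in> space_at D i" if "i \<in> {1..n}" "x \<in> X" for i x
      using \<rho>(1)[OF that(1)] that(2) by (simp add: linear_between_def)
    define u where "u x = (\<Sum>j\<in>?S. s (\<kappa> (p j) j (\<rho> (p j) x)) (l j))" for x
    have uL: "u x \<in> L" for x unfolding u_def by (rule indexed_basis_sum_mem[OF l])
    have edge: "\<kappa> (tgt D i) j (\<rho> (tgt D i) x) = (if src D i \<in> T j then \<kappa> (src D i) j (\<rho> (src D i) x) else 0)"
      if "i \<in> {1..<n}" "j \<in> J" "x \<in> X" "tgt D i \<in> T j" for i j x
      using \<kappa>(4)[OF that(1,2) \<rho>D[OF _ that(3)] that(4)] src_tgt_range[OF that(1), of D] \<rho>(2)[OF that(1,3)]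
      by simp
    have const: "\<kappa> i j (\<rho> i x) = \<kappa> i' j (\<rho> i' x)"
      if "j \<in> J" "x \<in> X" "i \<in> T j \<inter> {1..n}" "i' \<in> T j \<inter> {1..n}" for i i' j x
      by (rule constant_on_convex[where h = "\<lambda>i. \<kappa> i j (\<rho> i x)" and D = D, OF conv[OF that(1)] _ that(3,4)])
        (use edge[OF _ that(1,2)] in auto)
    have coeff: "\<kappa> i j (\<rho> i x) = (if j \<in> ?S then \<kappa> (p j) j (\<rho> (p j) x) else 0)"
      if j: "j \<in> J" and x: "x \<in> X" and i: "i \<in> {1..n}" "i \<in> T j" for i j x
    proof (cases "j \<in> ?S")
      case True
      show ?thesis using const[OF j x, of i "p j"] p[OF True] i True by simp
    next
      case False
      then obtain a where a: "a \<in> {1..<n}" "tgt D a \<in> T j" "src D a \<notin> T j"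
        using j i by (auto simp: source_strands_def)
      have "\<kappa> i j (\<rho> i x) = \<kappa> (tgt D a) j (\<rho> (tgt D a) x)"
        using const[OF j x, of i "tgt D a"] i a src_tgt_range[OF a(1), of D] by blast
      then show ?thesis using edge[OF a(1) j x a(2)] a(3) False by simp
    qed
    have "linear_between s X s L u"
      unfolding linear_between_def
    proof (intro conjI ballI allI)
      have lin': "\<kappa> (p j) j (\<rho> (p j) (x + y)) = \<kappa> (p j) j (\<rho> (p j) x) + \<kappa> (p j) j (\<rho> (p j) y)"
        "\<kappa> (p j) j (\<rho> (p j) (s c x)) = c * \<kappa> (p j) j (\<rho> (p j) x)"
        if "j \<in> ?S" "x \<in> X" "y \<in> X" for j x y c
      proof -
        interpret K: Vector_Spaces.linear s "(*)" "\<kappa> (p j) j" by (rule \<kappa>(1)[OF p(2)[OF that(1)]])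
        show "\<kappa> (p j) j (\<rho> (p j) (x + y)) = \<kappa> (p j) j (\<rho> (p j) x) + \<kappa> (p j) j (\<rho> (p j) y)"
          "\<kappa> (p j) j (\<rho> (p j) (s c x)) = c * \<kappa> (p j) j (\<rho> (p j) x)"
          using \<rho>(1)[OF p(2)[OF that(1)]] that(2,3) by (simp_all add: linear_between_def K.add K.scale)
      qed
      show "u (x + y) = u x + u y" if "x \<in> X" "y \<in> X" for x y
        unfolding u_def using lin'(1)[OF _ that] by (simp add: S.scale_left_distrib sum.distrib)
      show "u (s c x) = s c (u x)" if "x \<in> X" for c x
        unfolding u_def using lin'(2)[OF _ that that] by (simp add: S.scale_sum_right)
    qed (use uL in auto)
    moreover have "\<pi> i (u x) = \<rho> i x" if i: "i \<in> {1..n}" and x: "x \<in> X" for i x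
    proof -
      have "\<pi> i (u x) = (\<Sum>j\<in>?S. s (\<kappa> (p j) j (\<rho> (p j) x)) (\<pi> i (l j)))"
        unfolding u_def
        by (rule linear_between_sum[OF s s indexed_basis_subspace[OF s l] lin[OF i] indexed_basis_mem[OF s l]])
      also have "\<dots> = (\<Sum>j\<in>?S. if i \<in> T j then s (\<kappa> (p j) j (\<rho> (p j) x)) (e j i) else 0)"
        by (rule sum.cong[OF refl]) (simp add: \<pi>[OF i])
      also have "\<dots> = (\<Sum>j\<in>{j\<in>J. i \<in> T j}. s (if j \<in> ?S then \<kappa> (p j) j (\<rho> (p j) x) else 0) (e j i))"
        using fin SJ by (intro sum.mono_neutral_cong) (auto intro: finite_subset)
      also have "\<dots> = (\<Sum>j\<in>{j\<in>J. i \<in> T j}. s (\<kappa> i j (\<rho> i x)) (e j i))"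
        by (rule sum.cong[OF refl]) (simp add: coeff[OF _ x i])
      also have "\<dots> = \<rho> i x" by (rule \<kappa>(3)[OF i \<rho>D[OF i x], symmetric])
      finally show ?thesis .
    qed
    ultimately show ?thesis by blast
  qed
  show ?thesis
    unfolding is_limit_def Let_def
  proof (intro conjI allI impI ballI cone ex)
    fix X \<rho> u u' x
    assume u: "linear_between s X s L u \<and> (\<forall>i\<in>{1..n}. \<forall>x\<in>X. \<pi> i (u x) = \<rho> i x)"
      and u': "linear_between s X s L u' \<and> (\<forall>i\<in>{1..n}. \<forall>x\<in>X. \<pi> i (u' x) = \<rho> i x)" and x: "x \<in> X"
    then have "u x \<in> L" "u' x \<in> L" by (auto simp: linear_between_def)
    then show "u x = u' x" using inj u u' x by simp
  qed
qed

lemma limit_unique: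
  assumes L: "is_limit s n D L \<pi>" and L': "is_limit s n D L' \<pi>'"
  shows "\<exists>v. linear_between s L' s L v \<and> bij_betw v L' L \<and> (\<forall>i\<in>{1..n}. \<forall>x\<in>L'. \<pi> i (v x) = \<pi>' i x)"
proof -
  have c: "is_cone s n D L \<pi>" "is_cone s n D L' \<pi>'" using assms by (auto simp: is_limit_def)
  obtain v where v: "linear_between s L' s L v" "\<And>i x. i \<in> {1..n} \<Longrightarrow> x \<in> L' \<Longrightarrow> \<pi> i (v x) = \<pi>' i x"
    using L c(2) unfolding is_limit_def Let_def by blast
  obtain u where u: "linear_between s L s L' u" "\<And>i x. i \<in> {1..n} \<Longrightarrow> x \<in> L \<Longrightarrow> \<pi>' i (u x) = \<pi> i x"
    using L' c(1) unfolding is_limit_def Let_def by blast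
  have uniq: "w x = w' x" if "is_limit s n D M \<rho>" "linear_between s M s M w" "linear_between s M s M w'"
    "\<And>i x. i \<in> {1..n} \<Longrightarrow> x \<in> M \<Longrightarrow> \<rho> i (w x) = \<rho> i x"
    "\<And>i x. i \<in> {1..n} \<Longrightarrow> x \<in> M \<Longrightarrow> \<rho> i (w' x) = \<rho> i x" "x \<in> M" for M \<rho> w w' x
    using that unfolding is_limit_def Let_def by blast
  have id: "linear_between s M s M (\<lambda>x. x)" for M by (simp add: linear_between_def)
  have mem: "v x \<in> L" if "x \<in> L'" for x using v(1) that by (simp add: linear_between_def)
  have mem': "u x \<in> L'" if "x \<in> L" for x using u(1) that by (simp add: linear_between_def)
  have "(v \<circ> u) x = x" if "x \<in> L" for x
    by (rule uniq[OF L linear_between_comp[OF u(1) v(1)] id _ _ that]) (use u(2) v(2) mem' in auto)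
  moreover have "(u \<circ> v) x = x" if "x \<in> L'" for x
    by (rule uniq[OF L' linear_between_comp[OF v(1) u(1)] id _ _ that]) (use u(2) v(2) mem in auto)
  ultimately have "bij_betw v L' L" using mem mem' by (intro bij_betw_byWitness[where f' = u]) auto
  then show ?thesis using v by blast
qed

text \<open>The second part is about an arbitrary limit, since the reflection functors choose one.\<close>

lemma limit_strands:
  assumes s: "vector_space s" and inf: "\<nexists>B. finite_dimensional_vector_space s B"
    and D: "D \<in> zigzag_modules s n" and e: "strand_basis s n D J T e"
    and conv: "\<And>j x y z. j \<in> J \<Longrightarrow> x \<in> T j \<Longrightarrow> z \<in> T j \<Longrightarrow> 1 \<le> x \<Longrightarrow> x \<le> y \<Longrightarrow> y \<le> z \<Longrightarrow> y \<in> T j"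
  shows "\<exists>L \<pi>. is_limit s n D L \<pi>"
    and "is_limit s n D L \<pi> \<Longrightarrow> \<exists>l. indexed_basis s (source_strands n D J T) l L \<and>
      (\<forall>i\<in>{1..n}. \<forall>j\<in>source_strands n D J T. \<pi> i (l j) = (if i \<in> T j then e j i else 0))"
proof -
  let ?S = "source_strands n D J T"
  interpret S: vector_space s by (rule s)
  have "finite J" using e by (simp add: strand_basis_def)
  then have "finite ?S" by (rule rev_finite_subset) (auto simp: source_strands_def)
  then obtain l L0 where l: "indexed_basis s ?S l L0" by (rule indexed_basis_in_infinite_dimensional[OF s inf])
  define \<pi>0 where "\<pi>0 i = (SOME g. Vector_Spaces.linear s s g \<and> (\<forall>j\<in>?S. g (l j) = (if i \<in> T j then e j i else 0)))" for i
  have \<pi>0: "Vector_Spaces.linear s s (\<pi>0 i)" "\<And>j. j \<in> ?S \<Longrightarrow> \<pi>0 i (l j) = (if i \<in> T j then e j i else 0)" for i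
    using someI_ex[OF indexed_basis_linear_exists[OF s s l, of "\<lambda>j. if i \<in> T j then e j i else 0"], folded \<pi>0_def]
    by blast+
  have lin: "linear_between s L0 s (space_at D i) (\<pi>0 i)" if i: "i \<in> {1..n}" for i
  proof (rule linear_imp_linear_between[OF \<pi>0(1)])
    fix x assume "x \<in> L0"
    then obtain c where "x = (\<Sum>j\<in>?S. s (c j) (l j))" using indexed_basis_expand[OF l] by blast
    interpret P: Vector_Spaces.linear s s "\<pi>0 i" by (rule \<pi>0(1))
    have sub: "S.subspace (space_at D i)" using zigzag_module_spaces[OF D] i by auto
    have "indexed_basis s {j\<in>J. i \<in> T j} (\<lambda>j. e j i) (space_at D i)" using e i by (simp add: strand_basis_def)
    from indexed_basis_mem[OF s this] have "e j i \<in> space_at D i" if "j \<in> ?S" "i \<in> T j" for j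
      using that by (auto simp: source_strands_def)
    then have "(\<Sum>j\<in>?S. s (c j) (\<pi>0 i (l j))) \<in> space_at D i"
      using \<pi>0(2) S.subspace_0[OF sub] by (intro S.subspace_sum[OF sub] S.subspace_scale[OF sub]) auto
    then show "\<pi>0 i x \<in> space_at D i" unfolding \<open>x = _\<close> by (simp add: P.sum P.scale)
  qed
  have L0: "is_limit s n D L0 \<pi>0" by (rule limit_of_strands[OF s D e conv l lin \<pi>0(2)])
  then show "\<exists>L \<pi>. is_limit s n D L \<pi>" by blast
  assume L: "is_limit s n D L \<pi>"
  from limit_unique[OF L L0] obtain v where v: "linear_between s L0 s L v" "bij_betw v L0 L"
    "\<forall>i\<in>{1..n}. \<forall>x\<in>L0. \<pi> i (v x) = \<pi>0 i x" by blast
  have "indexed_basis s ?S (v \<circ> l) L" by (rule indexed_basis_image[OF s s l v(1,2)])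
  moreover have "\<forall>i\<in>{1..n}. \<forall>j\<in>?S. \<pi> i ((v \<circ> l) j) = (if i \<in> T j then e j i else 0)"
    using v(3) \<pi>0(2) indexed_basis_mem[OF s l] by simp
  ultimately show "\<exists>l. indexed_basis s ?S l L \<and>
      (\<forall>i\<in>{1..n}. \<forall>j\<in>?S. \<pi> i (l j) = (if i \<in> T j then e j i else 0))" by blast
qed

text \<open>A cocone takes the same value on all basis vectors of a strand.  If an arrow leaves the strand, this value is zero;
the remaining values determine the mediating map.\<close>

lemma colimit_of_strands:
  fixes s :: "'a::field \<Rightarrow> 'v::ab_group_add \<Rightarrow> 'v"
  assumes s: "vector_space s" and D: "D \<in> zigzag_modules s n" and e: "strand_basis s n D J T e"
    and conv: "\<And>j x y z. j \<in> J \<Longrightarrow> x \<in> T j \<Longrightarrow> z \<in> T j \<Longrightarrow> 1 \<le> x \<Longrightarrow> x \<le> y \<Longrightarrow> y \<le> z \<Longrightarrow> y \<in> T j"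
    and l: "indexed_basis s (sink_strands n D J T) l C"
    and lin: "\<And>i. i \<in> {1..n} \<Longrightarrow> linear_between s (space_at D i) s C (\<iota> i)"
    and \<iota>: "\<And>i j. i \<in> {1..n} \<Longrightarrow> j \<in> J \<Longrightarrow> i \<in> T j \<Longrightarrow> \<iota> i (e j i) = (if j \<in> sink_strands n D J T then l j else 0)"
  shows "is_colimit s n D C \<iota>"
proof -
  interpret S: vector_space s by (rule s)
  let ?S = "sink_strands n D J T"
  have SJ: "?S \<subseteq> J" by (auto simp: sink_strands_def)
  have ib: "indexed_basis s {j\<in>J. i \<in> T j} (\<lambda>j. e j i) (space_at D i)" if "i \<in> {1..n}" for i
    using e that by (simp add: strand_basis_def)
  have map: "map_at D i (e j (src D i)) = (if tgt D i \<in> T j then e j (tgt D i) else 0)"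
    if "i \<in> {1..<n}" "j \<in> J" "src D i \<in> T j" for i j
    using e that by (auto simp: strand_basis_def)
  have cocone: "is_cocone s n D C \<iota>"
    unfolding is_cocone_def
  proof (intro conjI ballI)
    show "fd_space s C" by (rule indexed_basis_fd[OF s l])
    fix i x assume i: "i \<in> {1..<n}" and x: "x \<in> space_at D (src D i)"
    note st = src_tgt_range[OF i, of D]
    have i0: "\<iota> (tgt D i) 0 = 0"
      by (rule linear_between_0[OF s indexed_basis_subspace[OF s ib[OF st(2)]] lin[OF st(2)]])
    have "(\<iota> (tgt D i) \<circ> map_at D i) x = \<iota> (src D i) x"
    proof (rule linear_between_eq_on_basis[OF s s ib[OF st(1)] linear_between_comp[OF zigzag_module_maps[OF D i] lin[OF st(2)]] lin[OF st(1)] _ x])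
      fix j assume "j \<in> {j\<in>J. src D i \<in> T j}"
      then have j: "j \<in> J" "src D i \<in> T j" by auto
      have "j \<in> ?S \<Longrightarrow> tgt D i \<in> T j" using j i by (auto simp: sink_strands_def)
      then show "(\<iota> (tgt D i) \<circ> map_at D i) (e j (src D i)) = \<iota> (src D i) (e j (src D i))"
        using map[OF i j] \<iota>[OF st(1) j] \<iota>[OF st(2) j(1)] i0 by auto
    qed
    then show "\<iota> (tgt D i) (map_at D i x) = \<iota> (src D i) x" by simp
  qed (use lin in blast)
  define p where "p j = (SOME i. i \<in> T j \<inter> {1..n})" for j
  have p: "p j \<in> T j" "p j \<in> {1..n}" if "j \<in> ?S" for j
  proof -
    have "p j \<in> T j \<inter> {1..n}" unfolding p_def by (rule someI_ex) (use that in \<open>auto simp: sink_strands_def\<close>)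
    then show "p j \<in> T j" "p j \<in> {1..n}" by auto
  qed
  have ex: "\<exists>u. linear_between s C s X u \<and> (\<forall>i\<in>{1..n}. \<forall>x\<in>space_at D i. u (\<iota> i x) = \<rho> i x)"
    if cX: "is_cocone s n D X \<rho>" for X \<rho>
  proof -
    have X: "S.subspace X" using cX by (simp add: is_cocone_def fd_space_def)
    have \<rho>: "\<And>i. i \<in> {1..n} \<Longrightarrow> linear_between s (space_at D i) s X (\<rho> i)"
      "\<And>i x. i \<in> {1..<n} \<Longrightarrow> x \<in> space_at D (src D i) \<Longrightarrow> \<rho> (tgt D i) (map_at D i x) = \<rho> (src D i) x"
      using cX unfolding is_cocone_def by blast+
    have eD: "e j i \<in> space_at D i" if "i \<in> {1..n}" "j \<in> J" "i \<in> T j" for i j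
      using indexed_basis_mem[OF s ib[OF that(1)], of j] that by simp
    obtain u where u: "Vector_Spaces.linear s s u" "\<And>j. j \<in> ?S \<Longrightarrow> u (l j) = \<rho> (p j) (e j (p j))"
      using indexed_basis_linear_exists[OF s s l, of "\<lambda>j. \<rho> (p j) (e j (p j))"] by blast
    interpret U: Vector_Spaces.linear s s u by (rule u(1))
    have edge: "\<rho> (src D i) (e j (src D i)) = (if tgt D i \<in> T j then \<rho> (tgt D i) (e j (tgt D i)) else 0)"
      if i: "i \<in> {1..<n}" and "j \<in> J" "src D i \<in> T j" for i j
    proof -
      note st = src_tgt_range[OF i, of D]
      have "\<rho> (tgt D i) 0 = 0"
        by (rule linear_between_0[OF s indexed_basis_subspace[OF s ib[OF st(2)]] \<rho>(1)[OF st(2)]])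
      then show ?thesis using \<rho>(2)[OF i eD[OF st(1) that(2,3)]] map[OF that] by (auto split: if_splits)
    qed
    have const: "\<rho> i (e j i) = \<rho> i' (e j i')" if "j \<in> J" "i \<in> T j \<inter> {1..n}" "i' \<in> T j \<inter> {1..n}" for i i' j
      by (rule constant_on_convex[where h = "\<lambda>i. \<rho> i (e j i)" and D = D, OF conv[OF that(1)] _ that(2,3)])
        (use edge[OF _ that(1)] in auto)
    have lu: "linear_between s C s X u"
    proof (rule linear_imp_linear_between[OF u(1)])
      fix x assume "x \<in> C"
      then obtain c where c: "x = (\<Sum>j\<in>?S. s (c j) (l j))" using indexed_basis_expand[OF l] by blast
      have "u (l j) \<in> X" if "j \<in> ?S" for j
        using u(2)[OF that] \<rho>(1)[OF p(2)[OF that]] eD[OF p(2)[OF that] _ p(1)[OF that]] that SJ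
        by (auto simp: linear_between_def)
      then show "u x \<in> X" unfolding c U.sum U.scale by (intro S.subspace_sum[OF X] S.subspace_scale[OF X])
    qed
    have "u (\<iota> i x) = \<rho> i x" if i: "i \<in> {1..n}" and x: "x \<in> space_at D i" for i x
    proof -
      have "(u \<circ> \<iota> i) x = \<rho> i x"
      proof (rule linear_between_eq_on_basis[OF s s ib[OF i] linear_between_comp[OF lin[OF i] lu] \<rho>(1)[OF i] _ x])
        fix j assume "j \<in> {j\<in>J. i \<in> T j}"
        then have j: "j \<in> J" "i \<in> T j" by auto
        show "(u \<circ> \<iota> i) (e j i) = \<rho> i (e j i)"
        proof (cases "j \<in> ?S")
          case True
          then show ?thesis using \<iota>[OF i j] u(2)[OF True] const[OF j(1), of i "p j"] p[OF True] i j by simp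
        next
          case False
          then obtain a where a: "a \<in> {1..<n}" "src D a \<in> T j" "tgt D a \<notin> T j"
            using j i by (auto simp: sink_strands_def)
          have "\<rho> i (e j i) = \<rho> (src D a) (e j (src D a))"
            using const[OF j(1), of i "src D a"] i j a src_tgt_range[OF a(1), of D] by blast
          then show ?thesis using edge[OF a(1) j(1) a(2)] a(3) False \<iota>[OF i j] by (simp add: U.zero)
        qed
      qed
      then show ?thesis by simp
    qed
    then show ?thesis using lu by blast
  qed
  show ?thesis
    unfolding is_colimit_def Let_def
  proof (intro conjI allI impI cocone ex)
    fix X \<rho> u u'
    assume u: "linear_between s C s X u \<and> (\<forall>i\<in>{1..n}. \<forall>x\<in>space_at D i. u (\<iota> i x) = \<rho> i x)"
      and u': "linear_between s C s X u' \<and> (\<forall>i\<in>{1..n}. \<forall>x\<in>space_at D i. u' (\<iota> i x) = \<rho> i x)"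
    show "\<forall>x\<in>C. u x = u' x"
    proof
      fix x assume x: "x \<in> C"
      show "u x = u' x"
      proof (rule linear_between_eq_on_basis[OF s s l conjunct1[OF u] conjunct1[OF u'] _ x])
        fix j assume j: "j \<in> ?S"
        then have "l j = \<iota> (p j) (e j (p j))" using \<iota>[OF p(2)[OF j] _ p(1)[OF j]] SJ by auto
        moreover have "e j (p j) \<in> space_at D (p j)"
          using indexed_basis_mem[OF s ib[OF p(2)[OF j]], of j] j SJ p(1)[OF j] by auto
        ultimately show "u (l j) = u' (l j)" using u u' p(2)[OF j] by simp
      qed
    qed
  qed
qed

lemma colimit_unique:
  assumes C: "is_colimit s n D C \<iota>" and C': "is_colimit s n D C' \<iota>'"
  shows "\<exists>v. linear_between s C' s C v \<and> bij_betw v C' C \<and>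
    (\<forall>i\<in>{1..n}. \<forall>x\<in>space_at D i. v (\<iota>' i x) = \<iota> i x)"
proof -
  have c: "is_cocone s n D C \<iota>" "is_cocone s n D C' \<iota>'" using assms by (auto simp: is_colimit_def)
  obtain v where v: "linear_between s C' s C v" "\<And>i x. i \<in> {1..n} \<Longrightarrow> x \<in> space_at D i \<Longrightarrow> v (\<iota>' i x) = \<iota> i x"
    using C' c(1) unfolding is_colimit_def Let_def by blast
  obtain u where u: "linear_between s C s C' u" "\<And>i x. i \<in> {1..n} \<Longrightarrow> x \<in> space_at D i \<Longrightarrow> u (\<iota> i x) = \<iota>' i x"
    using C c(2) unfolding is_colimit_def Let_def by blast
  have uniq: "w x = w' x" if "is_colimit s n D M \<rho>" "linear_between s M s M w" "linear_between s M s M w'"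
    "\<And>i x. i \<in> {1..n} \<Longrightarrow> x \<in> space_at D i \<Longrightarrow> w (\<rho> i x) = \<rho> i x"
    "\<And>i x. i \<in> {1..n} \<Longrightarrow> x \<in> space_at D i \<Longrightarrow> w' (\<rho> i x) = \<rho> i x" "x \<in> M" for M \<rho> w w' x
    using that unfolding is_colimit_def Let_def by blast
  have id: "linear_between s M s M (\<lambda>x. x)" for M by (simp add: linear_between_def)
  have mem: "v x \<in> C" if "x \<in> C'" for x using v(1) that by (simp add: linear_between_def)
  have mem': "u x \<in> C'" if "x \<in> C" for x using u(1) that by (simp add: linear_between_def)
  have "(v \<circ> u) x = x" if "x \<in> C" for x
    by (rule uniq[OF C linear_between_comp[OF u(1) v(1)] id _ _ that]) (use u(2) v(2) in auto)
  moreover have "(u \<circ> v) x = x" if "x \<in> C'" for x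
    by (rule uniq[OF C' linear_between_comp[OF v(1) u(1)] id _ _ that]) (use u(2) v(2) in auto)
  ultimately have "bij_betw v C' C" using mem mem' by (intro bij_betw_byWitness[where f' = u]) auto
  then show ?thesis using v by blast
qed

lemma colimit_strands:
  assumes s: "vector_space s" and inf: "\<nexists>B. finite_dimensional_vector_space s B"
    and D: "D \<in> zigzag_modules s n" and e: "strand_basis s n D J T e"
    and conv: "\<And>j x y z. j \<in> J \<Longrightarrow> x \<in> T j \<Longrightarrow> z \<in> T j \<Longrightarrow> 1 \<le> x \<Longrightarrow> x \<le> y \<Longrightarrow> y \<le> z \<Longrightarrow> y \<in> T j"
  shows "\<exists>C \<iota>. is_colimit s n D C \<iota>"
    and "is_colimit s n D C \<iota> \<Longrightarrow> \<exists>l. indexed_basis s (sink_strands n D J T) l C \<and>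
      (\<forall>i\<in>{1..n}. \<forall>j\<in>J. i \<in> T j \<longrightarrow> \<iota> i (e j i) = (if j \<in> sink_strands n D J T then l j else 0))"
proof -
  let ?S = "sink_strands n D J T"
  interpret S: vector_space s by (rule s)
  have "finite J" using e by (simp add: strand_basis_def)
  then have "finite ?S" by (rule rev_finite_subset) (auto simp: sink_strands_def)
  then obtain l C0 where l: "indexed_basis s ?S l C0" by (rule indexed_basis_in_infinite_dimensional[OF s inf])
  have C0: "S.subspace C0" by (rule indexed_basis_subspace[OF s l])
  have ib: "indexed_basis s {j\<in>J. i \<in> T j} (\<lambda>j. e j i) (space_at D i)" if "i \<in> {1..n}" for i
    using e that by (simp add: strand_basis_def)
  define \<iota>0 where "\<iota>0 i = (SOME g. Vector_Spaces.linear s s g \<and>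
    (\<forall>j\<in>{j\<in>J. i \<in> T j}. g (e j i) = (if j \<in> ?S then l j else 0)))" for i
  have \<iota>0: "Vector_Spaces.linear s s (\<iota>0 i)"
    "\<And>j. j \<in> J \<Longrightarrow> i \<in> T j \<Longrightarrow> \<iota>0 i (e j i) = (if j \<in> ?S then l j else 0)" if "i \<in> {1..n}" for i
    using someI_ex[OF indexed_basis_linear_exists[OF s s ib[OF that], of "\<lambda>j. if j \<in> ?S then l j else 0"], folded \<iota>0_def]
    by auto
  have lin: "linear_between s (space_at D i) s C0 (\<iota>0 i)" if i: "i \<in> {1..n}" for i
  proof (rule linear_imp_linear_between[OF \<iota>0(1)[OF i]])
    fix x assume "x \<in> space_at D i"
    then obtain c where c: "x = (\<Sum>j\<in>{j\<in>J. i \<in> T j}. s (c j) (e j i))"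
      using indexed_basis_expand[OF ib[OF i]] by blast
    interpret P: Vector_Spaces.linear s s "\<iota>0 i" by (rule \<iota>0(1)[OF i])
    show "\<iota>0 i x \<in> C0" unfolding c P.sum P.scale
      using \<iota>0(2)[OF i] indexed_basis_mem[OF s l] S.subspace_0[OF C0]
      by (intro S.subspace_sum[OF C0] S.subspace_scale[OF C0]) auto
  qed
  have L0: "is_colimit s n D C0 \<iota>0" by (rule colimit_of_strands[OF s D e conv l lin \<iota>0(2)])
  then show "\<exists>C \<iota>. is_colimit s n D C \<iota>" by blast
  assume C: "is_colimit s n D C \<iota>"
  from colimit_unique[OF C L0] obtain v where v: "linear_between s C0 s C v" "bij_betw v C0 C"
    "\<forall>i\<in>{1..n}. \<forall>x\<in>space_at D i. v (\<iota>0 i x) = \<iota> i x" by blast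
  have "indexed_basis s ?S (v \<circ> l) C" by (rule indexed_basis_image[OF s s l v(1,2)])
  moreover have "\<forall>i\<in>{1..n}. \<forall>j\<in>J. i \<in> T j \<longrightarrow> \<iota> i (e j i) = (if j \<in> ?S then (v \<circ> l) j else 0)"
  proof (intro ballI impI)
    fix i j assume i: "i \<in> {1..n}" and j: "j \<in> J" "i \<in> T j"
    have "e j i \<in> space_at D i" using indexed_basis_mem[OF s ib[OF i], of j] j by simp
    then have "\<iota> i (e j i) = v (\<iota>0 i (e j i))" using v(3) i by simp
    then show "\<iota> i (e j i) = (if j \<in> ?S then (v \<circ> l) j else 0)"
      using \<iota>0(2)[OF i j] linear_between_0[OF s C0 v(1)] by simp
  qed
  ultimately show "\<exists>l. indexed_basis s ?S l C \<and>
      (\<forall>i\<in>{1..n}. \<forall>j\<in>J. i \<in> T j \<longrightarrow> \<iota> i (e j i) = (if j \<in> ?S then l j else 0))" by blast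
qed


section \<open>Reflections on intervals\<close>

lemma replace_at_strands:
  assumes s: "vector_space s" and V: "V \<in> zigzag_modules s n" and e: "strand_basis s n V J T e"
    and k: "1 \<le> k" "k \<le> n" and l: "indexed_basis s K l X" and K: "K \<subseteq> J"
    and fout: "k \<noteq> 1 \<Longrightarrow> \<delta> = Bwd \<Longrightarrow> linear_between s X s (space_at V (k - 1)) f \<and>
      (\<forall>j\<in>K. f (l j) = (if k - 1 \<in> T j then e j (k - 1) else 0))"
    and fin: "k \<noteq> 1 \<Longrightarrow> \<delta> = Fwd \<Longrightarrow> linear_between s (space_at V (k - 1)) s X f \<and>
      (\<forall>j\<in>J. k - 1 \<in> T j \<longrightarrow> f (e j (k - 1)) = (if j \<in> K then l j else 0))"
    and gout: "k \<noteq> n \<Longrightarrow> \<epsilon> = Fwd \<Longrightarrow> linear_between s X s (space_at V (k + 1)) g \<and>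
      (\<forall>j\<in>K. g (l j) = (if k + 1 \<in> T j then e j (k + 1) else 0))"
    and gin: "k \<noteq> n \<Longrightarrow> \<epsilon> = Bwd \<Longrightarrow> linear_between s (space_at V (k + 1)) s X g \<and>
      (\<forall>j\<in>J. k + 1 \<in> T j \<longrightarrow> g (e j (k + 1)) = (if j \<in> K then l j else 0))"
  shows "replace_at k X \<delta> f \<epsilon> g V \<in> zigzag_modules s n" (is "?W \<in> _")
    and "strand_basis s n (replace_at k X \<delta> f \<epsilon> g V) J
      (\<lambda>j. (T j - {k}) \<union> (if j \<in> K then {k} else {})) (\<lambda>j. (e j)(k := l j))"
proof -
  let ?T = "\<lambda>j. (T j - {k}) \<union> (if j \<in> K then {k} else {})"
  let ?e = "\<lambda>j. (e j)(k := l j)"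
  have sp: "space_at ?W = (space_at V)(k := X)" by (simp add: replace_at_def)
  have ib: "indexed_basis s {j\<in>J. i \<in> ?T j} (\<lambda>j. ?e j i) (space_at ?W i)" if i: "i \<in> {1..n}" for i
  proof (cases "i = k")
    case True
    have "{j\<in>J. i \<in> ?T j} = K" using True K by auto
    then show ?thesis using l True by (simp add: sp)
  next
    case False
    have "{j\<in>J. i \<in> ?T j} = {j\<in>J. i \<in> T j}" using False by auto
    then show ?thesis using e i False by (simp add: sp strand_basis_def)
  qed
  have arrow: "linear_between s (space_at ?W (src ?W i)) s (space_at ?W (tgt ?W i)) (map_at ?W i) \<and>
    (\<forall>j\<in>J. src ?W i \<in> ?T j \<longrightarrow>
      map_at ?W i (?e j (src ?W i)) = (if tgt ?W i \<in> ?T j then ?e j (tgt ?W i) else 0))"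
    if i: "i \<in> {1..<n}" for i
  proof -
    consider "i = k - 1" "k \<noteq> 1" | "i = k" | "i \<noteq> k - 1" "i \<noteq> k" using i by force
    then show ?thesis
    proof cases
      case 1
      then have W: "dir_at ?W i = \<delta>" "map_at ?W i = f" "k - 1 \<noteq> k" "k - 1 + 1 = k"
        using i by (auto simp: replace_at_def)
      show ?thesis
      proof (cases \<delta>)
        case Fwd
        then have "src ?W i = k - 1" "tgt ?W i = k" using W 1 by (auto simp: src_def tgt_def)
        then show ?thesis using fin[OF 1(2) Fwd] W by (auto simp: sp)
      next
        case Bwd
        then have "src ?W i = k" "tgt ?W i = k - 1" using W 1 by (auto simp: src_def tgt_def)
        then show ?thesis using fout[OF 1(2) Bwd] W by (auto simp: sp)
      qed
    next
      case 2
      then have W: "dir_at ?W i = \<epsilon>" "map_at ?W i = g" "k \<noteq> n" using i by (auto simp: replace_at_def)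
      show ?thesis
      proof (cases \<epsilon>)
        case Fwd
        then have "src ?W i = k" "tgt ?W i = k + 1" using W 2 by (auto simp: src_def tgt_def)
        then show ?thesis using gout[OF W(3) Fwd] W by (auto simp: sp)
      next
        case Bwd
        then have "src ?W i = k + 1" "tgt ?W i = k" using W 2 by (auto simp: src_def tgt_def)
        then show ?thesis using gin[OF W(3) Bwd] W by (auto simp: sp)
      qed
    next
      case 3
      then have st: "src ?W i = src V i" "tgt ?W i = tgt V i" "map_at ?W i = map_at V i"
        by (auto simp: replace_at_def src_def tgt_def)
      have ne: "src V i \<noteq> k" "tgt V i \<noteq> k" using 3 by (auto simp: src_def tgt_def split: direction.splits)
      show ?thesis
        using zigzag_module_maps[OF V i] e i ne by (simp add: st sp strand_basis_def)
    qed
  qed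
  show "?W \<in> zigzag_modules s n"
    unfolding zigzag_modules_def using indexed_basis_fd[OF s ib] arrow by blast
  show "strand_basis s n ?W J ?T ?e"
    unfolding strand_basis_def using e ib arrow by (auto simp: strand_basis_def)
qed

text \<open>The padding arrows have a zero space at one end, so that no strand continues along them.\<close>

lemma part_of_padded_strands:
  assumes s: "vector_space s" and V: "V \<in> zigzag_modules s n" and e: "strand_basis s n V J T e"
    and T: "\<And>j. j \<in> J \<Longrightarrow> T j \<subseteq> {1..n}" and k: "1 \<le> k" "k \<le> n"
  shows "part_at k (pad n \<delta> V) \<in> zigzag_modules s 3" (is "?D \<in> _")
    and "strand_basis s 3 (part_at k (pad n \<delta> V)) J (\<lambda>j. {i. 1 \<le> i \<and> k + i - 2 \<in> T j}) (\<lambda>j i. e j (k + i - 2))"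
proof -
  let ?P = "pad n \<delta> V"
  have ib: "indexed_basis s {j\<in>J. m \<in> T j} (\<lambda>j. e j m) (space_at ?P m)" if m: "m \<le> n + 1" for m
  proof (cases "m \<in> {1..n}")
    case True
    then show ?thesis using e by (simp add: pad_def strand_basis_def)
  next
    case False
    then have none: "{j\<in>J. m \<in> T j} = {}" using T by blast
    have zero: "space_at ?P m = {0}" using False m by (auto simp: pad_def)
    show ?thesis unfolding none zero by (simp add: indexed_basis_empty)
  qed
  have arrow: "linear_between s (space_at ?P (src ?P m)) s (space_at ?P (tgt ?P m)) (map_at ?P m) \<and>
    (\<forall>j\<in>J. src ?P m \<in> T j \<longrightarrow> map_at ?P m (e j (src ?P m)) = (if tgt ?P m \<in> T j then e j (tgt ?P m) else 0))"
    if m: "m \<le> n" for m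
  proof (cases "m \<in> {1..<n}")
    case True
    then have st: "src ?P m = src V m" "tgt ?P m = tgt V m" "map_at ?P m = map_at V m"
      by (auto simp: pad_def src_def tgt_def)
    have "space_at ?P i = space_at V i" if "i \<in> {1..n}" for i using that by (auto simp: pad_def)
    then show ?thesis
      using src_tgt_range[OF True, of V] zigzag_module_maps[OF V True] e True by (simp add: st strand_basis_def)
  next
    case False
    then have m0: "m = 0 \<or> m = n" using m by auto
    then have z: "map_at ?P m = (\<lambda>_. 0)" by (auto simp: pad_def)
    have r: "src ?P m \<le> n + 1" "tgt ?P m \<le> n + 1" using m by (auto simp: src_def tgt_def split: direction.splits)
    interpret S: vector_space s by (rule s)
    have "0 \<in> space_at ?P (tgt ?P m)" by (rule S.subspace_0[OF indexed_basis_subspace[OF s ib[OF r(2)]]])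
    moreover have "src ?P m \<in> {1..n} \<Longrightarrow> tgt ?P m \<notin> {1..n}"
      using m0 k by (auto simp: src_def tgt_def split: direction.splits)
    then have "tgt ?P m \<notin> T j" if "j \<in> J" "src ?P m \<in> T j" for j using T[OF that(1)] that(2) by blast
    ultimately show ?thesis by (auto simp: z linear_between_def)
  qed
  have st: "k + src ?D i - 2 = src ?P (k + i - 2)" "k + tgt ?D i - 2 = tgt ?P (k + i - 2)" "1 \<le> src ?D i" "1 \<le> tgt ?D i"
    if "i \<in> {1..<3}" for i
    using that k by (auto simp: part_at_def src_def tgt_def split: direction.splits)
  have sp: "space_at ?D i = space_at ?P (k + i - 2)" "map_at ?D i = map_at ?P (k + i - 2)" for i
    by (simp_all add: part_at_def)
  have ib': "indexed_basis s {j\<in>J. i \<in> {i. 1 \<le> i \<and> k + i - 2 \<in> T j}} (\<lambda>j. e j (k + i - 2)) (space_at ?D i)"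
    if "i \<in> {1..3}" for i
    unfolding sp using ib[of "k + i - 2"] that k by auto
  have le: "k + i - 2 \<le> n" if "i \<in> {1..<3}" for i using that k by auto
  show "?D \<in> zigzag_modules s 3"
    unfolding zigzag_modules_def using indexed_basis_fd[OF s ib'] arrow[OF le] by (simp add: sp st)
  show "strand_basis s 3 ?D J (\<lambda>j. {i. 1 \<le> i \<and> k + i - 2 \<in> T j}) (\<lambda>j i. e j (k + i - 2))"
    unfolding strand_basis_def
  proof (intro conjI ballI impI)
    show "finite J" using e by (simp add: strand_basis_def)
    fix i j assume i: "i \<in> {1..<3}" and j: "j \<in> J" and a: "src ?D i \<in> {i. 1 \<le> i \<and> k + i - 2 \<in> T j}"
    have "src ?P (k + i - 2) \<in> T j" using a st(1)[OF i] by simp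
    then have "map_at ?P (k + i - 2) (e j (src ?P (k + i - 2))) =
      (if tgt ?P (k + i - 2) \<in> T j then e j (tgt ?P (k + i - 2)) else 0)"
      using arrow[OF le[OF i]] j by blast
    then show "map_at ?D i (e j (k + src ?D i - 2)) =
      (if tgt ?D i \<in> {i. 1 \<le> i \<and> k + i - 2 \<in> T j} then e j (k + tgt ?D i - 2) else 0)"
      unfolding sp st[OF i] using st(2,4)[OF i] by simp
  qed (rule ib')
qed

text \<open>The effect of a limit reflection at \<open>k\<close> on an interval \<open>(b, d)\<close> with \<open>b < d\<close>, where \<open>a\<close> and \<open>c\<close> are the
directions of the arrows before and after \<open>k\<close>: the index \<open>k\<close> belongs to the new interval exactly if the
part of the old one in \<open>{k - 1..k + 1}\<close> is nonempty and no arrow enters it from outside.  At most one of the two endpoints is close enough to \<open>k\<close> to move.\<close>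

definition shift_interval :: "nat \<Rightarrow> direction \<Rightarrow> direction \<Rightarrow> nat \<times> nat \<Rightarrow> nat \<times> nat" where
  "shift_interval k a c = (\<lambda>(b, d).
     (if b = k then (if a = Bwd then k else k + 1) else if b = k + 1 then (if c = Bwd then k else k + 1) else b,
      if d + 1 = k then (if a = Fwd then k else k - 1) else if d = k then (if c = Fwd then k else k - 1) else d))"

text \<open>Colimits exchange entering and leaving arrows, hence the flips.  The updates at \<open>0\<close> and \<open>n\<close> are the padding
arrows.\<close>

fun reflect_interval :: "nat \<Rightarrow> reflection \<Rightarrow> (nat \<Rightarrow> direction) \<Rightarrow> nat \<times> nat \<Rightarrow> nat \<times> nat" where
  "reflect_interval n (Lim k \<delta>) \<tau> =
     shift_interval k ((\<tau>(0 := \<delta>, n := \<delta>)) (k - 1)) ((\<tau>(0 := \<delta>, n := \<delta>)) k)"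
| "reflect_interval n (Colim k \<delta>) \<tau> =
     shift_interval k (flip ((\<tau>(0 := \<delta>, n := \<delta>)) (k - 1))) (flip ((\<tau>(0 := \<delta>, n := \<delta>)) k))"

fun reflect_dirs :: "reflection \<Rightarrow> (nat \<Rightarrow> direction) \<Rightarrow> nat \<Rightarrow> direction" where
  "reflect_dirs (Lim k \<delta>) \<tau> = \<tau>(k - 1 := Bwd, k := Fwd)"
| "reflect_dirs (Colim k \<delta>) \<tau> = \<tau>(k - 1 := Fwd, k := Bwd)"

lemma shift_interval_set:
  assumes "1 \<le> b" "b < d" "1 \<le> k"
    and K: "K \<longleftrightarrow> {b..d} \<inter> {k - 1..k + 1} \<noteq> {} \<and>
      (if a = Fwd then k \<in> {b..d} \<longrightarrow> k - 1 \<in> {b..d} else k - 1 \<in> {b..d} \<longrightarrow> k \<in> {b..d}) \<and>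
      (if c = Fwd then k + 1 \<in> {b..d} \<longrightarrow> k \<in> {b..d} else k \<in> {b..d} \<longrightarrow> k + 1 \<in> {b..d})"
  shows "({b..d} - {k}) \<union> (if K then {k} else {}) =
    {fst (shift_interval k a c (b, d))..snd (shift_interval k a c (b, d))}"
proof -
  have meet: "{b..d} \<inter> {k - 1..k + 1} \<noteq> {} \<longleftrightarrow> b \<le> k + 1 \<and> k - 1 \<le> d"
    using assms(2) by (auto simp: Int_atLeastAtMost)
  note K = K[unfolded meet atLeastAtMost_iff]
  consider "d + 1 < k" | "d + 1 = k" | "d = k" | "b = k" | "b = k + 1" | "k + 1 < b" | "b < k" "k < d"
    by linarith
  then show ?thesis
  proof cases
    case 2
    then have "K \<longleftrightarrow> a = Fwd" using K assms(1-3) by auto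
    then show ?thesis using 2 assms(1-3) by (auto simp: shift_interval_def)
  next
    case 3
    then have "K \<longleftrightarrow> c = Fwd" using K assms(1-3) by auto
    then show ?thesis using 3 assms(1-3) by (auto simp: shift_interval_def)
  next
    case 4
    then have "K \<longleftrightarrow> a = Bwd" using K assms(1-3) by (cases a) auto
    then show ?thesis using 4 assms(1-3) by (auto simp: shift_interval_def)
  next
    case 5
    then have "K \<longleftrightarrow> c = Bwd" using K assms(1-3) by (cases c) auto
    then show ?thesis using 5 assms(1-3) by (auto simp: shift_interval_def)
  next
    case 7
    then have "K" using K assms(1-3) by auto
    then show ?thesis using 7 assms(1-3) by (auto simp: shift_interval_def)
  qed (use K assms(1-3) in \<open>auto simp: shift_interval_def\<close>)
qed

lemma shift_interval_bounds:
  assumes "1 \<le> b" "b < d" "d \<le> n" "1 \<le> k" "k \<le> n" "(b', d') = shift_interval k a c (b, d)"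
  shows "1 \<le> b'" "b' \<le> d'" "d' \<le> n"
  using assms by (auto simp: shift_interval_def split: if_splits)

text \<open>Simple summands are excluded because a summand \<open>(k, k)\<close> may vanish; all other intervals correspond to
exactly one interval of the reflected module.\<close>

lemma reflection_properties:
  assumes s: "vector_space s" and inf: "\<nexists>B. finite_dimensional_vector_space s B"
    and V: "V \<in> zigzag_modules s n" and ns: "\<forall>(b, d)\<in>#Dgm s n V. b \<noteq> d"
    and r: "1 \<le> reflection_index r" "reflection_index r \<le> n"
  shows "reflect s n r V \<in> zigzag_modules s n"
    and "dir_at (reflect s n r V) = reflect_dirs r (dir_at V)"
    and "Dgm s n (reflect s n r V) = image_mset (reflect_interval n r (dir_at V)) (Dgm s n V)"
proof -
  obtain J :: "nat set" and b d e where e: "strand_basis s n V J (\<lambda>j. {b j..d j}) e"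
    and bd: "\<And>j. j \<in> J \<Longrightarrow> 1 \<le> b j \<and> b j \<le> d j \<and> d j \<le> n"
    and Dg: "Dgm s n V = image_mset (\<lambda>j. (b j, d j)) (mset_set J)"
    by (rule Dgm_strandsE[OF s V]) (rule that)
  let ?T = "\<lambda>j. {b j..d j}"
  have fin: "finite J" using e by (simp add: strand_basis_def)
  have lt: "b j < d j" if "j \<in> J" for j
    using ns bd[OF that] that fin by (force simp: Dg)
  define k where "k = reflection_index r"
  have k: "1 \<le> k" "k \<le> n" using r by (auto simp: k_def)
  have T: "?T j \<subseteq> {1..n}" if "j \<in> J" for j using bd[OF that] by auto
  note part = part_of_padded_strands[OF s V e T k]
  let ?T3 = "\<lambda>j. {i. 1 \<le> i \<and> k + i - 2 \<in> ?T j}"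
  have conv: "y \<in> ?T3 j" if "x \<in> ?T3 j" "z \<in> ?T3 j" "1 \<le> x" "x \<le> y" "y \<le> z" for j x y z using that by auto
  have idx: "k + 1 - 2 = k - 1" "k + 3 - 2 = k + 1" using k by auto
  have memb: "1 \<in> ?T3 j \<longleftrightarrow> k - 1 \<in> ?T j" "3 \<in> ?T3 j \<longleftrightarrow> k + 1 \<in> ?T j" for j
    unfolding mem_Collect_eq idx by simp_all
  have spL: "space_at (part_at k (pad n \<delta> V)) 1 = space_at V (k - 1)" if "k \<noteq> 1" for \<delta>
  proof -
    have "k - 1 \<noteq> 0" "k - 1 \<noteq> n + 1" using k that by auto
    then show ?thesis unfolding part_at_def pad_def by (simp add: idx[unfolded One_nat_def])
  qed
  have spR: "space_at (part_at k (pad n \<delta> V)) 3 = space_at V (k + 1)" if "k \<noteq> n" for \<delta>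
  proof -
    have "k + 1 \<noteq> 0" "k + 1 \<noteq> n + 1" using k that by auto
    then show ?thesis unfolding part_at_def pad_def by simp
  qed
  have set3: "{1..<3} = {1, 2::nat}" "{1..3} = {1, 2, 3::nat}" by auto
  \<comment> \<open>The condition on the part around \<open>k\<close>, stated in the numbering of the whole module;
    \<open>\<gamma>\<close> gives the directions of the two arrows, flipped in the case of colimits.\<close>
  have keep: "K = K'"
    if K: "K = {j\<in>J. ?T3 j \<inter> {1..3} \<noteq> {} \<and> (\<forall>i\<in>{1..<3}. (if \<gamma> i = Fwd then i + 1 \<in> ?T3 j \<longrightarrow> i \<in> ?T3 j
        else i \<in> ?T3 j \<longrightarrow> i + 1 \<in> ?T3 j))}"
      and K': "K' = {j\<in>J. ?T j \<inter> {k - 1..k + 1} \<noteq> {} \<and>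
        (if \<gamma> 1 = Fwd then k \<in> ?T j \<longrightarrow> k - 1 \<in> ?T j else k - 1 \<in> ?T j \<longrightarrow> k \<in> ?T j) \<and>
        (if \<gamma> 2 = Fwd then k + 1 \<in> ?T j \<longrightarrow> k \<in> ?T j else k \<in> ?T j \<longrightarrow> k + 1 \<in> ?T j)}"
    for K K' and \<gamma> :: "nat \<Rightarrow> direction"
  proof -
    have m: "1 \<in> ?T3 j \<longleftrightarrow> k - 1 \<in> ?T j" "2 \<in> ?T3 j \<longleftrightarrow> k \<in> ?T j" "3 \<in> ?T3 j \<longleftrightarrow> k + 1 \<in> ?T j" for j
      using k by auto
    have "{k - 1..k + 1} = {k - 1, k, k + 1}" using k by auto
    then have meet: "?T3 j \<inter> {1..3} \<noteq> {} \<longleftrightarrow> ?T j \<inter> {k - 1..k + 1} \<noteq> {}" for j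
      using m[of j] unfolding set3 by (simp del: mem_Collect_eq atLeastAtMost_iff)
    have nums: "1 + 1 = (2::nat)" "2 + 1 = (3::nat)" by simp_all
    show ?thesis unfolding K K' set3(1) by (simp only: ball_simps nums m meet simp_thms)
  qed
  have main: "W \<in> zigzag_modules s n \<and> dir_at W = reflect_dirs r (dir_at V) \<and>
    Dgm s n W = image_mset (reflect_interval n r (dir_at V)) (Dgm s n V)"
    if W: "W = replace_at k X \<delta> f \<epsilon> g V" and dirs: "reflect_dirs r (dir_at V) = (dir_at V)(k - 1 := \<delta>, k := \<epsilon>)"
      and ri: "reflect_interval n r (dir_at V) = shift_interval k (\<gamma> 1) (\<gamma> 2)"
      and m: "W \<in> zigzag_modules s n"
      and sb: "strand_basis s n W J (\<lambda>j. (?T j - {k}) \<union> (if j \<in> K then {k} else {})) (\<lambda>j. (e j)(k := l j))"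
      and K: "K = {j\<in>J. ?T3 j \<inter> {1..3} \<noteq> {} \<and> (\<forall>i\<in>{1..<3}. (if \<gamma> i = Fwd then i + 1 \<in> ?T3 j \<longrightarrow> i \<in> ?T3 j
        else i \<in> ?T3 j \<longrightarrow> i + 1 \<in> ?T3 j))}"
    for W X \<delta> f \<epsilon> g \<gamma> K l
  proof -
    let ?sh = "\<lambda>j. shift_interval k (\<gamma> 1) (\<gamma> 2) (b j, d j)"
    have "Dgm s n W = image_mset (\<lambda>j. (fst (?sh j), snd (?sh j))) (mset_set J)"
    proof (rule Dgm_eq_strands[OF s m sb])
      fix j assume j: "j \<in> J"
      show "(?T j - {k}) \<union> (if j \<in> K then {k} else {}) = {fst (?sh j)..snd (?sh j)}"
        by (rule shift_interval_set) (use bd[OF j] lt[OF j] k j keep[OF K refl] in auto)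
      show "1 \<le> fst (?sh j) \<and> fst (?sh j) \<le> snd (?sh j) \<and> snd (?sh j) \<le> n"
        using shift_interval_bounds[of "b j" "d j" n k "fst (?sh j)" "snd (?sh j)" "\<gamma> 1" "\<gamma> 2"] bd[OF j] lt[OF j] k by simp
    qed
    then show ?thesis using m dirs by (simp add: W replace_at_def ri Dg image_mset.compositionality o_def)
  qed
  have "\<exists>W. is_reflection_of s n r V W" and all: "\<And>W. is_reflection_of s n r V W \<Longrightarrow>
    W \<in> zigzag_modules s n \<and> dir_at W = reflect_dirs r (dir_at V) \<and>
    Dgm s n W = image_mset (reflect_interval n r (dir_at V)) (Dgm s n V)"
  proof (atomize (full), cases r)
    case (Lim k' \<delta>)
    then have k': "k' = k" by (simp add: k_def)
    let ?D = "part_at k (pad n \<delta> V)"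
    have lim1: "\<exists>L \<pi>. is_limit s 3 ?D L \<pi>" by (rule limit_strands(1)[OF s inf part conv])
    have lim2: "\<exists>l. indexed_basis s (source_strands 3 ?D J ?T3) l L \<and>
      (\<forall>i\<in>{1..3}. \<forall>j\<in>source_strands 3 ?D J ?T3. \<pi> i (l j) = (if i \<in> ?T3 j then e j (k + i - 2) else 0))"
      if "is_limit s 3 ?D L \<pi>" for L \<pi>
      by (rule limit_strands(2)[OF s inf part conv that])
    have "\<exists>W. is_reflection_of s n r V W" using lim1 Lim k' by auto
    moreover have "W \<in> zigzag_modules s n \<and> dir_at W = reflect_dirs r (dir_at V) \<and>
      Dgm s n W = image_mset (reflect_interval n r (dir_at V)) (Dgm s n V)" if Wr: "is_reflection_of s n r V W" for W
    proof -
      obtain L \<pi> where L: "is_limit s 3 ?D L \<pi>" and W: "W = replace_at k L Bwd (\<pi> 1) Fwd (\<pi> 3) V"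
        using Wr Lim k' by auto
      let ?K = "source_strands 3 ?D J ?T3"
      obtain l where l: "indexed_basis s ?K l L"
        "\<And>i j. i \<in> {1..3} \<Longrightarrow> j \<in> ?K \<Longrightarrow> \<pi> i (l j) = (if i \<in> ?T3 j then e j (k + i - 2) else 0)"
        using lim2[OF L] by blast
      have lin: "linear_between s L s (space_at ?D i) (\<pi> i)" if "i \<in> {1..3}" for i
        using L that by (auto simp: is_limit_def is_cone_def)
      have KJ: "?K \<subseteq> J" by (auto simp: source_strands_def)
      have f: "linear_between s L s (space_at V (k - 1)) (\<pi> 1) \<and>
        (\<forall>j\<in>?K. \<pi> 1 (l j) = (if k - 1 \<in> ?T j then e j (k - 1) else 0))" if "k \<noteq> 1"
        using lin[of 1] l(2)[of 1] unfolding spL[OF that] memb idx by simp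
      have g: "linear_between s L s (space_at V (k + 1)) (\<pi> 3) \<and>
        (\<forall>j\<in>?K. \<pi> 3 (l j) = (if k + 1 \<in> ?T j then e j (k + 1) else 0))" if "k \<noteq> n"
        using lin[of 3] l(2)[of 3] unfolding spR[OF that] memb idx by simp
      have rep: "W \<in> zigzag_modules s n"
        "strand_basis s n W J (\<lambda>j. (?T j - {k}) \<union> (if j \<in> ?K then {k} else {})) (\<lambda>j. (e j)(k := l j))"
        unfolding W using replace_at_strands[OF s V e k l(1) KJ, of Bwd "\<pi> 1" Fwd "\<pi> 3"] f g by auto
      show ?thesis
      proof (rule main[OF W _ _ rep])
        show "reflect_dirs r (dir_at V) = (dir_at V)(k - 1 := Bwd, k := Fwd)" by (simp add: Lim k')
        show "reflect_interval n r (dir_at V) = shift_interval k (dir_at ?D 1) (dir_at ?D 2)"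
          using k by (simp add: Lim k' part_at_def pad_def)
        show "?K = {j\<in>J. ?T3 j \<inter> {1..3} \<noteq> {} \<and> (\<forall>i\<in>{1..<3}. (if dir_at ?D i = Fwd then i + 1 \<in> ?T3 j \<longrightarrow> i \<in> ?T3 j
          else i \<in> ?T3 j \<longrightarrow> i + 1 \<in> ?T3 j))}"
          unfolding source_strands_def
          by (intro Collect_cong conj_cong ball_cong refl) (simp add: src_def tgt_def split: direction.splits)
      qed
    qed
    ultimately show "(\<exists>W. is_reflection_of s n r V W) \<and> (\<forall>W. is_reflection_of s n r V W \<longrightarrow>
      W \<in> zigzag_modules s n \<and> dir_at W = reflect_dirs r (dir_at V) \<and>
      Dgm s n W = image_mset (reflect_interval n r (dir_at V)) (Dgm s n V))" by blast
  next
    case (Colim k' \<delta>)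
    then have k': "k' = k" by (simp add: k_def)
    let ?D = "part_at k (pad n \<delta> V)"
    have lim1: "\<exists>C \<iota>. is_colimit s 3 ?D C \<iota>" by (rule colimit_strands(1)[OF s inf part conv])
    have lim2: "\<exists>l. indexed_basis s (sink_strands 3 ?D J ?T3) l C \<and>
      (\<forall>i\<in>{1..3}. \<forall>j\<in>J. i \<in> ?T3 j \<longrightarrow> \<iota> i (e j (k + i - 2)) = (if j \<in> sink_strands 3 ?D J ?T3 then l j else 0))"
      if "is_colimit s 3 ?D C \<iota>" for C \<iota>
      by (rule colimit_strands(2)[OF s inf part conv that])
    have "\<exists>W. is_reflection_of s n r V W" using lim1 Colim k' by auto
    moreover have "W \<in> zigzag_modules s n \<and> dir_at W = reflect_dirs r (dir_at V) \<and>
      Dgm s n W = image_mset (reflect_interval n r (dir_at V)) (Dgm s n V)" if Wr: "is_reflection_of s n r V W" for W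
    proof -
      obtain C \<iota> where C: "is_colimit s 3 ?D C \<iota>" and W: "W = replace_at k C Fwd (\<iota> 1) Bwd (\<iota> 3) V"
        using Wr Colim k' by auto
      let ?K = "sink_strands 3 ?D J ?T3"
      obtain l where l: "indexed_basis s ?K l C"
        "\<And>i j. i \<in> {1..3} \<Longrightarrow> j \<in> J \<Longrightarrow> i \<in> ?T3 j \<Longrightarrow> \<iota> i (e j (k + i - 2)) = (if j \<in> ?K then l j else 0)"
        using lim2[OF C] by blast
      have lin: "linear_between s (space_at ?D i) s C (\<iota> i)" if "i \<in> {1..3}" for i
        using C that by (auto simp: is_colimit_def is_cocone_def)
      have KJ: "?K \<subseteq> J" by (auto simp: sink_strands_def)
      have f: "linear_between s (space_at V (k - 1)) s C (\<iota> 1) \<and>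
        (\<forall>j\<in>J. k - 1 \<in> ?T j \<longrightarrow> \<iota> 1 (e j (k - 1)) = (if j \<in> ?K then l j else 0))" if "k \<noteq> 1"
        using lin[of 1] l(2)[of 1] unfolding spL[OF that] memb idx by simp
      have g: "linear_between s (space_at V (k + 1)) s C (\<iota> 3) \<and>
        (\<forall>j\<in>J. k + 1 \<in> ?T j \<longrightarrow> \<iota> 3 (e j (k + 1)) = (if j \<in> ?K then l j else 0))" if "k \<noteq> n"
        using lin[of 3] l(2)[of 3] unfolding spR[OF that] memb idx by simp
      have rep: "W \<in> zigzag_modules s n"
        "strand_basis s n W J (\<lambda>j. (?T j - {k}) \<union> (if j \<in> ?K then {k} else {})) (\<lambda>j. (e j)(k := l j))"
        unfolding W using replace_at_strands[OF s V e k l(1) KJ, of Fwd "\<iota> 1" Bwd "\<iota> 3"] f g by auto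
      show ?thesis
      proof (rule main[OF W _ _ rep])
        show "reflect_dirs r (dir_at V) = (dir_at V)(k - 1 := Fwd, k := Bwd)" by (simp add: Colim k')
        show "reflect_interval n r (dir_at V) = shift_interval k (flip (dir_at ?D 1)) (flip (dir_at ?D 2))"
          using k by (simp add: Colim k' part_at_def pad_def)
        show "?K = {j\<in>J. ?T3 j \<inter> {1..3} \<noteq> {} \<and> (\<forall>i\<in>{1..<3}. (if flip (dir_at ?D i) = Fwd then i + 1 \<in> ?T3 j \<longrightarrow> i \<in> ?T3 j
          else i \<in> ?T3 j \<longrightarrow> i + 1 \<in> ?T3 j))}"
          unfolding sink_strands_def
          by (intro Collect_cong conj_cong ball_cong refl) (simp add: src_def tgt_def split: direction.splits)
      qed
    qed
    ultimately show "(\<exists>W. is_reflection_of s n r V W) \<and> (\<forall>W. is_reflection_of s n r V W \<longrightarrow>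
      W \<in> zigzag_modules s n \<and> dir_at W = reflect_dirs r (dir_at V) \<and>
      Dgm s n W = image_mset (reflect_interval n r (dir_at V)) (Dgm s n V))" by blast
  qed
  then have "is_reflection_of s n r V (reflect s n r V)" unfolding reflect_def by (blast intro: someI_ex)
  from all[OF this] show "reflect s n r V \<in> zigzag_modules s n"
    "dir_at (reflect s n r V) = reflect_dirs r (dir_at V)"
    "Dgm s n (reflect s n r V) = image_mset (reflect_interval n r (dir_at V)) (Dgm s n V)" by blast+
qed


section \<open>Sequences of reflections\<close>

fun drop_simples :: "(nat \<Rightarrow> direction) \<times> (nat \<times> nat) multiset \<Rightarrow> (nat \<Rightarrow> direction) \<times> (nat \<times> nat) multiset" where
  "drop_simples (\<tau>, D) = (\<tau>, {#(b, d) \<in># D. b \<noteq> d#})"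

fun reflect_diagram :: "nat \<Rightarrow> reflection \<Rightarrow> (nat \<Rightarrow> direction) \<times> (nat \<times> nat) multiset \<Rightarrow>
    (nat \<Rightarrow> direction) \<times> (nat \<times> nat) multiset" where
  "reflect_diagram n r (\<tau>, D) = (reflect_dirs r \<tau>, image_mset (reflect_interval n r \<tau>) D)"

fun run_reflections :: "nat \<Rightarrow> reflection list \<Rightarrow> (nat \<Rightarrow> direction) \<times> (nat \<times> nat) multiset \<Rightarrow>
    (nat \<Rightarrow> direction) \<times> (nat \<times> nat) multiset" where
  "run_reflections n [] x = drop_simples x"
| "run_reflections n (r # rs) x = drop_simples (reflect_diagram n r (run_reflections n rs x))"

lemma diagram_le_trans:
  assumes "diagram_le n x y" "diagram_le n y z"
  shows "diagram_le n x z"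
proof -
  have sub: "snd x \<subseteq># snd y" "snd y \<subseteq># snd z" using assms by (auto simp: diagram_le_def)
  have "\<forall>(b, d)\<in>#snd x. d \<noteq> k \<and> b \<noteq> k + 1" if k: "k \<in> {1..<n}" "fst x k \<noteq> fst z k" for k
  proof (cases "fst x k = fst y k")
    case True
    then have "\<forall>(b, d)\<in>#snd y. d \<noteq> k \<and> b \<noteq> k + 1" using k assms(2) by (simp add: diagram_le_def)
    then show ?thesis using mset_subset_eqD[OF sub(1)] by blast
  next
    case False
    then show ?thesis using k(1) assms(1) by (simp add: diagram_le_def)
  qed
  then show ?thesis using subset_mset.order_trans[OF sub] by (simp add: diagram_le_def)
qed

lemma diagram_le_drop_short:
  assumes "diagram_le n x y"
  shows "diagram_le n (drop_simples x) (drop_simples y)"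
  using assms by (cases x; cases y) (auto simp: diagram_le_def multiset_filter_mono)

lemma drop_simples_le: "diagram_le n (drop_simples x) x"
  by (cases x) (auto simp: diagram_le_def)

lemma drop_simples_ident:
  assumes "\<forall>(b, d)\<in>#D. b \<noteq> d"
  shows "drop_simples (\<tau>, D) = (\<tau>, D)"
proof -
  have "{#(b, d) \<in># D. b \<noteq> d#} = {#x \<in># D. True#}"
    by (rule filter_mset_cong[OF refl]) (use assms in auto)
  then show ?thesis by simp
qed

lemma drop_simples_idem: "drop_simples (drop_simples x) = drop_simples x"
proof (cases x)
  case (Pair \<tau> D)
  show ?thesis unfolding Pair drop_simples.simps(1)[of \<tau> D] by (rule drop_simples_ident) auto
qed

lemma shift_interval_cong:
  assumes "a \<noteq> a' \<Longrightarrow> d + 1 \<noteq> k \<and> b \<noteq> k" "c \<noteq> c' \<Longrightarrow> d \<noteq> k \<and> b \<noteq> k + 1"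
  shows "shift_interval k a c (b, d) = shift_interval k a' c' (b, d)"
  using assms by (cases "a = a'"; cases "c = c'") (auto simp: shift_interval_def)

lemma shift_interval_endpoints:
  assumes "(b', d') = shift_interval k a c (b, d)" "j \<noteq> k" "j + 1 \<noteq> k" "d \<noteq> j" "b \<noteq> j + 1" "1 \<le> k"
  shows "d' \<noteq> j" "b' \<noteq> j + 1"
  using assms by (auto simp: shift_interval_def split: if_splits)

text \<open>The directions at \<open>k - 1\<close> and \<open>k\<close> matter only for intervals which are cut at the respective arrow.\<close>

lemma reflect_interval_cong:
  assumes r: "1 \<le> reflection_index r" "reflection_index r \<le> n"
    and eq: "\<And>j. j \<in> {1..<n} \<Longrightarrow> \<tau> j \<noteq> \<tau>' j \<Longrightarrow> d \<noteq> j \<and> b \<noteq> j + 1"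
  shows "reflect_interval n r \<tau> (b, d) = reflect_interval n r \<tau>' (b, d)"
proof -
  have *: "(\<tau>(0 := \<delta>, n := \<delta>)) m \<noteq> (\<tau>'(0 := \<delta>, n := \<delta>)) m \<Longrightarrow> d \<noteq> m \<and> b \<noteq> m + 1" if "m \<le> n" for m \<delta>
    using eq[of m] that by (auto split: if_splits)
  have inj: "x \<noteq> y" if "flip x \<noteq> flip y" for x y using that by auto
  let ?k = "reflection_index r"
  have l: "d + 1 \<noteq> ?k \<and> b \<noteq> ?k" if "(\<tau>(0 := \<delta>, n := \<delta>)) (?k - 1) \<noteq> (\<tau>'(0 := \<delta>, n := \<delta>)) (?k - 1)" for \<delta>
  proof -
    have "d \<noteq> ?k - 1 \<and> b \<noteq> ?k - 1 + 1" using *[OF _ that] r by simp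
    then show ?thesis using r(1) by auto
  qed
  have r: "d \<noteq> ?k \<and> b \<noteq> ?k + 1" if "(\<tau>(0 := \<delta>, n := \<delta>)) ?k \<noteq> (\<tau>'(0 := \<delta>, n := \<delta>)) ?k" for \<delta>
    using *[OF _ that] r by auto
  show ?thesis
  proof (cases r)
    case (Lim k \<delta>)
    then have k: "?k = k" by simp
    show ?thesis unfolding Lim reflect_interval.simps
      by (rule shift_interval_cong) (erule l[unfolded k] r[unfolded k])+
  next
    case (Colim k \<delta>)
    then have k: "?k = k" by simp
    show ?thesis unfolding Colim reflect_interval.simps
      by (rule shift_interval_cong) (erule l[unfolded k, OF inj] r[unfolded k, OF inj])+
  qed
qed

text \<open>Intervals of the smaller diagram are transformed in the same way in both diagrams by
\<open>reflect_interval_cong\<close>.  After the reflection, the types agree around \<open>k\<close>, and away from \<open>k\<close> no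
endpoint has changed.\<close>

lemma diagram_le_reflect:
  assumes r: "1 \<le> reflection_index r" "reflection_index r \<le> n" and le: "diagram_le n x y"
  shows "diagram_le n (reflect_diagram n r x) (reflect_diagram n r y)"
proof -
  obtain \<tau> D \<tau>' D' where x: "x = (\<tau>, D)" and y: "y = (\<tau>', D')" by (cases x; cases y) auto
  let ?k = "reflection_index r"
  have sub: "D \<subseteq># D'" and uncut: "\<And>k b d. k \<in> {1..<n} \<Longrightarrow> \<tau> k \<noteq> \<tau>' k \<Longrightarrow> (b, d) \<in># D \<Longrightarrow> d \<noteq> k \<and> b \<noteq> k + 1"
    using le by (auto simp: diagram_le_def x y)
  have eq: "image_mset (reflect_interval n r \<tau>) D = image_mset (reflect_interval n r \<tau>') D"
  proof (rule image_mset_cong)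
    fix z assume "z \<in># D"
    then show "reflect_interval n r \<tau> z = reflect_interval n r \<tau>' z"
      by (cases z) (use reflect_interval_cong[OF r] uncut in blast)
  qed
  have unc: "d' \<noteq> j \<and> b' \<noteq> j + 1"
    if j: "j \<in> {1..<n}" "reflect_dirs r \<tau> j \<noteq> reflect_dirs r \<tau>' j"
      and I: "(b', d') \<in># image_mset (reflect_interval n r \<tau>) D" for j b' d'
  proof -
    obtain b d where bd: "(b, d) \<in># D" "(b', d') = reflect_interval n r \<tau> (b, d)" using I by auto
    have ne: "j \<noteq> ?k" "j + 1 \<noteq> ?k" "\<tau> j \<noteq> \<tau>' j" using j by (cases r; auto split: if_splits)+
    obtain a c where "reflect_interval n r \<tau> (b, d) = shift_interval ?k a c (b, d)" by (cases r) auto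
    then show ?thesis
      using shift_interval_endpoints[of b' d' ?k a c b d j] bd ne uncut[OF j(1) ne(3) bd(1)] r(1) by simp
  qed
  show ?thesis
    unfolding diagram_le_def x y reflect_diagram.simps fst_conv snd_conv
  proof (intro conjI ballI impI)
    show "image_mset (reflect_interval n r \<tau>) D \<subseteq># image_mset (reflect_interval n r \<tau>') D'"
      unfolding eq by (rule image_mset_subseteq_mono[OF sub])
    show "case z of (b, d) \<Rightarrow> d \<noteq> j \<and> b \<noteq> j + 1"
      if "j \<in> {1..<n}" "reflect_dirs r \<tau> j \<noteq> reflect_dirs r \<tau>' j"
        "z \<in># image_mset (reflect_interval n r \<tau>) D" for j z
      using unc[OF that(1,2)] that(3) by (cases z) blast
  qed
qed

lemma diagram_le_run_reflections:
  assumes "rs \<in> reflection_sequences n" "diagram_le n x y"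
  shows "diagram_le n (run_reflections n rs x) (run_reflections n rs y)"
  using assms
  by (induction rs) (auto simp: reflection_sequences_def intro!: diagram_le_drop_short diagram_le_reflect)

lemma drop_simples_run_reflections: "drop_simples (run_reflections n rs x) = run_reflections n rs x"
  by (cases rs) (simp_all add: drop_simples_idem)

lemma run_reflections_append: "run_reflections n (qs @ rs) x = run_reflections n qs (run_reflections n rs x)"
  by (induction qs) (simp_all add: drop_simples_run_reflections)

text \<open>The types agree on the arrows of the module only, since the removal of simple summands and isomorphisms
ignore the other values of \<open>dir_at\<close>.\<close>

lemma apply_reflections_diagram:
  assumes s: "vector_space s" and inf: "\<nexists>B. finite_dimensional_vector_space s B"
    and V: "V \<in> zigzag_modules s n" and rs: "rs \<in> reflection_sequences n"
  shows "apply_reflections s n rs V \<in> zigzag_modules s n \<and>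
    snd (diagram s n (apply_reflections s n rs V)) = snd (run_reflections n rs (diagram s n V)) \<and>
    (\<forall>i\<in>{1..<n}. dir_at (apply_reflections s n rs V) i = fst (run_reflections n rs (diagram s n V)) i)"
  using rs
proof (induction rs)
  case Nil
  then show ?case using remove_simples_properties[OF s inf V] by (simp add: diagram_def same_type_def)
next
  case (Cons r rs)
  let ?W = "apply_reflections s n rs V"
  obtain \<tau> D where run: "run_reflections n rs (diagram s n V) = (\<tau>, D)" by fastforce
  have W: "?W \<in> zigzag_modules s n" "Dgm s n ?W = D" "\<And>i. i \<in> {1..<n} \<Longrightarrow> dir_at ?W i = \<tau> i"
    using Cons run by (auto simp: diagram_def reflection_sequences_def)
  have r: "1 \<le> reflection_index r" "reflection_index r \<le> n" using Cons by (auto simp: reflection_sequences_def)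
  have "drop_simples (\<tau>, D) = (\<tau>, D)" using drop_simples_run_reflections[of n rs "diagram s n V"] run by simp
  then have D: "{#(b, d) \<in># D. b \<noteq> d#} = D" by simp
  have "\<forall>(b, d)\<in>#D. b \<noteq> d" by (subst D[symmetric]) auto
  then have ns: "\<forall>(b, d)\<in>#Dgm s n ?W. b \<noteq> d" using W by simp
  note R = reflection_properties[OF s inf W(1) ns r]
  note S = remove_simples_properties[OF s inf R(1)]
  have img: "image_mset (reflect_interval n r (dir_at ?W)) D = image_mset (reflect_interval n r \<tau>) D"
  proof (rule image_mset_cong)
    fix z assume "z \<in># D"
    show "reflect_interval n r (dir_at ?W) z = reflect_interval n r \<tau> z"
      by (cases z) (use reflect_interval_cong[OF r] W(3) in metis)
  qed
  have "dir_at (remove_simples s n (reflect s n r ?W)) i = reflect_dirs r \<tau> i" if "i \<in> {1..<n}" for i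
    using S(2) R(2) W(3)[OF that] that by (cases r) (auto simp: same_type_def)
  then show ?case unfolding run_reflections.simps run reflect_diagram.simps drop_simples.simps
    using S R W(2) img by (simp add: diagram_def)
qed

lemma summand_apply_reflections_iff:
  assumes s: "vector_space s" and inf: "\<nexists>B. finite_dimensional_vector_space s B"
    and V: "V \<in> zigzag_modules s n" and W: "W \<in> zigzag_modules s n" and rs: "rs \<in> reflection_sequences n"
  shows "summand_upto_equiv s n (apply_reflections s n rs V) W \<longleftrightarrow>
    diagram_le n (run_reflections n rs (diagram s n V)) (diagram s n W)"
  using apply_reflections_diagram[OF s inf V rs] summand_upto_equiv_iff[OF s inf W]
  by (auto simp: diagram_le_def diagram_def)


section \<open>Annihilating sequences\<close>

text \<open>Treats limits and colimits at once, using that the two are exchanged when all arrows are reversed: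
this is the reflection at \<open>k\<close> after which the arrow at \<open>k\<close> has the direction \<open>u\<close>, and the one at
\<open>k - 1\<close> the opposite direction.\<close>

definition toward :: "direction \<Rightarrow> nat \<Rightarrow> direction \<Rightarrow> reflection" where
  "toward u k \<delta> = (if u = Fwd then Lim k \<delta> else Colim k \<delta>)"

lemma reflection_index_toward [simp]: "reflection_index (toward u k \<delta>) = k"
  by (simp add: toward_def)

lemma reflect_dirs_toward: "reflect_dirs (toward u k \<delta>) \<tau> = \<tau>(k - 1 := flip u, k := u)"
  by (cases u) (simp_all add: toward_def)

lemma reflect_interval_toward:
  assumes "b < d" "d \<le> k" "2 \<le> k" "k \<le> n"
  shows "reflect_interval n (toward u k \<delta>) \<tau> (b, d) =
     (b, if d + 1 = k then (if \<tau> (k - 1) = u then k else d)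
         else if d = k then (if (if k = n then \<delta> else \<tau> k) = u then k else k - 1) else d)"
proof -
  have f: "flip x = Fwd \<longleftrightarrow> x = Bwd" for x by (cases x) auto
  have e: "(\<tau>(0 := \<delta>, n := \<delta>)) (k - 1) = \<tau> (k - 1)" "(\<tau>(0 := \<delta>, n := \<delta>)) k = (if k = n then \<delta> else \<tau> k)"
    using assms by auto
  have b: "b \<noteq> k" "b \<noteq> k + 1" using assms by auto
  show ?thesis
  proof (cases u)
    case Fwd
    then have "reflect_interval n (toward u k \<delta>) \<tau> = shift_interval k (\<tau> (k - 1)) (if k = n then \<delta> else \<tau> k)"
      unfolding toward_def by (simp only: if_True refl reflect_interval.simps e)
    then show ?thesis using b Fwd by (auto simp: shift_interval_def)
  next
    case Bwd
    then have "reflect_interval n (toward u k \<delta>) \<tau> = shift_interval k (flip (\<tau> (k - 1))) (flip (if k = n then \<delta> else \<tau> k))"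
      unfolding toward_def by (simp only: direction.distinct if_False reflect_interval.simps e)
    then show ?thesis using b Bwd by (auto simp: shift_interval_def f)
  qed
qed

lemma run_reflections_single:
  assumes "\<forall>(b, d)\<in>#D. b < d"
  shows "run_reflections n [r] (\<tau>, D) = drop_simples (reflect_dirs r \<tau>, image_mset (reflect_interval n r \<tau>) D)"
proof -
  have "\<forall>(b, d)\<in>#D. b \<noteq> d" using assms by auto
  then show ?thesis unfolding run_reflections.simps by (simp only: drop_simples_ident reflect_diagram.simps)
qed

lemma lt_imp_non_simple: "\<forall>(b, d)\<in>#D. b < d \<Longrightarrow> \<forall>(b, d)\<in>#D. b \<noteq> (d :: nat)"
  by auto

lemma flip_neq: "x \<noteq> u \<longleftrightarrow> x = flip u"
  by (cases x; cases u) auto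

text \<open>If all intervals end at \<open>m\<close> or before, extend those that end at \<open>m\<close> to \<open>m + 1\<close>; this reverses the arrow between the two.
The arrow after \<open>m + 1\<close> now lies beyond the support and can be set by recursion (or by the choice of the padding
arrow if \<open>m + 1 = n\<close>) so that another reflection at \<open>m + 1\<close> takes the extension back.\<close>

lemma flip_arrow_beyond_support:
  assumes "1 \<le> m" "m < n" "\<forall>(b, d)\<in>#D. b < d \<and> d \<le> m"
  shows "\<exists>R\<in>reflection_sequences n. \<exists>\<tau>'. run_reflections n R (\<tau>, D) = (\<tau>', D) \<and> \<tau>' m = flip (\<tau> m) \<and> (\<forall>i<m. \<tau>' i = \<tau> i)"
  using assms
proof (induction "n - m" arbitrary: m \<tau> D)
  case 0
  then show ?case by simp
next
  case (Suc x)
  let ?u = "\<tau> m" and ?k = "m + 1"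
  \<comment> \<open>The diagram in which the intervals that end at \<open>m\<close> are extended to \<open>m + 1\<close>.\<close>
  define D1 where "D1 = image_mset (\<lambda>(b, d). (b, if d = m then ?k else d)) D"
  define \<tau>1 where "\<tau>1 = \<tau>(m := flip ?u, ?k := ?u)"
  have D: "\<forall>(b, d)\<in>#D. b < d" using Suc.prems(3) by auto
  have D1: "\<forall>(b, d)\<in>#D1. b < d \<and> d \<le> ?k" using Suc.prems(3) by (auto simp: D1_def)
  then have D1': "\<forall>(b, d)\<in>#D1. b < d" by auto
  have "image_mset (reflect_interval n (toward ?u ?k Fwd) \<tau>) D = D1"
    unfolding D1_def
  proof (rule image_mset_cong)
    fix z assume "z \<in># D"
    then obtain b d where z: "z = (b, d)" "b < d" "d \<le> m" using Suc.prems(3) by (cases z) auto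
    then show "reflect_interval n (toward ?u ?k Fwd) \<tau> z = (case z of (b, d) \<Rightarrow> (b, if d = m then ?k else d))"
      using reflect_interval_toward[of b d ?k n ?u Fwd \<tau>] Suc.prems(1,2) by auto
  qed
  then have run1: "run_reflections n [toward ?u ?k Fwd] (\<tau>, D) = (\<tau>1, D1)"
    using drop_simples_ident[OF lt_imp_non_simple[OF D1']] by (simp add: run_reflections_single[OF D] reflect_dirs_toward \<tau>1_def del: run_reflections.simps drop_simples.simps)
  obtain R2 \<tau>2 where R2: "R2 \<in> reflection_sequences n" "run_reflections n R2 (\<tau>1, D1) = (\<tau>2, D1)"
    "?k < n \<Longrightarrow> \<tau>2 ?k = flip ?u" "\<forall>i<?k. \<tau>2 i = \<tau>1 i"
  proof (cases "?k < n")
    case True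
    have "x = n - ?k" using Suc.hyps(2) by simp
    from Suc.hyps(1)[OF this _ True D1, of \<tau>1]
    obtain R \<tau>' where "R \<in> reflection_sequences n" "run_reflections n R (\<tau>1, D1) = (\<tau>', D1)" "\<tau>' ?k = flip (\<tau>1 ?k)"
      "\<forall>i<?k. \<tau>' i = \<tau>1 i" by auto
    then show ?thesis using that by (simp add: \<tau>1_def)
  next
    case False
    show ?thesis by (rule that[of "[]" \<tau>1]) (use False drop_simples_ident[OF lt_imp_non_simple[OF D1']] in \<open>auto simp: reflection_sequences_def\<close>)
  qed
  let ?r = "toward ?u ?k (flip ?u)"
  have \<tau>2m: "\<tau>2 m = flip ?u" using R2(4) by (simp add: \<tau>1_def)
  have fu: "flip v \<noteq> v" for v by (cases v) auto
  have "image_mset (reflect_interval n ?r \<tau>2) D1 = image_mset (\<lambda>z. z) D"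
    unfolding D1_def image_mset.compositionality
  proof (rule image_mset_cong)
    fix z assume "z \<in># D"
    then obtain b d where z: "z = (b, d)" "b < d" "d \<le> m" using Suc.prems(3) by (cases z) auto
    have c: "(if ?k = n then flip ?u else \<tau>2 ?k) \<noteq> ?u" using R2(3) Suc.prems(2) fu by auto
    show "(reflect_interval n ?r \<tau>2 \<circ> (\<lambda>(b, d). (b, if d = m then ?k else d))) z = z"
      using reflect_interval_toward[of b "if d = m then ?k else d" ?k n ?u "flip ?u" \<tau>2] z Suc.prems(1,2) c \<tau>2m fu
      by auto
  qed
  then have run3: "run_reflections n [?r] (\<tau>2, D1) = (\<tau>2(m := flip ?u, ?k := ?u), D)"
    using drop_simples_ident[OF lt_imp_non_simple[OF D]] by (simp add: run_reflections_single[OF D1'] reflect_dirs_toward del: run_reflections.simps drop_simples.simps)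
  let ?R = "[?r] @ R2 @ [toward ?u ?k Fwd]"
  have "run_reflections n ?R (\<tau>, D) = (\<tau>2(m := flip ?u, ?k := ?u), D)"
    unfolding run_reflections_append run1 R2(2) run3 ..
  moreover have "?R \<in> reflection_sequences n" using R2(1) Suc.prems(2) by (auto simp: reflection_sequences_def)
  moreover have "\<forall>i<m. (\<tau>2(m := flip ?u, ?k := ?u)) i = \<tau> i" using R2(4) by (auto simp: \<tau>1_def)
  ultimately show ?case by (intro bexI[of _ ?R] exI[of _ "\<tau>2(m := flip ?u, ?k := ?u)"]) auto
qed

text \<open>If the two arrows at \<open>m\<close> have the same direction, one of the two kinds of reflection at \<open>m\<close> shortens the intervals that
end at \<open>m\<close> and leaves those that end at \<open>m - 1\<close> alone.  The arrow after \<open>m\<close> can be adjusted by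
\<open>flip_arrow_beyond_support\<close>, or is a padding arrow.\<close>

lemma shrink_support:
  assumes "2 \<le> m" "m \<le> n" "\<forall>(b, d)\<in>#D. b < d \<and> d \<le> m \<and> 1 \<le> b"
  shows "\<exists>R\<in>reflection_sequences n. \<exists>\<tau>' D'. run_reflections n R (\<tau>, D) = (\<tau>', D') \<and> (\<forall>(b, d)\<in>#D'. b < d \<and> d \<le> m - 1 \<and> 1 \<le> b)"
proof -
  let ?v = "\<tau> (m - 1)"
  have D: "\<forall>(b, d)\<in>#D. b < d" "\<forall>(b, d)\<in>#D. b < d \<and> d \<le> m" using assms(3) by auto
  obtain R1 \<tau>1 where R1: "R1 \<in> reflection_sequences n" "run_reflections n R1 (\<tau>, D) = (\<tau>1, D)" "\<tau>1 (m - 1) = ?v"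
    "m < n \<Longrightarrow> \<tau>1 m = ?v"
  proof (cases "m < n \<and> \<tau> m \<noteq> ?v")
    case True
    then have "1 \<le> m" "m < n" using assms(1) by auto
    from flip_arrow_beyond_support[OF this D(2), of \<tau>]
    obtain R \<tau>' where R: "R \<in> reflection_sequences n" "run_reflections n R (\<tau>, D) = (\<tau>', D)" "\<tau>' m = flip (\<tau> m)"
      "\<forall>i<m. \<tau>' i = \<tau> i" by blast
    have "\<tau>' (m - 1) = ?v" using R(4) assms(1) by simp
    moreover have "\<tau>' m = ?v" using R(3) True flip_neq[of ?v "\<tau> m"] by auto
    ultimately show ?thesis using that[OF R(1,2)] by blast
  next
    case False
    show ?thesis by (rule that[of "[]" \<tau>]) (use False drop_simples_ident[OF lt_imp_non_simple[OF D(1)]] in \<open>auto simp: reflection_sequences_def\<close>)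
  qed
  let ?r = "toward (flip ?v) m ?v"
  have fv: "v \<noteq> flip v" for v by (cases v) auto
  have int: "reflect_interval n ?r \<tau>1 (b, d) = (b, if d = m then m - 1 else d)" if "(b, d) \<in># D" for b d
  proof -
    have bd: "b < d" "d \<le> m" using D(2) that by auto
    have "(if m = n then ?v else \<tau>1 m) \<noteq> flip ?v" using R1(4) assms(2) fv by auto
    then show ?thesis using reflect_interval_toward[OF bd assms(1,2), of "flip ?v" ?v \<tau>1] bd R1(3) fv by auto
  qed
  let ?D' = "snd (run_reflections n [?r] (\<tau>1, D))"
  have "b < d \<and> d \<le> m - 1 \<and> 1 \<le> b" if "(b, d) \<in># ?D'" for b d
  proof -
    have "(b, d) \<in># image_mset (reflect_interval n ?r \<tau>1) D" "b \<noteq> d"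
      using that by (auto simp: run_reflections_single[OF D(1)] simp del: run_reflections.simps)
    then obtain b0 d0 where "(b0, d0) \<in># D" "(b, d) = reflect_interval n ?r \<tau>1 (b0, d0)" by auto
    then have "b = b0" "d = (if d0 = m then m - 1 else d0)" "b0 < d0" "d0 \<le> m" "1 \<le> b0"
      using int assms(3) by auto
    then show ?thesis using \<open>b \<noteq> d\<close> by (auto split: if_splits)
  qed
  moreover have "run_reflections n ([?r] @ R1) (\<tau>, D) = (fst (run_reflections n [?r] (\<tau>1, D)), ?D')"
    unfolding run_reflections_append R1(2) by simp
  moreover have "[?r] @ R1 \<in> reflection_sequences n" using R1(1) assms by (auto simp: reflection_sequences_def)
  ultimately show ?thesis by blast
qed

lemma annihilating_sequence:
  assumes "\<forall>(b, d)\<in>#D. 1 \<le> b \<and> b \<le> d \<and> d \<le> n"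
  shows "\<exists>R\<in>reflection_sequences n. snd (run_reflections n R (\<tau>, D)) = {#}"
proof -
  have short: "\<exists>R\<in>reflection_sequences n. snd (run_reflections n R (\<tau>, D)) = {#}"
    if "m \<le> n" "\<forall>(b, d)\<in>#D. b < d \<and> d \<le> m \<and> 1 \<le> b" for m \<tau> D
    using that
  proof (induction m arbitrary: \<tau> D rule: less_induct)
    case (less m)
    show ?case
    proof (cases "2 \<le> m")
      case True
      then obtain R \<tau>' D' where R: "R \<in> reflection_sequences n" "run_reflections n R (\<tau>, D) = (\<tau>', D')"
        "\<forall>(b, d)\<in>#D'. b < d \<and> d \<le> m - 1 \<and> 1 \<le> b"
        using shrink_support[OF True less.prems] by blast
      have "m - 1 < m" "m - 1 \<le> n" using True less.prems(1) by auto
      from less.IH[OF this R(3), of \<tau>']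
      obtain R' where "R' \<in> reflection_sequences n" "snd (run_reflections n R' (\<tau>', D')) = {#}" by blast
      then show ?thesis using R by (intro bexI[of _ "R' @ R"]) (auto simp: run_reflections_append reflection_sequences_def)
    next
      case False
      have "z \<notin># D" for z using less.prems(2) False by (cases z) fastforce
      then have "D = {#}" by (simp add: multiset_eq_iff not_in_iff)
      then show ?thesis by (intro bexI[of _ "[]"]) (auto simp: reflection_sequences_def)
    qed
  qed
  have "\<forall>(b, d)\<in>#{#(b, d) \<in># D. b \<noteq> d#}. b < d \<and> d \<le> n \<and> 1 \<le> b" using assms by force
  from short[OF order_refl this, of \<tau>] obtain R where
    R: "R \<in> reflection_sequences n" "snd (run_reflections n R (drop_simples (\<tau>, D))) = {#}" by auto
  have "run_reflections n R (drop_simples (\<tau>, D)) = run_reflections n (R @ []) (\<tau>, D)" unfolding run_reflections_append by simp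
  then show ?thesis using R by auto
qed


section \<open>The distance\<close>

definition reach_length ::
  "nat \<Rightarrow> (nat \<Rightarrow> direction) \<times> (nat \<times> nat) multiset \<Rightarrow>
    (nat \<Rightarrow> direction) \<times> (nat \<times> nat) multiset \<Rightarrow> nat \<Rightarrow> bool" where
  "reach_length n x y m \<longleftrightarrow> (\<exists>R\<in>reflection_sequences n. length R = m \<and> diagram_le n (run_reflections n R x) y)"

definition dist_length ::
  "nat \<Rightarrow> (nat \<Rightarrow> direction) \<times> (nat \<times> nat) multiset \<Rightarrow>
    (nat \<Rightarrow> direction) \<times> (nat \<times> nat) multiset \<Rightarrow> nat" where
  "dist_length n x y = (LEAST m. \<exists>i j. m = max i j \<and> reach_length n x y i \<and> reach_length n y x j)"

lemma reach_length_exists: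
  assumes "\<forall>(b, d)\<in>#snd x. 1 \<le> b \<and> b \<le> d \<and> d \<le> n"
  shows "\<exists>m. reach_length n x y m"
proof -
  obtain R where "R \<in> reflection_sequences n" "snd (run_reflections n R x) = {#}"
    using annihilating_sequence[OF assms, of "fst x"] by auto
  then have "reach_length n x y (length R)" unfolding reach_length_def by (auto simp: diagram_le_def)
  then show ?thesis by blast
qed

text \<open>Monotonicity of reflection sequences under \<open>diagram_le\<close> is what makes lengths additive.\<close>

lemma reach_length_add:
  assumes "reach_length n x y i" "reach_length n y z j"
  shows "reach_length n x z (j + i)"
proof -
  obtain R where R: "R \<in> reflection_sequences n" "length R = i" "diagram_le n (run_reflections n R x) y"
    using assms(1) by (auto simp: reach_length_def)
  obtain Q where Q: "Q \<in> reflection_sequences n" "length Q = j" "diagram_le n (run_reflections n Q y) z"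
    using assms(2) by (auto simp: reach_length_def)
  have "diagram_le n (run_reflections n (Q @ R) x) z"
    unfolding run_reflections_append by (rule diagram_le_trans[OF diagram_le_run_reflections[OF Q(1) R(3)] Q(3)])
  moreover have "Q @ R \<in> reflection_sequences n" using Q R by (auto simp: reflection_sequences_def)
  ultimately show ?thesis unfolding reach_length_def using R Q by (intro bexI[of _ "Q @ R"]) auto
qed

lemma dist_length_props:
  assumes x: "\<forall>(b, d)\<in>#snd x. 1 \<le> b \<and> b \<le> d \<and> d \<le> n" and y: "\<forall>(b, d)\<in>#snd y. 1 \<le> b \<and> b \<le> d \<and> d \<le> n"
  shows "\<exists>i j. dist_length n x y = max i j \<and> reach_length n x y i \<and> reach_length n y x j"
  unfolding dist_length_def
  by (rule LeastI_ex) (use reach_length_exists[OF x, of y] reach_length_exists[OF y, of x] in blast)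

lemma dist_length_le: "reach_length n x y i \<Longrightarrow> reach_length n y x j \<Longrightarrow> dist_length n x y \<le> max i j"
  unfolding dist_length_def by (rule Least_le) blast

text \<open>For \<open>t\<close> between \<open>0\<close> and \<open>1\<close> we have \<open>t \<le> t powr q\<close>; apply this to the two fractions of \<open>x + y\<close>.\<close>

lemma powr_subadditive:
  fixes x y q :: real
  assumes "0 \<le> x" "0 \<le> y" "0 < q" "q \<le> 1"
  shows "(x + y) powr q \<le> x powr q + y powr q"
proof (cases "x + y = 0")
  case True
  then show ?thesis using assms by simp
next
  case False
  then have pos: "0 < x + y" using assms by simp
  have frac: "t \<le> t powr q" if "0 \<le> t" "t \<le> 1" for t
    using powr_mono'[of q 1 t] that assms(3,4) by (cases "t = 0") auto
  have "1 = x / (x + y) + y / (x + y)" using False by (simp add: add_divide_distrib[symmetric])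
  also have "\<dots> \<le> (x / (x + y)) powr q + (y / (x + y)) powr q"
    using assms pos by (intro add_mono frac) auto
  also have "\<dots> = (x powr q + y powr q) / (x + y) powr q"
    using assms by (simp add: powr_divide add_divide_distrib)
  finally show ?thesis using pos by (simp add: field_simps)
qed

lemma pseudometric_quotient:
  assumes pm: "pseudometric_on M d"
    and E: "E = {(x, y). x \<in> M \<and> y \<in> M \<and> d x y = 0}"
  shows "\<exists>D. Metric_space (M // E) D \<and> (\<forall>x\<in>M. \<forall>y\<in>M. D (E `` {x}) (E `` {y}) = d x y)"
proof -
  have nonneg: "\<And>x y. x \<in> M \<Longrightarrow> y \<in> M \<Longrightarrow> 0 \<le> d x y" and self: "\<And>x. x \<in> M \<Longrightarrow> d x x = 0"
    and sym: "\<And>x y. x \<in> M \<Longrightarrow> y \<in> M \<Longrightarrow> d x y = d y x"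
    and tri: "\<And>x y z. x \<in> M \<Longrightarrow> y \<in> M \<Longrightarrow> z \<in> M \<Longrightarrow> d x z \<le> d x y + d y z"
    using pm unfolding pseudometric_on_def by blast+
  define rep where "rep A = (SOME x. x \<in> A)" for A :: "'a set"
  define D where "D A B = (if A \<in> M // E \<and> B \<in> M // E then d (rep A) (rep B) else 0)" for A B
  have rep: "rep (E `` {x}) \<in> M" "d x (rep (E `` {x})) = 0" if "x \<in> M" for x
  proof -
    have "rep (E `` {x}) \<in> E `` {x}" unfolding rep_def by (rule someI[of _ x]) (use that self in \<open>auto simp: E\<close>)
    then show "rep (E `` {x}) \<in> M" "d x (rep (E `` {x})) = 0" by (auto simp: E)
  qed
  have eq: "d x z = d y z" if "x \<in> M" "y \<in> M" "z \<in> M" "d x y = 0" for x y z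
    using tri[of x y z] tri[of y x z] sym[of x y] that by simp
  have D: "D (E `` {x}) (E `` {y}) = d x y" if x: "x \<in> M" and y: "y \<in> M" for x y
  proof -
    have "D (E `` {x}) (E `` {y}) = d (rep (E `` {x})) (rep (E `` {y}))"
      using x y by (simp add: D_def quotientI)
    also have "\<dots> = d x (rep (E `` {y}))" using eq[OF x rep(1)[OF x] rep(1)[OF y] rep(2)[OF x]] by simp
    also have "\<dots> = d (rep (E `` {y})) x" by (rule sym[OF x rep(1)[OF y]])
    also have "\<dots> = d y x" using eq[OF y rep(1)[OF y] x rep(2)[OF y]] by simp
    also have "\<dots> = d x y" by (rule sym[OF y x])
    finally show ?thesis .
  qed
  have repM: "rep A \<in> M" if "A \<in> M // E" for A using that rep by (auto elim: quotientE)
  have "Metric_space (M // E) D"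
  proof
    show "0 \<le> D A B" for A B using nonneg repM by (simp add: D_def)
    show "D A B = D B A" for A B using sym repM by (simp add: D_def)
    show "D A C \<le> D A B + D B C" if "A \<in> M // E" "B \<in> M // E" "C \<in> M // E" for A B C
      using tri repM that by (simp add: D_def)
    show "D A B = 0 \<longleftrightarrow> A = B" if AB: "A \<in> M // E" "B \<in> M // E" for A B
    proof -
      obtain x y where xy: "x \<in> M" "y \<in> M" "A = E `` {x}" "B = E `` {y}" using AB by (auto elim!: quotientE)
      have "E `` {x} = E `` {y}" if "d x y = 0" using eq[OF xy(1,2) _ that] xy by (auto simp: E)
      moreover have "d x y = 0" if "E `` {x} = E `` {y}"
      proof -
        have "y \<in> E `` {x}" unfolding that using self xy by (auto simp: E)
        then show ?thesis by (auto simp: E)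
      qed
      ultimately show ?thesis using D xy by auto
    qed
  qed
  then show ?thesis using D by blast
qed

theorem theorem6p1:
  fixes scale :: "'a::field \<Rightarrow> 'v::ab_group_add \<Rightarrow> 'v" and n :: nat and p :: real
  assumes "vector_space scale"
    and "\<nexists>B. finite_dimensional_vector_space scale B"
    and "1 \<le> p"
  shows "pseudometric_on (zigzag_modules scale n) (reflection_dist scale n p) \<and>
    (\<forall>V\<in>zigzag_modules scale n. \<forall>W\<in>zigzag_modules scale n.
       reflection_dist scale n p V W = 0 \<longleftrightarrow> (V, W) \<in> equiv_upto_simples scale n) \<and>
    (\<exists>D. Metric_space (zigzag_modules scale n // equiv_upto_simples scale n) D \<and>
       (\<forall>V\<in>zigzag_modules scale n. \<forall>W\<in>zigzag_modules scale n.
          D (equiv_upto_simples scale n `` {V}) (equiv_upto_simples scale n `` {W})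
            = reflection_dist scale n p V W))"
proof -
  note s = assms(1) and inf = assms(2)
  let ?M = "zigzag_modules scale n" and ?d = "reflection_dist scale n p" and ?g = "diagram scale n"
  let ?E = "equiv_upto_simples scale n"
  define h where "h m = real m powr (1 / p)" for m
  have mono: "h i \<le> h j" if "i \<le> j" for i j
    unfolding h_def using that assms(3) by (intro powr_mono2) auto
  have h0: "h m = 0 \<longleftrightarrow> m = 0" for m using assms(3) by (simp add: h_def)
  have cost: "cost p R = h (length R)" for R by (simp add: cost_def h_def)
  have max: "max (h i) (h j) = h (max i j)" for i j using mono[of i j] mono[of j i] by (auto simp: max_def)
  have valid: "\<forall>(b, d)\<in>#snd (?g V). 1 \<le> b \<and> b \<le> d \<and> d \<le> n" if "V \<in> ?M" for V
    using Dgm_bounds[OF s that] by (auto simp: diagram_def)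
  have dist: "?d V W = h (dist_length n (?g V) (?g W))" if V: "V \<in> ?M" and W: "W \<in> ?M" for V W
  proof -
    have set: "(\<exists>R\<in>reflection_sequences n. \<exists>R'\<in>reflection_sequences n. c = max (cost p R) (cost p R') \<and>
        summand_upto_equiv scale n (apply_reflections scale n R V) W \<and>
        summand_upto_equiv scale n (apply_reflections scale n R' W) V) \<longleftrightarrow>
      (\<exists>i j. c = h (max i j) \<and> reach_length n (?g V) (?g W) i \<and> reach_length n (?g W) (?g V) j)" for c
      using summand_apply_reflections_iff[OF s inf V W] summand_apply_reflections_iff[OF s inf W V]
      unfolding reach_length_def cost max by blast
    show ?thesis
      unfolding reflection_dist_def set
    proof (rule Least_equality)
      show "\<exists>i j. h (dist_length n (?g V) (?g W)) = h (max i j) \<and>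
        reach_length n (?g V) (?g W) i \<and> reach_length n (?g W) (?g V) j"
        using dist_length_props[OF valid[OF V] valid[OF W]] by metis
      show "h (dist_length n (?g V) (?g W)) \<le> c"
        if "\<exists>i j. c = h (max i j) \<and> reach_length n (?g V) (?g W) i \<and> reach_length n (?g W) (?g V) j" for c
        using that dist_length_le mono by blast
    qed
  qed
  have zero: "?d V W = 0 \<longleftrightarrow> (V, W) \<in> ?E" if V: "V \<in> ?M" and W: "W \<in> ?M" for V W
  proof -
    have nil: "[] \<in> reflection_sequences n" by (simp add: reflection_sequences_def)
    have "dist_length n (?g V) (?g W) = 0 \<longleftrightarrow> reach_length n (?g V) (?g W) 0 \<and> reach_length n (?g W) (?g V) 0"
    proof
      assume "dist_length n (?g V) (?g W) = 0"
      then show "reach_length n (?g V) (?g W) 0 \<and> reach_length n (?g W) (?g V) 0"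
        using dist_length_props[OF valid[OF V] valid[OF W]] by auto
    next
      assume "reach_length n (?g V) (?g W) 0 \<and> reach_length n (?g W) (?g V) 0"
      then show "dist_length n (?g V) (?g W) = 0" using dist_length_le[of n "?g V" "?g W" 0 0] by simp
    qed
    also have "\<dots> \<longleftrightarrow> (V, W) \<in> ?E"
      using summand_apply_reflections_iff[OF s inf V W nil] summand_apply_reflections_iff[OF s inf W V nil] nil V W
      by (auto simp: equiv_upto_simples_def reach_length_def)
    finally show ?thesis by (simp add: dist[OF V W] h0)
  qed
  have self: "?d V V = 0" if "V \<in> ?M" for V
  proof -
    have "reach_length n (?g V) (?g V) 0"
      unfolding reach_length_def by (rule bexI[of _ "[]"]) (simp_all add: drop_simples_le reflection_sequences_def)
    then have "dist_length n (?g V) (?g V) = 0" using dist_length_le[of n "?g V" "?g V" 0 0] by simp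
    then show ?thesis by (simp add: dist[OF that that] h0)
  qed
  have tri: "?d V U \<le> ?d V W + ?d W U" if V: "V \<in> ?M" and W: "W \<in> ?M" and U: "U \<in> ?M" for V W U
  proof -
    let ?i = "dist_length n (?g V) (?g W)" and ?j = "dist_length n (?g W) (?g U)"
    obtain i1 i2 where i: "?i = max i1 i2" "reach_length n (?g V) (?g W) i1" "reach_length n (?g W) (?g V) i2"
      using dist_length_props[OF valid[OF V] valid[OF W]] by blast
    obtain j1 j2 where j: "?j = max j1 j2" "reach_length n (?g W) (?g U) j1" "reach_length n (?g U) (?g W) j2"
      using dist_length_props[OF valid[OF W] valid[OF U]] by blast
    \<comment> \<open>On the way back from \<open>U\<close> to \<open>V\<close> the order of the two sequences is exchanged.\<close>
    have "dist_length n (?g V) (?g U) \<le> max (j1 + i1) (i2 + j2)"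
      by (rule dist_length_le[OF reach_length_add[OF i(2) j(2)] reach_length_add[OF j(3) i(3)]])
    also have "\<dots> \<le> ?i + ?j" unfolding i(1) j(1) by auto
    finally have "h (dist_length n (?g V) (?g U)) \<le> h (?i + ?j)" by (rule mono)
    also have "\<dots> \<le> h ?i + h ?j"
      unfolding h_def of_nat_add using assms(3) by (intro powr_subadditive) auto
    finally show ?thesis by (simp add: dist V W U)
  qed
  have comm: "dist_length n x y = dist_length n y x" for x y
  proof -
    have "(\<exists>i j. m = max i j \<and> reach_length n x y i \<and> reach_length n y x j) \<longleftrightarrow>
      (\<exists>i j. m = max i j \<and> reach_length n y x i \<and> reach_length n x y j)" for m
      by (metis max.commute)
    then show ?thesis unfolding dist_length_def by simp
  qed
  have pm: "pseudometric_on ?M ?d"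
    unfolding pseudometric_on_def using self tri dist comm by (auto simp: h_def)
  have "?E = {(V, W). V \<in> ?M \<and> W \<in> ?M \<and> ?d V W = 0}"
    using zero by (auto simp: equiv_upto_simples_def)
  from pseudometric_quotient[OF pm this] show ?thesis using pm zero by blast
qed

end
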